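(* For any fixed integer $k$, there exists an algorithm running in $n^{O(k^{5^k})}$ time that decides, given a graph $G$ and $k$ pairs of vertices $(s_1,t_1),\dots,(s_k,t_k)$ of $G$, whether there exist $k$ internally vertex-disjoint paths $P_1,\dots,P_k$ in $G$ such that each $P_i$ is a shortest $(s_i,t_i)$-path.
   Context: Graphs are undirected, and $n$ denotes the number of vertices of $G$. The length of a path is its number of edges, and a shortest $(s,t)$-path is a path between $s$ and $t$ in $G$ of minimum length among all such paths. Paths are internally vertex-disjoint if no internal vertex of one of them is a vertex of another (they may share endpoints). *)

theory Defs
  imports "Graph_Theory.Graph_Theory" "HOL-Library.Landau_Symbols"
begin

section \<open>Disjoint shortest paths\<close>

text \<open>
  An undirected graph is a digraph with a symmetric arc relation; \<open>pair_graph\<close> is the class of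
  finite simple graphs. Paths are lists of arcs, so \<open>length p\<close> is the number of edges, and the
  empty list is the path of length 0 from a vertex to itself.
\<close>

context pre_digraph
begin

definition shortest_path :: "'a \<Rightarrow> 'b awalk \<Rightarrow> 'a \<Rightarrow> bool" where
  "shortest_path s p t \<longleftrightarrow> apath s p t \<and> (\<forall>q. apath s q t \<longrightarrow> length p \<le> length q)"

text \<open>
  The condition on \<open>i\<close> and \<open>j\<close> ranges over ordered pairs, hence is symmetric. The source \<open>fst (st ! j)\<close>
  is needed in \<open>awalk_verts\<close> to determine the vertex of an empty path.
\<close>

definition has_disjoint_shortest_paths :: "('a \<times> 'a) list \<Rightarrow> bool" where
  "has_disjoint_shortest_paths st \<longleftrightarrow>
     (\<exists>P. length P = length st \<and>
        (\<forall>i<length st. shortest_path (fst (st ! i)) (P ! i) (snd (st ! i))) \<and>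
        (\<forall>i<length st. \<forall>j<length st. i \<noteq> j \<longrightarrow>
           set (inner_verts (P ! i)) \<inter> set (awalk_verts (fst (st ! j)) (P ! j)) = {}))"

end

section \<open>Random access machines\<close>

text \<open>
  Structured programs for a random access machine with uniform cost. A program text mentions only
  finitely many registers, which are accessed directly; the memory is accessed indirectly, through
  an address held in a register. The arithmetic instructions are addition and truncated
  subtraction only: without multiplication, numbers computed in \<open>T\<close> steps have \<open>O(T)\<close> more bits
  than the input and the program constants, so uniform cost is polynomially related to Turing
  machine time.
\<close>

type_synonym reg = nat

datatype prog =
    Imm reg nat           \<comment> \<open>\<open>Imm r c\<close>: \<open>r := c\<close>\<close>
  | Add reg reg reg       \<comment> \<open>\<open>Add r a b\<close>: \<open>r := a + b\<close>\<close>
  | Sub reg reg reg       \<comment> \<open>\<open>Sub r a b\<close>: \<open>r := a - b\<close>, truncated at 0\<close>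
  | Load reg reg          \<comment> \<open>\<open>Load r a\<close>: \<open>r := memory[a]\<close>\<close>
  | Store reg reg         \<comment> \<open>\<open>Store a r\<close>: \<open>memory[a] := r\<close>\<close>
  | Seq prog prog
  | Cond reg prog prog    \<comment> \<open>tests whether the register is nonzero\<close>
  | While reg prog        \<comment> \<open>iterates as long as the register is nonzero\<close>

type_synonym state = "(nat \<Rightarrow> nat) \<times> (nat \<Rightarrow> nat)"  \<comment> \<open>registers and memory\<close>

text \<open>
  \<open>exec p \<sigma> T \<sigma>'\<close>: started in \<open>\<sigma>\<close>, the program \<open>p\<close> terminates in \<open>\<sigma>'\<close> after exactly \<open>T\<close> steps.
  Every instruction and every test takes one step.
\<close>

inductive exec :: "prog \<Rightarrow> state \<Rightarrow> nat \<Rightarrow> state \<Rightarrow> bool" where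
  Imm: "exec (Imm r c) (\<rho>, \<mu>) 1 (\<rho>(r := c), \<mu>)"
| Add: "exec (Add r a b) (\<rho>, \<mu>) 1 (\<rho>(r := \<rho> a + \<rho> b), \<mu>)"
| Sub: "exec (Sub r a b) (\<rho>, \<mu>) 1 (\<rho>(r := \<rho> a - \<rho> b), \<mu>)"
| Load: "exec (Load r a) (\<rho>, \<mu>) 1 (\<rho>(r := \<mu> (\<rho> a)), \<mu>)"
| Store: "exec (Store a r) (\<rho>, \<mu>) 1 (\<rho>, \<mu>(\<rho> a := \<rho> r))"
| Seq: "exec p \<sigma> T \<sigma>' \<Longrightarrow> exec q \<sigma>' T' \<sigma>'' \<Longrightarrow> exec (Seq p q) \<sigma> (T + T') \<sigma>''"
| Cond_True: "fst \<sigma> r \<noteq> 0 \<Longrightarrow> exec p \<sigma> T \<sigma>' \<Longrightarrow> exec (Cond r p q) \<sigma> (Suc T) \<sigma>'"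
| Cond_False: "fst \<sigma> r = 0 \<Longrightarrow> exec q \<sigma> T \<sigma>' \<Longrightarrow> exec (Cond r p q) \<sigma> (Suc T) \<sigma>'"
| While_False: "fst \<sigma> r = 0 \<Longrightarrow> exec (While r p) \<sigma> 1 \<sigma>"
| While_True: "fst \<sigma> r \<noteq> 0 \<Longrightarrow> exec p \<sigma> T \<sigma>' \<Longrightarrow> exec (While r p) \<sigma>' T' \<sigma>'' \<Longrightarrow>
    exec (While r p) \<sigma> (Suc (T + T')) \<sigma>''"

inductive_cases exec_elims:
  "exec (Imm r c) \<sigma> T \<sigma>'" "exec (Add r a b) \<sigma> T \<sigma>'" "exec (Sub r a b) \<sigma> T \<sigma>'"
  "exec (Load r a) \<sigma> T \<sigma>'" "exec (Store a r) \<sigma> T \<sigma>'" "exec (Seq p q) \<sigma> T \<sigma>'"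
  "exec (Cond r p q) \<sigma> T \<sigma>'" "exec (While r p) \<sigma> T \<sigma>'"

lemma exec_deterministic:
  "exec p \<sigma> T \<sigma>' \<Longrightarrow> exec p \<sigma> T1 \<sigma>1 \<Longrightarrow> T1 = T \<and> \<sigma>1 = \<sigma>'"
proof (induction arbitrary: T1 \<sigma>1 rule: exec.induct)
  case (Seq p \<sigma> T \<sigma>' q T' \<sigma>'')
  show ?case using Seq.prems by (rule exec_elims) (use Seq.IH in blast)
next
  case (Cond_True \<sigma> r p T \<sigma>' q)
  show ?case using Cond_True.prems by (rule exec_elims) (use Cond_True.hyps in \<open>auto dest!: Cond_True.IH\<close>)
next
  case (Cond_False \<sigma> r q T \<sigma>' p)
  show ?case using Cond_False.prems by (rule exec_elims) (use Cond_False.hyps in \<open>auto dest!: Cond_False.IH\<close>)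
next
  case (While_False \<sigma> r p)
  show ?case using While_False.prems by (rule exec_elims) (use While_False.hyps in auto)
next
  case (While_True \<sigma> r p T \<sigma>' T' \<sigma>'')
  show ?case using While_True.prems by (rule exec_elims) (use While_True.hyps(1) While_True.IH in \<open>simp, blast\<close>)
qed (auto elim: exec_elims)

text \<open>The input is placed in the first memory cells; all other cells and all registers are 0.\<close>

definition initial_state :: "nat list \<Rightarrow> state" where
  "initial_state xs = ((\<lambda>_. 0), (\<lambda>i. if i < length xs then xs ! i else 0))"

text \<open>On input \<open>xs\<close>, \<open>p\<close> halts after \<open>T\<close> steps with answer \<open>b\<close>, which it returns in register 0.\<close>

definition answers :: "prog \<Rightarrow> nat list \<Rightarrow> bool \<Rightarrow> nat \<Rightarrow> bool" where
  "answers p xs b T \<longleftrightarrow> (\<exists>\<rho> \<mu>. exec p (initial_state xs) T (\<rho>, \<mu>) \<and> (b \<longleftrightarrow> \<rho> 0 \<noteq> 0))"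

section \<open>Instances and their encoding\<close>

text \<open>
  As inputs of an algorithm, graphs have vertex set \<open>{0, ..., n - 1}\<close>. The encoding consists of \<open>n\<close>,
  the vertices \<open>s\<^sub>1, t\<^sub>1, ..., s\<^sub>k, t\<^sub>k\<close>, and the adjacency matrix, row by row.
\<close>

definition is_instance :: "nat \<Rightarrow> nat pair_pre_digraph \<Rightarrow> (nat \<times> nat) list \<Rightarrow> bool" where
  "is_instance k G st \<longleftrightarrow>
     pair_graph G \<and> pverts G = {..<card (pverts G)} \<and>
     length st = k \<and> set st \<subseteq> pverts G \<times> pverts G"

definition encode :: "nat pair_pre_digraph \<Rightarrow> (nat \<times> nat) list \<Rightarrow> nat list" where
  "encode G st = (let n = card (pverts G) in
     n # concat (map (\<lambda>(s, t). [s, t]) st) @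
     concat (map (\<lambda>u. map (\<lambda>v. of_bool ((u, v) \<in> parcs G)) [0..<n]) [0..<n]))"

end

theory Submission
  imports Defs
begin

text \<open>
  Let \<open>d\<^sub>i\<close> be the distance from \<open>s\<^sub>i\<close>. For a pair of shortest paths \<open>P\<^sub>i\<close>, \<open>P\<^sub>j\<close> there are a line
  \<open>d\<^sub>i - d\<^sub>j = u\<close> and a line \<open>d\<^sub>i + d\<^sub>j = w\<close> such that subpaths of \<open>P\<^sub>i\<close> and \<open>P\<^sub>j\<close> that do not change sides
  can have a vertex in common, even after rerouting them along other shortest paths, only on one of the lines.
  Cut each \<open>P\<^sub>i\<close> along these lines and along all their compositions
  \<open>d\<^sub>i \<plusminus> d\<^sub>l = c\<close>. The number of blocks depends on \<open>k\<close> only, and whenever two blocks can be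
  rerouted so that they meet, both are geodesic for the distance from one and the same terminal.

  Hence it suffices to guess the ends and the root of each block, to check that blocks with different roots
  cannot meet, and to find the blocks with a common root by moving one pebble per block, with the distance
  from the root as time. The reachable pebble configurations form a table that is defined by a first-order
  formula, and such tables can be computed within \<open>n\<close> to the power of the size of the formula.
\<close>

section \<open>Programs with time bounds\<close>

text \<open>The algorithm guesses only the ends of a block, so its pebbles may take other shortest
  paths than the solution did. Every statement about a block therefore has to hold on the whole
  interval between its ends. The lines come from monotonicity. Distances are 1-Lipschitz, so along
  P_i and all its reroutings both d_i - d_j and d_i + d_j are nondecreasing, while along P_j the
  difference is nonincreasing. In these two coordinates P_i climbs to the north-east and P_j to the
  north-west, and two such chains have a point none of whose open quadrants meets both. On a line,
  d_i and d_j change at the same rate up to sign, so a block of P_i is geodesic for d_j as well. To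
  find one root for blocks of several paths, such equations must be chained; this is why
  compositions are needed. A chain needs at most k^2 links and there are at most 4k^2 base lines,
  which gives at most (1 + 4k^2)^(k^2) lines with three sides each. The exponent is quadratic in the
  number of blocks because pairs of blocks are compared. It is of order k^(10k^2 + 6), below k^(5^k)
  for large k.\<close>

definition runs :: "prog \<Rightarrow> state \<Rightarrow> nat \<Rightarrow> (state \<Rightarrow> bool) \<Rightarrow> bool" where
  "runs p \<sigma> T Q \<longleftrightarrow> (\<exists>t \<sigma>'. exec p \<sigma> t \<sigma>' \<and> t \<le> T \<and> Q \<sigma>')"

lemma runs_mono:
  assumes "runs p \<sigma> T Q" "T \<le> T'" "\<And>\<sigma>'. Q \<sigma>' \<Longrightarrow> Q' \<sigma>'"
  shows "runs p \<sigma> T' Q'"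
  using assms unfolding runs_def by (meson order_trans)

lemma runs_Imm: "1 \<le> T \<Longrightarrow> Q (\<rho>(r := c), \<mu>) \<Longrightarrow> runs (Imm r c) (\<rho>, \<mu>) T Q"
  unfolding runs_def using exec.Imm by blast

lemma runs_Add: "1 \<le> T \<Longrightarrow> Q (\<rho>(r := \<rho> a + \<rho> b), \<mu>) \<Longrightarrow> runs (Add r a b) (\<rho>, \<mu>) T Q"
  unfolding runs_def using exec.Add by blast

lemma runs_Sub: "1 \<le> T \<Longrightarrow> Q (\<rho>(r := \<rho> a - \<rho> b), \<mu>) \<Longrightarrow> runs (Sub r a b) (\<rho>, \<mu>) T Q"
  unfolding runs_def using exec.Sub by blast

lemma runs_Load: "1 \<le> T \<Longrightarrow> Q (\<rho>(r := \<mu> (\<rho> a)), \<mu>) \<Longrightarrow> runs (Load r a) (\<rho>, \<mu>) T Q"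
  unfolding runs_def using exec.Load by blast

lemma runs_Store: "1 \<le> T \<Longrightarrow> Q (\<rho>, \<mu>(\<rho> a := \<rho> r)) \<Longrightarrow> runs (Store a r) (\<rho>, \<mu>) T Q"
  unfolding runs_def using exec.Store by blast

lemma runs_Seq:
  assumes "runs p \<sigma> T1 (\<lambda>\<sigma>'. runs q \<sigma>' T2 Q)" "T1 + T2 \<le> T"
  shows "runs (Seq p q) \<sigma> T Q"
proof -
  obtain t \<sigma>' where 1: "exec p \<sigma> t \<sigma>'" "t \<le> T1" "runs q \<sigma>' T2 Q"
    using assms(1) unfolding runs_def by blast
  then obtain t' \<sigma>'' where 2: "exec q \<sigma>' t' \<sigma>''" "t' \<le> T2" "Q \<sigma>''"
    unfolding runs_def by blast
  have "t + t' \<le> T" using 1 2 assms(2) by linarith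
  then show ?thesis unfolding runs_def using exec.Seq[OF 1(1) 2(1)] 2(3) by blast
qed

lemma runs_Cond:
  assumes "fst \<sigma> r \<noteq> 0 \<Longrightarrow> runs p \<sigma> T Q" "fst \<sigma> r = 0 \<Longrightarrow> runs q \<sigma> T Q" "T + 1 \<le> T'"
  shows "runs (Cond r p q) \<sigma> T' Q"
proof (cases "fst \<sigma> r = 0")
  case True
  then obtain t \<sigma>' where "exec q \<sigma> t \<sigma>'" "t \<le> T" "Q \<sigma>'"
    using assms(2) unfolding runs_def by blast
  with True show ?thesis using assms(3) unfolding runs_def
    by (intro exI[of _ "Suc t"] exI[of _ \<sigma>']) (auto intro: exec.Cond_False)
next
  case False
  then obtain t \<sigma>' where "exec p \<sigma> t \<sigma>'" "t \<le> T" "Q \<sigma>'"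
    using assms(1) unfolding runs_def by blast
  with False show ?thesis using assms(3) unfolding runs_def
    by (intro exI[of _ "Suc t"] exI[of _ \<sigma>']) (auto intro: exec.Cond_True)
qed

text \<open>The invariant is indexed by the number of remaining iterations, which yields termination
  and the bound together. Each iteration pays one step for its test, and the final failing test pays
  one more.\<close>

lemma runs_While:
  assumes body: "\<And>m \<sigma>. I (Suc m) \<sigma> \<Longrightarrow> fst \<sigma> r \<noteq> 0 \<and> runs p \<sigma> t (I m)"
    and stop: "\<And>\<sigma>. I 0 \<sigma> \<Longrightarrow> fst \<sigma> r = 0 \<and> Q \<sigma>"
    and start: "I m \<sigma>" and T: "m * (t + 1) + 1 \<le> T"
  shows "runs (While r p) \<sigma> T Q"
  using start T
proof (induction m arbitrary: \<sigma> T)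
  case 0
  then show ?case using stop[of \<sigma>] unfolding runs_def
    by (intro exI[of _ 1] exI[of _ \<sigma>]) (use exec.While_False in auto)
next
  case (Suc m)
  obtain t1 \<sigma>' where 1: "exec p \<sigma> t1 \<sigma>'" "t1 \<le> t" "I m \<sigma>'"
    using body[OF Suc.prems(1)] unfolding runs_def by blast
  have "runs (While r p) \<sigma>' (m * (t + 1) + 1) Q" by (rule Suc.IH[OF 1(3)]) simp
  then obtain t2 \<sigma>'' where 2: "exec (While r p) \<sigma>' t2 \<sigma>''" "t2 \<le> m * (t + 1) + 1" "Q \<sigma>''"
    unfolding runs_def by blast
  have "Suc (t1 + t2) \<le> T" using 1 2 Suc.prems(2) by simp
  moreover have "exec (While r p) \<sigma> (Suc (t1 + t2)) \<sigma>''"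
    using exec.While_True[OF _ 1(1) 2(1)] body[OF Suc.prems(1)] by blast
  ultimately show ?case using 2(3) unfolding runs_def by blast
qed

text \<open>
  Even registers hold variables, odd registers form the evaluation stack of compiled formulas:
  code compiled at depth \<open>d\<close> may overwrite \<open>sc j\<close> only for \<open>j \<ge> d\<close>. Register 0 is \<open>vr 0\<close>.
\<close>

definition vr :: "nat \<Rightarrow> reg" where "vr v = 2 * v"
definition sc :: "nat \<Rightarrow> reg" where "sc j = 2 * j + 1"

lemma vr_sc [simp]: "vr v \<noteq> sc j" "sc j \<noteq> vr v" "vr v = vr w \<longleftrightarrow> v = w" "sc i = sc j \<longleftrightarrow> i = j"
  unfolding vr_def sc_def by presburger+

definition agree :: "nat \<Rightarrow> (nat \<Rightarrow> nat) \<Rightarrow> (nat \<Rightarrow> nat) \<Rightarrow> bool" where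
  "agree d \<rho> \<rho>' \<longleftrightarrow> (\<forall>v. \<rho>' (vr v) = \<rho> (vr v)) \<and> (\<forall>j<d. \<rho>' (sc j) = \<rho> (sc j))"

lemma agree_refl [simp]: "agree d \<rho> \<rho>" by (simp add: agree_def)
lemma agree_trans [trans]: "agree d \<rho> \<rho>' \<Longrightarrow> agree d \<rho>' \<rho>'' \<Longrightarrow> agree d \<rho> \<rho>''"
  by (simp add: agree_def)
lemma agree_upd [simp]: "d \<le> j \<Longrightarrow> agree d \<rho> (\<rho>'(sc j := x)) \<longleftrightarrow> agree d \<rho> \<rho>'"
  by (auto simp: agree_def)
lemma agree_vr: "agree d \<rho> \<rho>' \<Longrightarrow> \<rho>' (vr v) = \<rho> (vr v)" by (simp add: agree_def)
lemma agree_sc: "agree d \<rho> \<rho>' \<Longrightarrow> j < d \<Longrightarrow> \<rho>' (sc j) = \<rho> (sc j)" by (simp add: agree_def)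

abbreviation (input) "vZ \<equiv> 4 :: nat"
abbreviation (input) "vO \<equiv> 2 :: nat"
abbreviation (input) "vN \<equiv> 3 :: nat"

text \<open>Three variables hold constants: adding \<open>vZ\<close> copies a register, subtracting
  \<open>vO\<close> decrements it, and subtracting from \<open>vO\<close> negates a truth
  value.\<close>

definition std :: "nat \<Rightarrow> (nat \<Rightarrow> nat) \<Rightarrow> bool" where
  "std n \<rho> \<longleftrightarrow> \<rho> (vr vZ) = 0 \<and> \<rho> (vr vO) = 1 \<and> \<rho> (vr vN) = n"

lemma std_agree: "agree d \<rho> \<rho>' \<Longrightarrow> std n \<rho> \<Longrightarrow> std n \<rho>'"
  by (simp add: std_def agree_def)

section \<open>Base-n numbering of vectors and table addresses\<close>

definition horner :: "nat \<Rightarrow> nat list \<Rightarrow> nat" where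
  "horner n vs = foldl (\<lambda>a v. a * n + v) 0 vs"

lemma foldl_horner: "foldl (\<lambda>a v. a * n + v) a vs = a * n ^ length vs + horner n (vs :: nat list)"
proof (induction vs arbitrary: a)
  case (Cons v vs)
  have "horner n (v # vs) = v * n ^ length vs + horner n vs"
    using Cons.IH[of v] by (simp add: horner_def)
  then show ?case using Cons.IH[of "a * n + v"] by (simp add: algebra_simps)
qed (simp add: horner_def)

lemma horner_Nil [simp]: "horner n [] = 0" by (simp add: horner_def)

lemma horner_Cons: "horner n (v # vs) = v * n ^ length vs + horner n vs"
  using foldl_horner[of n v vs] by (simp add: horner_def)

lemma horner_less: "set vs \<subseteq> {..<n} \<Longrightarrow> horner n vs < n ^ length vs"
proof (induction vs)
  case (Cons v vs)
  have "horner n (v # vs) < v * n ^ length vs + n ^ length vs"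
    using Cons by (simp add: horner_Cons)
  also have "\<dots> = (v + 1) * n ^ length vs" by simp
  also have "\<dots> \<le> n * n ^ length vs" by (rule mult_right_mono) (use Cons.prems in auto)
  finally show ?case by simp
qed simp

text \<open>By \<open>horner_less\<close> the leading digit is the quotient by its place value.
  Hence distinct vectors own distinct cells of a table.\<close>

lemma horner_inj:
  "length vs = length ws \<Longrightarrow> set vs \<subseteq> {..<n} \<Longrightarrow> set ws \<subseteq> {..<n} \<Longrightarrow>
    horner n vs = horner n ws \<longleftrightarrow> vs = ws"
proof (induction vs ws rule: list_induct2)
  case (Cons v vs w ws)
  let ?B = "n ^ length ws"
  have l: "horner n vs < ?B" "horner n ws < ?B"
    using horner_less[of vs n] horner_less[of ws n] Cons by auto
  have "horner n (v # vs) = horner n (w # ws) \<Longrightarrow> v = w \<and> horner n vs = horner n ws"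
  proof -
    assume *: "horner n (v # vs) = horner n (w # ws)"
    have "v = (v * ?B + horner n vs) div ?B" using l(1)
      by (metis add.commute add.right_neutral div_less div_mult_self1 mult.commute not_less_zero)
    also have "\<dots> = (w * ?B + horner n ws) div ?B" using * Cons.hyps by (simp add: horner_Cons)
    also have "\<dots> = w" using l(2)
      by (metis add.commute add.right_neutral div_less div_mult_self1 mult.commute not_less_zero)
    finally show ?thesis using * Cons.hyps by (simp add: horner_Cons)
  qed
  then show ?case using Cons by auto
qed simp

text \<open>The machine cannot multiply, so the product of \<open>sc d\<close> with n is formed by n
  additions. This is where the factor n in the cost of a table lookup comes from.\<close>

definition mulN :: "nat \<Rightarrow> prog" where
  "mulN d = Seq (Imm (sc (d+1)) 0) (Seq (Add (sc (d+2)) (vr vN) (vr vZ))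
    (While (sc (d+2)) (Seq (Add (sc (d+1)) (sc (d+1)) (sc d)) (Sub (sc (d+2)) (sc (d+2)) (vr vO)))))"

lemma runs_mulN:
  assumes "std n \<rho>" and Q: "\<And>\<rho>'. agree (d+1) \<rho> \<rho>' \<Longrightarrow> \<rho>' (sc (d+1)) = \<rho> (sc d) * n \<Longrightarrow> Q (\<rho>', \<mu>)"
  shows "runs (mulN d) (\<rho>, \<mu>) (3 * n + 3) Q"
proof -
  define I where "I m \<sigma> \<longleftrightarrow> (\<exists>\<rho>'. \<sigma> = (\<rho>', \<mu>) \<and> agree (d+1) \<rho> \<rho>' \<and> \<rho>' (sc (d+2)) = m \<and> m \<le> n \<and>
    \<rho>' (sc (d+1)) = \<rho> (sc d) * (n - m))" for m and \<sigma> :: state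
  show ?thesis
    unfolding mulN_def
    apply (rule runs_Seq[where ?T1.0 = 1 and ?T2.0 = "3 * n + 2"])
     apply (rule runs_Imm, simp)
     apply (rule runs_Seq[where ?T1.0 = 1 and ?T2.0 = "3 * n + 1"])
      apply (rule runs_Add, simp)
      apply (rule runs_While[where I = I and m = n and t = 2])
         subgoal for m \<sigma>
           unfolding I_def
           apply clarsimp
           apply (rule runs_Seq[where ?T1.0 = 1 and ?T2.0 = 1])
            apply (rule runs_Add, simp)
            apply (rule runs_Sub, simp)
           using assms(1) by (auto simp: std_def agree_vr agree_sc mult_Suc_right[symmetric]
             Suc_diff_Suc[symmetric] Suc_le_eq simp del: mult_Suc_right) (simp add: algebra_simps)
         subgoal for \<sigma> unfolding I_def using Q by auto
        subgoal using assms(1) unfolding I_def std_def by simp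
       by simp_all
qed

text \<open>The accumulator is \<open>sc d\<close>. The language has no empty program, so the base
  case writes to a scratch register above it.\<close>

primrec horner_prog :: "nat \<Rightarrow> nat list \<Rightarrow> prog" where
  "horner_prog d [] = Imm (sc (d+1)) 0"
| "horner_prog d (r # rs) = Seq (mulN d) (Seq (Add (sc d) (sc (d+1)) (vr r)) (horner_prog d rs))"

lemma runs_horner_prog:
  assumes "std n \<rho>"
    and Q: "\<And>\<rho>'. agree d \<rho> \<rho>' \<Longrightarrow>
      \<rho>' (sc d) = foldl (\<lambda>a v. a * n + v) (\<rho> (sc d)) (map (\<lambda>r. \<rho> (vr r)) rs) \<Longrightarrow> Q (\<rho>', \<mu>)"
  shows "runs (horner_prog d rs) (\<rho>, \<mu>) (length rs * (3 * n + 4) + 1) Q"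
  using assms
proof (induction rs arbitrary: \<rho>)
  case Nil
  then show ?case by (auto intro!: runs_Imm Nil simp: agree_def)
next
  case (Cons r rs)
  show ?case
    unfolding horner_prog.simps
    apply (rule runs_Seq[where ?T1.0 = "3 * n + 3" and ?T2.0 = "1 + (length rs * (3 * n + 4) + 1)"])
     apply (rule runs_mulN[OF Cons.prems(1)])
     apply (rule runs_Seq[where ?T1.0 = 1, OF _ order.refl])
     apply (rule runs_Add, simp)
     apply (rule Cons.IH)
    subgoal for \<rho>' using Cons.prems(1) by (auto simp: std_def agree_vr)
    subgoal for \<rho>1 \<rho>2
      apply (rule Cons.prems(2))
      subgoal by (rule agree_trans[of _ _ "\<rho>1(sc d := \<rho>1 (sc (d + 1)) + \<rho>1 (vr r))"])
          (auto simp: agree_def)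
      subgoal by (auto simp: agree_vr cong: map_cong)
      done
    by simp
qed

definition address_prog :: "nat \<Rightarrow> nat \<Rightarrow> nat list \<Rightarrow> prog" where
  "address_prog d b rs = Seq (Imm (sc d) 0) (Seq (horner_prog d rs) (Add (sc d) (sc d) (vr b)))"

lemma runs_address_prog:
  assumes "std n \<rho>"
    and Q: "\<And>\<rho>'. agree d \<rho> \<rho>' \<Longrightarrow>
      \<rho>' (sc d) = \<rho> (vr b) + horner n (map (\<lambda>r. \<rho> (vr r)) rs) \<Longrightarrow> Q (\<rho>', \<mu>)"
  shows "runs (address_prog d b rs) (\<rho>, \<mu>) (length rs * (3 * n + 4) + 3) Q"
  unfolding address_prog_def
  apply (rule runs_Seq[where ?T1.0 = 1 and ?T2.0 = "length rs * (3 * n + 4) + 2"])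
   apply (rule runs_Imm, simp)
   apply (rule runs_Seq[where ?T1.0 = "length rs * (3 * n + 4) + 1" and ?T2.0 = 1])
    apply (rule runs_horner_prog)
  subgoal using assms(1) by (simp add: std_def)
  subgoal for \<rho>'
    apply (rule runs_Add, simp)
    apply (rule Q)
     apply (simp add: agree_def)
    by (simp add: agree_vr horner_def add.commute)
  by simp_all

section \<open>First-order formulas over tables and their compilation\<close>

text \<open>
  \<open>Le a b c d\<close> compares \<open>a + b\<close> with \<open>c + d\<close>; \<open>Tab b rs\<close> looks up the table that starts at the address
  held in variable \<open>b\<close>; \<open>Ex\<close> ranges over \<open>{..<n}\<close>. Every nonzero value counts as true.
\<close>

datatype fm =
    Le nat nat nat nat
  | Tab nat "nat list"
  | Neg fm
  | Conj fm fm
  | Ex nat fm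

primrec sat :: "nat \<Rightarrow> (nat \<Rightarrow> nat) \<Rightarrow> (nat \<Rightarrow> nat) \<Rightarrow> fm \<Rightarrow> bool" where
  "sat n \<mu> e (Le a b c d) \<longleftrightarrow> e a + e b \<le> e c + e d"
| "sat n \<mu> e (Tab b rs) \<longleftrightarrow> \<mu> (e b + horner n (map e rs)) \<noteq> 0"
| "sat n \<mu> e (Neg f) \<longleftrightarrow> \<not> sat n \<mu> e f"
| "sat n \<mu> e (Conj f g) \<longleftrightarrow> sat n \<mu> e f \<and> sat n \<mu> e g"
| "sat n \<mu> e (Ex v f) \<longleftrightarrow> (\<exists>x<n. sat n \<mu> (e(v := x)) f)"

text \<open>A quantifier uses its variable as a loop counter, so it must not bind the answer
  variable 0 or the constants 2, 3 and 4.\<close>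

primrec wf_fm :: "fm \<Rightarrow> bool" where
  "wf_fm (Le a b c d) \<longleftrightarrow> True"
| "wf_fm (Tab b rs) \<longleftrightarrow> True"
| "wf_fm (Neg f) \<longleftrightarrow> wf_fm f"
| "wf_fm (Conj f g) \<longleftrightarrow> wf_fm f \<and> wf_fm g"
| "wf_fm (Ex v f) \<longleftrightarrow> 5 \<le> v \<and> wf_fm f"

text \<open>With truncated subtraction, 1 - (x - y) is nonzero iff x \<le> y, and 1 - x negates. For
  \<open>Ex\<close>, \<open>sc d\<close> saves the old value of the variable,
  \<open>sc (d+1)\<close> is the flag for a witness found, and the variable itself counts down from
  n, being decremented before each test. The assignments of 0 in the branches of \<open>Cond\<close>
  are dummies or leave a false value in place.\<close>

primrec compile :: "nat \<Rightarrow> fm \<Rightarrow> prog" where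
  "compile d (Le a b c e) = Seq (Add (sc d) (vr a) (vr b)) (Seq (Add (sc (d+1)) (vr c) (vr e))
     (Seq (Sub (sc d) (sc d) (sc (d+1))) (Sub (sc d) (vr vO) (sc d))))"
| "compile d (Tab b rs) = Seq (address_prog d b rs) (Load (sc d) (sc d))"
| "compile d (Neg f) = Seq (compile d f) (Sub (sc d) (vr vO) (sc d))"
| "compile d (Conj f g) = Seq (compile d f) (Cond (sc d) (compile d g) (Imm (sc (d+1)) 0))"
| "compile d (Ex v f) = Seq (Add (sc d) (vr v) (vr vZ)) (Seq (Imm (sc (d+1)) 0)
     (Seq (Add (vr v) (vr vN) (vr vZ))
     (Seq (While (vr v) (Seq (Sub (vr v) (vr v) (vr vO)) (Seq (compile (d+2) f)
        (Cond (sc (d+2)) (Imm (sc (d+1)) 1) (Imm (sc (d+2)) 0)))))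
     (Seq (Add (vr v) (sc d) (vr vZ)) (Add (sc d) (sc (d+1)) (vr vZ))))))"

primrec fm_time :: "nat \<Rightarrow> fm \<Rightarrow> nat" where
  "fm_time n (Le a b c d) = 4"
| "fm_time n (Tab b rs) = length rs * (3 * n + 4) + 4"
| "fm_time n (Neg f) = fm_time n f + 1"
| "fm_time n (Conj f g) = fm_time n f + fm_time n g + 2"
| "fm_time n (Ex v f) = n * (fm_time n f + 4) + 6"

abbreviation (input) env :: "(nat \<Rightarrow> nat) \<Rightarrow> nat \<Rightarrow> nat" where "env \<rho> \<equiv> (\<lambda>v. \<rho> (vr v))"

lemma env_upd_sc [simp]: "env (\<rho>(sc j := x)) = env \<rho>" by auto
lemma env_agree: "agree d \<rho> \<rho>' \<Longrightarrow> env \<rho>' = env \<rho>" by (auto simp: agree_def)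
lemma env_upd_vr [simp]: "env (\<rho>(vr v := x)) = (env \<rho>)(v := x)" by auto

lemma runs_compile:
  assumes "wf_fm f" "std n \<rho>"
    and Q: "\<And>\<rho>'. agree d \<rho> \<rho>' \<Longrightarrow> \<rho>' (sc d) \<noteq> 0 \<longleftrightarrow> sat n \<mu> (env \<rho>) f \<Longrightarrow> Q (\<rho>', \<mu>)"
  shows "runs (compile d f) (\<rho>, \<mu>) (fm_time n f) Q"
  using assms
proof (induction f arbitrary: d \<rho> Q)
  case (Le a b c e)
  show ?case
    unfolding compile.simps
    apply (rule runs_Seq[where ?T1.0 = 1 and ?T2.0 = 3])
     apply (rule runs_Add, simp)
     apply (rule runs_Seq[where ?T1.0 = 1 and ?T2.0 = 2])
      apply (rule runs_Add, simp)
      apply (rule runs_Seq[where ?T1.0 = 1 and ?T2.0 = 1])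
       apply (rule runs_Sub, simp)
       apply (rule runs_Sub, simp)
       apply (rule Le.prems(3))
    using Le.prems(2) by (auto simp: std_def agree_def)
next
  case (Tab b rs)
  show ?case
    unfolding compile.simps fm_time.simps
    apply (rule runs_Seq[where ?T2.0 = 1])
     apply (rule runs_address_prog[OF Tab.prems(2)])
     apply (rule runs_Load, simp)
     apply (rule Tab.prems(3))
    by (auto simp: agree_def)
next
  case (Neg f)
  show ?case
    unfolding compile.simps fm_time.simps
    apply (rule runs_Seq[where ?T2.0 = 1])
     apply (rule Neg.IH)
    using Neg.prems(1,2) apply simp_all
    apply (rule runs_Sub, simp)
    apply (rule Neg.prems(3))
     apply (auto simp: std_def agree_def)
    done
next
  case (Conj f g)
  show ?case
    unfolding compile.simps fm_time.simps
    apply (rule runs_Seq[where ?T2.0 = "fm_time n g + 2"])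
     apply (rule Conj.IH(1))
    using Conj.prems(1,2) apply simp_all
    subgoal for \<rho>'
      apply (rule runs_Cond[where T = "fm_time n g + 1"])
      subgoal
        apply (rule runs_mono[where T = "fm_time n g" and Q = Q])
        apply (rule Conj.IH(2))
        subgoal by simp
        subgoal by (rule std_agree)
        subgoal for \<rho>2
          apply (rule Conj.prems(3))
           apply (erule (1) agree_trans)
          by (simp add: env_agree)
        by simp_all
      subgoal
        apply (rule runs_Imm, simp)
        apply (rule Conj.prems(3))
        by (simp_all add: agree_def)
      by simp
    done
next
  case (Ex v f)
  \<comment> \<open>The values from \<open>m\<close> up to n - 1 have been tried, and the flag
    \<open>F\<close> tells whether one of them is a witness.\<close>
  define I where "I m \<sigma> \<longleftrightarrow> (\<exists>\<rho>' F. \<sigma> = (\<rho>', \<mu>) \<and>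
    agree (d+2) (\<rho>(sc d := \<rho> (vr v), sc (d+1) := F, vr v := m)) \<rho>' \<and>
    (F \<noteq> 0 \<longleftrightarrow> (\<exists>x<n. m \<le> x \<and> sat n \<mu> ((env \<rho>)(v := x)) f)))" for m and \<sigma> :: state
  have v: "5 \<le> v" "wf_fm f" using Ex.prems(1) by auto
  have body: "runs (Seq (Sub (vr v) (vr v) (vr vO)) (Seq (compile (d+2) f)
        (Cond (sc (d+2)) (Imm (sc (d+1)) 1) (Imm (sc (d+2)) 0)))) \<sigma> (fm_time n f + 3) (I m)"
    if I: "I (Suc m) \<sigma>" and mn: "m < n" for m \<sigma>
  proof -
    obtain \<rho>' F where \<rho>': "\<sigma> = (\<rho>', \<mu>)"
      "agree (d+2) (\<rho>(sc d := \<rho> (vr v), sc (d+1) := F, vr v := Suc m)) \<rho>'"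
      "F \<noteq> 0 \<longleftrightarrow> (\<exists>x<n. Suc m \<le> x \<and> sat n \<mu> ((env \<rho>)(v := x)) f)"
      using I unfolding I_def by blast
    have vv: "\<rho>' (vr v) = Suc m" "\<rho>' (vr vO) = 1" "\<rho>' (vr vZ) = 0" "\<rho>' (vr vN) = n"
      using v Ex.prems(2) by (auto simp: agree_vr[OF \<rho>'(2)] std_def)
    have e: "env (\<rho>'(vr v := m)) = (env \<rho>)(v := m)"
      using agree_vr[OF \<rho>'(2)] by (auto simp: fun_eq_iff)
    have lt: "(\<exists>x<n. m \<le> x \<and> P x) \<longleftrightarrow> P m \<or> (\<exists>x<n. Suc m \<le> x \<and> P x)" for P
      using mn by (metis Suc_leD Suc_leI le_eq_less_or_eq)
    have finish: "I m (\<rho>3, \<mu>)" if "agree (d+2) (\<rho>'(vr v := m, sc (d+1) := F')) \<rho>3"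
        "F' \<noteq> 0 \<longleftrightarrow> sat n \<mu> (env (\<rho>'(vr v := m))) f \<or> F \<noteq> 0" for \<rho>3 F'
      unfolding I_def lt
      using that \<rho>'(2,3) unfolding e
      by (intro exI[of _ \<rho>3] exI[of _ F'] conjI) (auto simp: agree_def less_Suc_eq)
    have F: "\<rho>' (sc (d+1)) = F" using agree_sc[OF \<rho>'(2)] by simp
    show ?thesis
      unfolding \<rho>'(1)
      apply (rule runs_Seq[where ?T1.0 = 1 and ?T2.0 = "fm_time n f + 2"])
       apply (rule runs_Sub, simp)
       apply (rule runs_Seq[where ?T1.0 = "fm_time n f" and ?T2.0 = "2"])
        apply (rule Ex.IH[OF v(2)])
      subgoal using vv v by (simp add: std_def)
      subgoal for \<rho>2
        apply (rule runs_Cond[where T = 1])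
        subgoal
          apply (rule runs_Imm, simp)
          apply (rule finish[of 1])
          subgoal using vv by (auto simp: agree_def less_Suc_eq)
          subgoal using vv by auto
          done
        subgoal
          apply (rule runs_Imm, simp)
          apply (rule finish[of F])
          subgoal using vv F by (auto simp: agree_def less_Suc_eq)
          subgoal using vv by auto
          done
        by simp
      by simp_all
  qed
  have stop: "fst \<sigma> (vr v) = 0 \<and>
      runs (Seq (Add (vr v) (sc d) (vr vZ)) (Add (sc d) (sc (d+1)) (vr vZ))) \<sigma> 2 Q"
    if I0: "I 0 \<sigma>" for \<sigma>
  proof -
    obtain \<rho>' F where \<rho>': "\<sigma> = (\<rho>', \<mu>)"
      "agree (d+2) (\<rho>(sc d := \<rho> (vr v), sc (d+1) := F, vr v := 0)) \<rho>'"
      "F \<noteq> 0 \<longleftrightarrow> (\<exists>x<n. sat n \<mu> ((env \<rho>)(v := x)) f)"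
      using I0 unfolding I_def by auto
    have "\<rho>' (vr v) = 0" "\<rho>' (vr vZ) = 0" "\<rho>' (sc d) = \<rho> (vr v)" "\<rho>' (sc (d + 1)) = F"
      using v Ex.prems(2) by (auto simp: agree_vr[OF \<rho>'(2)] agree_sc[OF \<rho>'(2)] std_def)
    then show ?thesis
      unfolding \<rho>'(1)
      apply (intro conjI)
       apply simp
      apply (rule runs_Seq[where ?T1.0 = 1 and ?T2.0 = "1"])
       apply (rule runs_Add, simp)
       apply (rule runs_Add, simp)
       apply (rule Ex.prems(3))
      subgoal using v \<rho>'(2) by (auto simp: agree_def less_Suc_eq)
      subgoal using v \<rho>'(3) by auto
      by simp
  qed
  have start: "I n (\<rho>', \<mu>)" if "\<rho>' = \<rho>(sc d := \<rho> (vr v), sc (d+1) := 0, vr v := n)" for \<rho>'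
    unfolding I_def using that by (intro exI[of _ \<rho>'] exI[of _ 0]) auto
  have nonz: "fst \<sigma> (vr v) \<noteq> 0" if "I (Suc m) \<sigma>" for m \<sigma>
    using that unfolding I_def by (auto simp: agree_def)
  have while: "runs (While (vr v) (Seq (Sub (vr v) (vr v) (vr vO)) (Seq (compile (d+2) f)
        (Cond (sc (d+2)) (Imm (sc (d+1)) 1) (Imm (sc (d+2)) 0))))) (\<rho>', \<mu>) (n * (fm_time n f + 4) + 1)
       (\<lambda>\<sigma>. runs (Seq (Add (vr v) (sc d) (vr vZ)) (Add (sc d) (sc (d+1)) (vr vZ))) \<sigma> 2 Q)"
    if "\<rho>' = \<rho>(sc d := \<rho> (vr v), sc (d+1) := 0, vr v := n)" for \<rho>'
    apply (rule runs_While[where I = "\<lambda>m \<sigma>. m \<le> n \<and> I m \<sigma>" and m = n and t = "fm_time n f + 3"])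
    subgoal for m \<sigma>
      apply (intro conjI)
       apply (rule nonz, blast)
      apply (rule runs_mono[OF body[of m]])
      by auto
    subgoal using stop by blast
    subgoal using start[OF that] by simp
    by simp
  have st: "\<rho> (vr vZ) = 0" "\<rho> (vr vN) = n" using Ex.prems(2) by (auto simp: std_def)
  show ?case
    unfolding compile.simps fm_time.simps
    apply (rule runs_Seq[where ?T1.0 = 1 and ?T2.0 = "n * (fm_time n f + 4) + 5"])
     apply (rule runs_Add, simp)
     apply (rule runs_Seq[where ?T1.0 = 1 and ?T2.0 = "n * (fm_time n f + 4) + 4"])
      apply (rule runs_Imm, simp)
      apply (rule runs_Seq[where ?T1.0 = 1 and ?T2.0 = "n * (fm_time n f + 4) + 3"])
       apply (rule runs_Add, simp)
       apply (rule runs_Seq[where ?T1.0 = "n * (fm_time n f + 4) + 1" and ?T2.0 = "2"])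
        apply (rule while)
        apply (simp add: st)
       by simp_all
qed

section \<open>Filling tables\<close>

definition vecs :: "nat \<Rightarrow> nat \<Rightarrow> nat list set" where
  "vecs n m = {ws. length ws = m \<and> set ws \<subseteq> {..<n}}"

definition ext :: "nat \<Rightarrow> nat list \<Rightarrow> nat \<Rightarrow> nat list set" where
  "ext n pv m = (\<lambda>ws. pv @ ws) ` vecs n m"

text \<open>Only true entries are written. A false entry is correct because the memory from the
  table on is still zero, which \<open>filled_in\<close> has to assume.\<close>

definition filled :: "nat \<Rightarrow> nat \<Rightarrow> (nat list \<Rightarrow> bool) \<Rightarrow> (nat \<Rightarrow> nat) \<Rightarrow> nat list set \<Rightarrow> nat \<Rightarrow> nat" where
  "filled n base P \<mu> D = (\<lambda>a. if \<exists>ws\<in>D. a = base + horner n ws \<and> P ws then 1 else \<mu> a)"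

text \<open>
  Tables are filled in increasing order of the first coordinate, so that a row may be defined by
  a formula that refers to the rows \<open>below\<close> it.
\<close>

definition below :: "nat \<Rightarrow> nat \<Rightarrow> nat \<Rightarrow> nat list set" where
  "below n m x = {ws \<in> vecs n m. hd ws < x}"

lemma filled_empty [simp]: "filled n base P \<mu> {} = \<mu>"
  by (simp add: filled_def)

lemma filled_insert: "filled n base P \<mu> (insert ws D) =
   (if P ws then (filled n base P \<mu> D)(base + horner n ws := 1) else filled n base P \<mu> D)"
  by (auto simp: filled_def fun_eq_iff)

lemma ext_0 [simp]: "ext n pv 0 = {pv}"
  by (auto simp: ext_def vecs_def)

lemma ext_Suc: "ext n pv (Suc m) = (\<Union>x<n. ext n (pv @ [x]) m)"
proof -
  have "vecs n (Suc m) = (\<Union>x<n. (\<lambda>ws. x # ws) ` vecs n m)"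
    by (auto simp: vecs_def image_iff length_Suc_conv)
  then show ?thesis by (auto simp: ext_def image_iff)
qed

lemma ext_Nil [simp]: "ext n [] m = vecs n m" by (simp add: ext_def)

lemma ext_subset: "pv \<in> vecs n m \<Longrightarrow> ext n pv m' \<subseteq> vecs n (m + m')"
  by (auto simp: ext_def vecs_def)

text \<open>The variant of \<open>agree\<close> for filling, which leaves the loop variables in
  \<open>R\<close> changed.\<close>

definition agreeX :: "nat \<Rightarrow> nat set \<Rightarrow> (nat \<Rightarrow> nat) \<Rightarrow> (nat \<Rightarrow> nat) \<Rightarrow> bool" where
  "agreeX d R \<rho> \<rho>' \<longleftrightarrow> (\<forall>v. v \<notin> R \<longrightarrow> \<rho>' (vr v) = \<rho> (vr v)) \<and> (\<forall>j<d. \<rho>' (sc j) = \<rho> (sc j))"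

definition fill_step :: "nat \<Rightarrow> nat list \<Rightarrow> fm \<Rightarrow> nat \<Rightarrow> prog" where
  "fill_step b rs f d = Seq (compile d f)
     (Cond (sc d) (Seq (address_prog d b rs) (Store (sc d) (vr vO))) (Imm (sc d) 0))"

definition fill_step_time :: "nat \<Rightarrow> nat list \<Rightarrow> fm \<Rightarrow> nat" where
  "fill_step_time n rs f = fm_time n f + (length rs * (3 * n + 4) + 5)"

text \<open>One loop per coordinate, the first coordinate outermost, so that whole rows are
  completed in increasing order. The coordinate counts up while \<open>sc d\<close> counts the
  remaining iterations.\<close>

primrec fill :: "nat \<Rightarrow> nat list \<Rightarrow> (nat \<Rightarrow> prog) \<Rightarrow> prog" where
  "fill d [] body = body d"
| "fill d (r # rs) body = Seq (Imm (vr r) 0) (Seq (Add (sc d) (vr vN) (vr vZ))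
     (While (sc d) (Seq (fill (d+1) rs body)
        (Seq (Add (vr r) (vr r) (vr vO)) (Sub (sc d) (sc d) (vr vO))))))"

primrec fill_time :: "nat \<Rightarrow> nat \<Rightarrow> nat list \<Rightarrow> nat" where
  "fill_time n t [] = t"
| "fill_time n t (r # rs) = n * (fill_time n t rs + 3) + 3"

lemma runs_fill_step:
  assumes "std n \<rho>" "wf_fm f" "base = \<rho> (vr b)"
    and sat: "sat n (filled n base P \<mu> D) (env \<rho>) f \<longleftrightarrow> P (map (env \<rho>) rs)"
    and Q: "\<And>\<rho>'. agree d \<rho> \<rho>' \<Longrightarrow> Q (\<rho>', filled n base P \<mu> (insert (map (env \<rho>) rs) D))"
  shows "runs (fill_step b rs f d) (\<rho>, filled n base P \<mu> D) (fill_step_time n rs f) Q"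
proof -
  have t: "Q (\<rho>', (filled n base P \<mu> D)(base + horner n (map (env \<rho>) rs) := 1))"
    if "sat n (filled n base P \<mu> D) (env \<rho>) f" "agree d \<rho> \<rho>'" for \<rho>'
    using Q[OF that(2)] that(1) sat by (simp only: filled_insert if_True)
  have f: "Q (\<rho>', filled n base P \<mu> D)"
    if "\<not> sat n (filled n base P \<mu> D) (env \<rho>) f" "agree d \<rho> \<rho>'" for \<rho>'
    using Q[OF that(2)] that(1) sat by (simp only: filled_insert if_False)
  have O: "\<rho> (vr vO) = 1" using assms(1) by (simp add: std_def)
  show ?thesis
  unfolding fill_step_def fill_step_time_def
  apply (rule runs_Seq[OF _ order.refl])
  apply (rule runs_compile[OF assms(2,1)])
  subgoal for \<rho>1
    apply (rule runs_Cond[where T = "length rs * (3 * n + 4) + 4"])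
    subgoal
      apply (rule runs_Seq[where ?T2.0 = 1])
       apply (rule runs_address_prog)
        apply (rule std_agree, assumption, rule assms(1))
      subgoal for \<rho>2
        apply (rule runs_Store, simp)
        using t[of \<rho>2] agree_trans[of d \<rho> \<rho>1 \<rho>2] assms(3) O
        by (simp add: agree_vr[of d \<rho> \<rho>1] agree_vr[of d \<rho>1 \<rho>2])
      by simp
    subgoal
      apply (rule runs_Imm, simp)
      using f[of "\<rho>1(sc d := 0)"] by (simp add: agree_def)
    by simp
  done
qed

text \<open>Generalised for the induction: the variables \<open>pre\<close> of the outer loops are
  fixed and the entries in \<open>D\<close> are already treated. That \<open>D\<close> contains all
  lower rows makes sense only once the outermost loop has set the first coordinate, hence the
  premise \<open>pre \<noteq> []\<close>.\<close>

lemma runs_fill_aux: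
  assumes "all = pre @ rs" "distinct all" "{vZ, vO, vN, b} \<inter> set all = {}" "wf_fm f"
    and std0: "std n \<rho>0" and base: "base = \<rho>0 (vr b)"
    and sat: "\<And>\<rho> D. agreeX 0 (set all) \<rho>0 \<rho> \<Longrightarrow> \<forall>v\<in>set all. \<rho> (vr v) < n \<Longrightarrow>
       below n (length all) (\<rho> (vr (hd all))) \<subseteq> D \<Longrightarrow> D \<subseteq> vecs n (length all) \<Longrightarrow>
       sat n (filled n base P \<mu> D) (env \<rho>) f \<longleftrightarrow> P (map (env \<rho>) all)"
    and "all \<noteq> []"
    and "agreeX 0 (set all) \<rho>0 \<rho>" "\<forall>v\<in>set pre. \<rho> (vr v) < n" "D \<subseteq> vecs n (length all)"
    and "pre \<noteq> [] \<Longrightarrow> below n (length all) (\<rho> (vr (hd pre))) \<subseteq> D"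
  shows "runs (fill d rs (fill_step b all f)) (\<rho>, filled n base P \<mu> D) (fill_time n (fill_step_time n all f) rs)
    (\<lambda>\<sigma>. \<exists>\<rho>'. \<sigma> = (\<rho>', filled n base P \<mu> (D \<union> ext n (map (env \<rho>) pre) (length rs))) \<and>
       agreeX d (set rs) \<rho> \<rho>')"
  using assms(1,9-12)
proof (induction rs arbitrary: pre D \<rho> d)
  case Nil
  have std: "std n \<rho>" "base = \<rho> (vr b)"
    using Nil.prems(2) assms(3) std0 base by (auto simp: std_def agreeX_def)
  show ?case
    unfolding fill.simps fill_time.simps
    apply (rule runs_fill_step[OF std(1) assms(4) std(2)])
     apply (rule sat)
    using Nil.prems \<open>all \<noteq> []\<close> apply simp_all
    by (auto simp: agree_def agreeX_def)
next
  case (Cons r rs)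
  let ?m = "length rs"
  let ?pv = "map (env \<rho>) pre"
  let ?t = "fill_time n (fill_step_time n all f) rs"
  \<comment> \<open>The entries treated once the current loop has gone through the values below
    \<open>j\<close>.\<close>
  define E where "E j = D \<union> (\<Union>x<j. ext n (?pv @ [x]) ?m)" for j
  have ESuc: "E (Suc j) = E j \<union> ext n (?pv @ [j]) ?m" for j
    by (auto simp: E_def lessThan_Suc)
  define I where "I m \<sigma> \<longleftrightarrow> (\<exists>\<rho>'. \<sigma> = (\<rho>', filled n base P \<mu> (E (n - m))) \<and>
    agreeX d (set (r # rs)) \<rho> \<rho>' \<and> \<rho>' (vr r) = n - m \<and> \<rho>' (sc d) = m \<and> m \<le> n)"
    for m and \<sigma> :: state
  have pv: "?pv \<in> vecs n (length pre)" using Cons.prems(3) by (auto simp: vecs_def)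
  have r: "r \<notin> set rs" "r \<notin> set pre" using assms(2) Cons.prems(1) by auto
  have len: "length all = length pre + Suc ?m" using Cons.prems(1) by simp
  have body: "fst \<sigma> (sc d) \<noteq> 0 \<and> runs (Seq (fill (d+1) rs (fill_step b all f))
        (Seq (Add (vr r) (vr r) (vr vO)) (Sub (sc d) (sc d) (vr vO)))) \<sigma> (?t + 2) (I m)"
    if I: "I (Suc m) \<sigma>" for m \<sigma>
  proof -
    define j where "j = n - Suc m"
    obtain \<rho>' where \<rho>': "\<sigma> = (\<rho>', filled n base P \<mu> (E j))"
      "agreeX d (set (r # rs)) \<rho> \<rho>'" "\<rho>' (vr r) = j" "\<rho>' (sc d) = Suc m" "Suc m \<le> n"
      using I unfolding I_def j_def by blast
    have j: "j < n" "n - m = Suc j" using \<rho>'(5) by (auto simp: j_def)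
    have preq: "map (env \<rho>') (pre @ [r]) = ?pv @ [j]"
      using \<rho>'(2,3) assms(2) Cons.prems(1) by (auto simp: agreeX_def)
    have IH: "runs (fill (d+1) rs (fill_step b all f)) (\<rho>', filled n base P \<mu> (E j)) ?t
      (\<lambda>\<sigma>. \<exists>\<rho>''. \<sigma> = (\<rho>'', filled n base P \<mu> (E j \<union> ext n (map (env \<rho>') (pre @ [r])) ?m)) \<and>
       agreeX (d+1) (set rs) \<rho>' \<rho>'')"
    proof (rule Cons.IH)
      show "all = (pre @ [r]) @ rs" using Cons.prems(1) by simp
      show "agreeX 0 (set all) \<rho>0 \<rho>'"
        using \<rho>'(2) Cons.prems(1,2) by (auto simp: agreeX_def)
      show "\<forall>v\<in>set (pre @ [r]). env \<rho>' v < n"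
      proof
        fix v assume v: "v \<in> set (pre @ [r])"
        show "env \<rho>' v < n"
        proof (cases "v = r")
          case True
          then show ?thesis using \<rho>'(3) j(1) by simp
        next
          case False
          then have "v \<in> set pre" "v \<notin> set (r # rs)" using v assms(2) Cons.prems(1) by auto
          then show ?thesis using \<rho>'(2) Cons.prems(3) unfolding agreeX_def by metis
        qed
      qed
      have "ext n (?pv @ [x]) ?m \<subseteq> vecs n (length all)" if "x < j" for x
        using ext_subset[of "?pv @ [x]" n "Suc (length pre)" ?m] pv that j(1) len
        by (auto simp: vecs_def)
      then show "E j \<subseteq> vecs n (length all)" using Cons.prems(4) by (auto simp: E_def)
      \<comment> \<open>In the outermost loop the lower rows are those just completed; in an inner
        loop the first coordinate is fixed and the premise is inherited.\<close>
      show "below n (length all) (env \<rho>' (hd (pre @ [r]))) \<subseteq> E j"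
      proof (cases "pre = []")
        case True
        show ?thesis
        proof
          fix ws assume "ws \<in> below n (length all) (env \<rho>' (hd (pre @ [r])))"
          then have ws: "ws \<in> vecs n (Suc ?m)" "hd ws < j"
            using True \<rho>'(3) len by (auto simp: below_def)
          then obtain x ws' where "ws = x # ws'" "ws' \<in> vecs n ?m"
            by (cases ws) (auto simp: vecs_def)
          then show "ws \<in> E j" using ws(2) True by (auto simp: E_def ext_def)
        qed
      next
        case False
        then have "env \<rho>' (hd (pre @ [r])) = env \<rho> (hd pre)"
          using preq by (cases pre) auto
        then show ?thesis using Cons.prems(5)[OF False] by (auto simp: E_def)
      qed
    qed
    have vO: "\<rho>' (vr vO) = 1"
      using \<rho>'(2) Cons.prems(1,2) assms(3) std0 by (auto simp: agreeX_def std_def)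
    have vOr: "vO \<notin> set rs" "vO \<noteq> r" using Cons.prems(1) assms(3) by auto
    have finish: "I m (\<rho>3, filled n base P \<mu> (E j \<union> ext n (map (env \<rho>') (pre @ [r])) ?m))"
      if "agreeX (d+1) (set rs) \<rho>' \<rho>''"
        and "\<rho>3 = \<rho>''(vr r := \<rho>'' (vr r) + 1, sc d := \<rho>'' (sc d) - 1)" for \<rho>'' \<rho>3
    proof -
      have "\<rho>'' (vr r) = j" "\<rho>'' (sc d) = Suc m" using that(1) \<rho>'(3,4) r(1) by (auto simp: agreeX_def)
      then show ?thesis
        unfolding I_def preq j(2) ESuc using that \<rho>'(2,5)
        by (intro exI[of _ \<rho>3] conjI refl) (auto simp: agreeX_def)
    qed
    have v1: "\<rho>'' (vr vO) = 1" if "agreeX (d+1) (set rs) \<rho>' \<rho>''" for \<rho>''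
      using that vO vOr by (simp add: agreeX_def)
    show ?thesis
      unfolding \<rho>'(1)
      apply (intro conjI)
      subgoal using \<rho>'(4) by simp
      apply (rule runs_Seq[where ?T1.0 = ?t and ?T2.0 = 2])
       apply (rule runs_mono[OF IH order.refl])
       apply (elim exE conjE)
      subgoal for \<sigma>' \<rho>''
        apply hypsubst
        apply (rule runs_Seq[where ?T1.0 = 1 and ?T2.0 = 1])
         apply (rule runs_Add, simp)
         apply (rule runs_Sub, simp)
         apply (rule finish, assumption)
        using v1[of \<rho>''] vOr(2) by simp_all
      by simp
  qed
  have st: "\<rho> (vr vN) = n" "\<rho> (vr vZ) = 0" "vN \<noteq> r" "vZ \<noteq> r"
    using Cons.prems(1,2) assms(3) std0 by (auto simp: agreeX_def std_def)
  show ?case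
    unfolding fill.simps fill_time.simps
    apply (rule runs_Seq[where ?T1.0 = 1 and ?T2.0 = "n * (?t + 3) + 2"])
     apply (rule runs_Imm, simp)
     apply (rule runs_Seq[where ?T1.0 = 1 and ?T2.0 = "n * (?t + 3) + 1"])
      apply (rule runs_Add, simp)
      apply (rule runs_While[where I = I and m = n and t = "?t + 2"])
    subgoal by (rule body)
    subgoal for \<sigma> unfolding I_def by (auto simp: E_def ext_Suc)
    subgoal unfolding I_def using st by (auto simp: E_def agreeX_def)
      by (simp_all add: algebra_simps)
qed

lemma runs_fill:
  assumes "distinct rs" "rs \<noteq> []" "{vZ, vO, vN, b} \<inter> set rs = {}" "wf_fm f" "std n \<rho>"
    and sat: "\<And>\<rho>' D. agreeX 0 (set rs) \<rho> \<rho>' \<Longrightarrow> \<forall>v\<in>set rs. \<rho>' (vr v) < n \<Longrightarrow>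
       below n (length rs) (\<rho>' (vr (hd rs))) \<subseteq> D \<Longrightarrow> D \<subseteq> vecs n (length rs) \<Longrightarrow>
       sat n (filled n (\<rho> (vr b)) P \<mu> D) (env \<rho>') f \<longleftrightarrow> P (map (env \<rho>') rs)"
    and Q: "\<And>\<rho>'. agreeX d (set rs) \<rho> \<rho>' \<Longrightarrow> Q (\<rho>', filled n (\<rho> (vr b)) P \<mu> (vecs n (length rs)))"
  shows "runs (fill d rs (fill_step b rs f)) (\<rho>, \<mu>) (fill_time n (fill_step_time n rs f) rs) Q"
proof (rule runs_mono)
  have "runs (fill d rs (fill_step b rs f)) (\<rho>, filled n (\<rho> (vr b)) P \<mu> {})
    (fill_time n (fill_step_time n rs f) rs)
    (\<lambda>\<sigma>. \<exists>\<rho>'. \<sigma> = (\<rho>', filled n (\<rho> (vr b)) P \<mu> ({} \<union> ext n (map (env \<rho>) []) (length rs))) \<and>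
       agreeX d (set rs) \<rho> \<rho>')"
    by (rule runs_fill_aux[OF _ assms(1,3,4,5) refl sat assms(2)]) (simp_all add: agreeX_def)
  then show "runs (fill d rs (fill_step b rs f)) (\<rho>, \<mu>)
    (fill_time n (fill_step_time n rs f) rs)
    (\<lambda>\<sigma>. \<exists>\<rho>'. \<sigma> = (\<rho>', filled n (\<rho> (vr b)) P \<mu> ({} \<union> ext n (map (env \<rho>) []) (length rs))) \<and>
       agreeX d (set rs) \<rho> \<rho>')" by (simp only: filled_empty)
qed (use Q in auto)

section \<open>Distances in finite graphs\<close>

lemma sym_relpow:
  assumes "sym R" shows "(u, v) \<in> R ^^ t \<Longrightarrow> (v, u) \<in> R ^^ t"
proof (induction t arbitrary: v)
  case (Suc t)
  then obtain y where "(u, y) \<in> R ^^ t" "(y, v) \<in> R" by auto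
  then show ?case using Suc.IH symD[OF assms] by (meson relpow_Suc_I2)
qed simp

locale dgraph =
  fixes n :: nat and A :: "(nat \<times> nat) set"
  assumes A_sub: "A \<subseteq> {..<n} \<times> {..<n}" and A_sym: "sym A"
begin

text \<open>
  If \<open>u\<close> and \<open>v\<close> are not connected, then \<open>gdist u v\<close> is an unspecified value that does not depend on \<open>u\<close> and \<open>v\<close>.
\<close>

definition conn :: "nat \<Rightarrow> nat \<Rightarrow> bool" where "conn u v \<longleftrightarrow> (u, v) \<in> A\<^sup>*"
definition gdist :: "nat \<Rightarrow> nat \<Rightarrow> nat" where "gdist u v = (LEAST t. (u, v) \<in> A ^^ t)"
definition is_gdist :: "nat \<Rightarrow> nat \<Rightarrow> nat \<Rightarrow> bool" where
  "is_gdist a u v \<longleftrightarrow> (u, v) \<in> A ^^ a \<and> (\<forall>b<a. (u, v) \<notin> A ^^ b)"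

lemma conn_refl [simp]: "conn u u" by (simp add: conn_def)
lemma conn_sym: "conn u v \<Longrightarrow> conn v u"
  unfolding conn_def using sym_rtrancl[OF A_sym] by (meson symD)
lemma conn_trans: "conn u v \<Longrightarrow> conn v w \<Longrightarrow> conn u w"
  unfolding conn_def by (rule rtrancl_trans)

lemma relpow_conn: "(u, v) \<in> A ^^ t \<Longrightarrow> conn u v"
  unfolding conn_def by (rule relpow_imp_rtrancl)
lemma gdist_le: "(u, v) \<in> A ^^ t \<Longrightarrow> gdist u v \<le> t"
  unfolding gdist_def by (rule Least_le)
lemma gdist_relpow: "conn u v \<Longrightarrow> (u, v) \<in> A ^^ gdist u v"
  unfolding gdist_def conn_def by (meson LeastI rtrancl_imp_relpow)

lemma is_gdist_iff: "is_gdist a u v \<longleftrightarrow> conn u v \<and> gdist u v = a"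
  unfolding is_gdist_def using relpow_conn gdist_le gdist_relpow
  by (metis le_less_linear le_antisym not_less)

lemma gdist_sym: "gdist u v = gdist v u"
  unfolding gdist_def using sym_relpow[OF A_sym] by metis

lemma gdist_triangle: "conn u v \<Longrightarrow> conn v w \<Longrightarrow> gdist u w \<le> gdist u v + gdist v w"
  by (rule gdist_le) (auto simp: relpow_add dest: gdist_relpow)

lemma gdist_self [simp]: "gdist u u = 0"
  using gdist_le[of u u 0] by simp

lemma gdist_nonconn: "\<not> conn u v \<Longrightarrow> gdist u v = (LEAST t. False)"
  unfolding gdist_def by (metis relpow_conn)

text \<open>No connection with \<open>w\<close> is assumed: if \<open>w\<close> reaches neither
  vertex, both distances are the same unspecified value.\<close>

lemma gdist_lipschitz: "conn x v \<Longrightarrow> \<bar>int (gdist w x) - int (gdist w v)\<bar> \<le> int (gdist x v)"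
proof (cases "conn w x")
  case True
  assume "conn x v"
  then have "conn w v" "conn v x" using True conn_trans conn_sym by blast+
  then show ?thesis
    using gdist_triangle[OF True \<open>conn x v\<close>] gdist_triangle[of w v x] gdist_sym[of x v] by auto
next
  case False
  assume "conn x v"
  then have "\<not> conn w v" using False conn_trans conn_sym by blast
  then show ?thesis using gdist_nonconn False by simp
qed

definition spath :: "(nat \<Rightarrow> nat) \<Rightarrow> nat \<Rightarrow> nat \<Rightarrow> bool" where
  "spath f u v \<longleftrightarrow> conn u v \<and> f 0 = u \<and> f (gdist u v) = v \<and> (\<forall>i<gdist u v. (f i, f (Suc i)) \<in> A)"

lemma spath_ex: "conn u v \<Longrightarrow> \<exists>f. spath f u v"
  using gdist_relpow[of u v] unfolding relpow_fun_conv spath_def by blast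

lemma walk_relpow: "\<forall>i<l. (f i, f (Suc i)) \<in> A \<Longrightarrow> i \<le> j \<Longrightarrow> j \<le> l \<Longrightarrow> (f i, f j) \<in> A ^^ (j - i)"
proof -
  assume *: "\<forall>i<l. (f i, f (Suc i)) \<in> A" "i \<le> j" "j \<le> l"
  show ?thesis unfolding relpow_fun_conv
    by (rule exI[of _ "\<lambda>m. f (i + m)"]) (use * in auto)
qed

lemma spath_relpow: "spath f u v \<Longrightarrow> i \<le> j \<Longrightarrow> j \<le> gdist u v \<Longrightarrow> (f i, f j) \<in> A ^^ (j - i)"
  unfolding spath_def using walk_relpow by blast

lemma spath_conn: "spath f u v \<Longrightarrow> i \<le> j \<Longrightarrow> j \<le> gdist u v \<Longrightarrow> conn (f i) (f j)"
  using spath_relpow relpow_conn by blast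

text \<open>The three parts of the path bound the three distances from above, and by the triangle
  inequality none of the bounds can be strict.\<close>

lemma spath_gdist:
  assumes "spath f u v" "i \<le> j" "j \<le> gdist u v"
  shows "gdist (f i) (f j) = j - i"
proof -
  have uv: "f 0 = u" "f (gdist u v) = v" "conn u v" using assms(1) by (auto simp: spath_def)
  have 1: "gdist u (f i) \<le> i" "gdist (f i) (f j) \<le> j - i" "gdist (f j) v \<le> gdist u v - j"
    using spath_relpow[OF assms(1), of 0 i] spath_relpow[OF assms(1), of i j]
      spath_relpow[OF assms(1), of j "gdist u v"] assms(2,3) uv gdist_le by fastforce+
  have c: "conn u (f i)" "conn (f i) (f j)" "conn (f j) v"
    using spath_conn[OF assms(1), of 0 i] spath_conn[OF assms(1), of i j]
      spath_conn[OF assms(1), of j "gdist u v"] assms(2,3) uv by auto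
  have "gdist u v \<le> gdist u (f i) + (gdist (f i) (f j) + gdist (f j) v)"
    using gdist_triangle[OF c(1) conn_trans[OF c(2,3)]] gdist_triangle[OF c(2,3)] by linarith
  then show ?thesis using 1 assms(2,3) by linarith
qed

lemma spath_gdist0: "spath f u v \<Longrightarrow> j \<le> gdist u v \<Longrightarrow> gdist u (f j) = j"
  using spath_gdist[of f u v 0 j] by (auto simp: spath_def)

lemma spath_conn0: "spath f u v \<Longrightarrow> j \<le> gdist u v \<Longrightarrow> conn u (f j)"
  using spath_conn[of f u v 0 j] by (auto simp: spath_def)

lemma spath_less: "spath f u v \<Longrightarrow> u < n \<Longrightarrow> j \<le> gdist u v \<Longrightarrow> f j < n"
  unfolding spath_def using A_sub by (cases j) (auto, meson Suc_le_lessD lessThan_iff mem_Sigma_iff subsetD)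

lemma conn_less: "conn u v \<Longrightarrow> u < n \<Longrightarrow> v < n"
  using spath_ex[of u v] spath_less[of _ u v "gdist u v"] by (auto simp: spath_def)

text \<open>The vertices of a shortest path lie at different distances from its start. So distances,
  and with them the times of a sweep, are in the range {..<n} of the quantifiers.\<close>

lemma gdist_less: assumes "conn u v" "u < n" shows "gdist u v < n"
proof -
  obtain f where f: "spath f u v" using spath_ex assms(1) by blast
  have "inj_on f {..gdist u v}"
    by (rule inj_onI) (metis f spath_gdist0 atMost_iff)
  moreover have "f ` {..gdist u v} \<subseteq> {..<n}" using spath_less[OF f assms(2)] by auto
  ultimately have "card {..gdist u v} \<le> card {..<n}" by (metis card_inj_on_le finite_lessThan)
  then show ?thesis by simp
qed

text \<open>The vertices that some rerouting of a shortest path between \<open>x\<close> and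
  \<open>y\<close> can visit.\<close>

definition in_interval :: "nat \<Rightarrow> nat \<Rightarrow> nat \<Rightarrow> bool" where
  "in_interval v x y \<longleftrightarrow> conn x v \<and> conn v y \<and> gdist x v + gdist v y = gdist x y"

end

section \<open>Two lemmas on monotone sequences\<close>

text \<open>
  The points \<open>p\<close> climb to the north-east and the points \<open>q\<close> to the north-west; no open quadrant at
  \<open>(u0, w0)\<close> contains points of both. Take the first \<open>p t\<close> with a point \<open>q b\<close> to its south-west: \<open>(u0, w0)\<close>
  is the join of \<open>p (t - 1)\<close> and \<open>q b\<close>, where \<open>b\<close> minimises the sum of its coordinates.
\<close>

lemma separating_point:
  fixes pu pw qu qw :: "nat \<Rightarrow> int"
  assumes p: "\<And>a b. a \<le> b \<Longrightarrow> b \<le> L \<Longrightarrow> pu a \<le> pu b \<and> pw a \<le> pw b"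
    and q: "\<And>a b. a \<le> b \<Longrightarrow> b \<le> L' \<Longrightarrow> qu b \<le> qu a \<and> qw a \<le> qw b"
  shows "\<exists>u0 w0. \<forall>a\<le>L. \<forall>b\<le>L'. sgn (pu a - u0) = sgn (qu b - u0) \<longrightarrow>
    sgn (pw a - w0) = sgn (qw b - w0) \<longrightarrow> pu a = u0 \<or> pw a = w0"
proof -
  define W where "W t = {b. b \<le> L' \<and> qu b \<le> pu t \<and> qw b \<le> pw t}" for t
  \<comment> \<open>Points running to the north-west cannot lie both weakly south-west and strictly
    north-east of one corner.\<close>
  have NE: False if "qu b \<le> u0" "qw b \<le> w0" "b \<le> L'" "b' \<le> L'" "u0 < qu b'" "w0 < qw b'" for u0 w0 b b'
    using q[of b b'] q[of b' b] that by (cases "b \<le> b'") auto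
  \<comment> \<open>Every point of \<open>p\<close> is weakly south-west or weakly north-east of the
    corner, and the open quadrant on its side is free of points of \<open>q\<close>. Equal signs
    without a zero would contradict this.\<close>
  have *: "\<exists>u0 w0. \<forall>a\<le>L. (pu a \<le> u0 \<and> pw a \<le> w0 \<and> (\<forall>b\<le>L'. \<not> (qu b < u0 \<and> qw b < w0))) \<or>
      (u0 \<le> pu a \<and> w0 \<le> pw a \<and> (\<forall>b\<le>L'. \<not> (u0 < qu b \<and> w0 < qw b)))"
  proof (cases "W L = {}")
    case True
    then have "pu a \<le> pu L \<and> pw a \<le> pw L \<and> (\<forall>b\<le>L'. \<not> (qu b < pu L \<and> qw b < pw L))"
      if "a \<le> L" for a
      using p[of a L] that by (force simp: W_def)
    then show ?thesis by blast
  next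
    case False
    define t where "t = (LEAST t. W t \<noteq> {})"
    have t: "W t \<noteq> {}" "t \<le> L" "\<And>r. r < t \<Longrightarrow> W r = {}"
      unfolding t_def using False LeastI[of "\<lambda>t. W t \<noteq> {}"] Least_le[of "\<lambda>t. W t \<noteq> {}"] not_less_Least
      by blast+
    show ?thesis
    proof (cases t)
      case 0
      \<comment> \<open>There is no earlier point of \<open>p\<close>, and \<open>q b\<close> itself
        serves as the corner.\<close>
      obtain b where b: "b \<in> W 0" using t(1) 0 by auto
      have "qu b \<le> pu a \<and> qw b \<le> pw a" if "a \<le> L" for a
        using p[of 0 a] that b by (auto simp: W_def)
      moreover have "\<not> (qu b < qu b' \<and> qw b < qw b')" if "b' \<le> L'" for b'
        using NE[of b "qu b" "qw b" b'] b that by (auto simp: W_def)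
      ultimately show ?thesis by blast
    next
      case (Suc r)
      define g where "g b = max (pu r) (qu b) + max (pw r) (qw b)" for b
      have "finite (W t)" by (auto simp: W_def)
      then obtain b where "is_arg_min g (\<lambda>x. x \<in> W t) b"
        using ex_is_arg_min_if_finite[of "W t" g] t(1) by blast
      then have b: "b \<in> W t" and bmin: "\<And>b'. b' \<in> W t \<Longrightarrow> g b \<le> g b'"
        by (auto simp: is_arg_min_linorder)
      define u0 w0 where "u0 = max (pu r) (qu b)" and "w0 = max (pw r) (qw b)"
      have rt: "pu r \<le> pu t" "pw r \<le> pw t" using p[of r t] t(2) Suc by auto
      have bb: "b \<le> L'" "u0 \<le> pu t" "w0 \<le> pw t" "qu b \<le> u0" "qw b \<le> w0"
        using b rt by (auto simp: u0_def w0_def W_def)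
      have no: "\<not> (qu b' < u0 \<and> qw b' < w0)" if b': "b' \<le> L'" for b'
      proof
        assume l: "qu b' < u0 \<and> qw b' < w0"
        then have "b' \<in> W t" using bb b' by (auto simp: W_def)
        from bmin[OF this] have "u0 + w0 \<le> g b'" by (simp add: g_def u0_def w0_def)
        \<comment> \<open>Neither coordinate of the join of \<open>p r\<close> and
          \<open>q b'\<close> exceeds that of the corner, so by minimality of \<open>g b\<close> the
          joins coincide. As \<open>q b'\<close> is strictly smaller, the corner is
          \<open>p r\<close> itself.\<close>
        then have "qu b' \<le> pu r" "qw b' \<le> pw r"
          using l unfolding g_def u0_def w0_def by linarith+
        then have "b' \<in> W r" using b' by (auto simp: W_def)
        then show False using t(3)[of r] Suc by auto
      qed
      show ?thesis
      proof (rule exI[of _ u0], rule exI[of _ w0], intro allI impI)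
        fix a assume a: "a \<le> L"
        show "(pu a \<le> u0 \<and> pw a \<le> w0 \<and> (\<forall>b\<le>L'. \<not> (qu b < u0 \<and> qw b < w0))) \<or>
          (u0 \<le> pu a \<and> w0 \<le> pw a \<and> (\<forall>b\<le>L'. \<not> (u0 < qu b \<and> w0 < qw b)))"
        proof (cases "a \<le> r")
          case True
          then have "pu a \<le> u0 \<and> pw a \<le> w0"
            using p[of a r] t(2) Suc by (auto simp: u0_def w0_def)
          then show ?thesis using no by blast
        next
          case False
          then have "u0 \<le> pu a \<and> w0 \<le> pw a" using p[of t a] a Suc bb by auto
          then show ?thesis using NE[OF bb(4,5,1)] by blast
        qed
      qed
    qed
  qed
  then obtain u0 w0 where uw: "\<forall>a\<le>L. (pu a \<le> u0 \<and> pw a \<le> w0 \<and> (\<forall>b\<le>L'. \<not> (qu b < u0 \<and> qw b < w0))) \<or>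
      (u0 \<le> pu a \<and> w0 \<le> pw a \<and> (\<forall>b\<le>L'. \<not> (u0 < qu b \<and> w0 < qw b)))" by blast
  show ?thesis
  proof (rule exI[of _ u0], rule exI[of _ w0], intro allI impI)
    fix a b assume ab: "a \<le> L" "b \<le> L'" and s: "sgn (pu a - u0) = sgn (qu b - u0)"
      "sgn (pw a - w0) = sgn (qw b - w0)"
    show "pu a = u0 \<or> pw a = w0"
      using uw[rule_format, OF ab(1)] ab(2) s by (auto simp: sgn_if split: if_splits)
  qed
qed

text \<open>
  A level that \<open>F\<close> does not attain yields a block with a single point.
\<close>

lemma level_blocks:
  fixes F :: "nat \<Rightarrow> nat"
  assumes mono: "\<And>a b. a \<le> b \<Longrightarrow> b \<le> L \<Longrightarrow> F a \<le> F b" and bound: "F L \<le> M"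
  shows "\<exists>a b. a 0 = 0 \<and> b M = L \<and> (\<forall>m. a m \<le> b m \<and> b m \<le> L \<and> F (a m) = F (b m)) \<and>
     (\<forall>m. a (Suc m) = b m \<or> a (Suc m) = Suc (b m))"
proof -
  \<comment> \<open>The last position of level at most \<open>m\<close>. The alternative
    \<open>t = 0\<close> supplies a value when all levels exceed \<open>m\<close>.\<close>
  define b where "b m = (GREATEST t. t \<le> L \<and> (F t \<le> m \<or> t = 0))" for m
  have bP: "b m \<le> L \<and> (F (b m) \<le> m \<or> b m = 0)" for m
    unfolding b_def by (rule GreatestI_nat[of _ 0 L]) auto
  have bmax: "t \<le> b m" if "t \<le> L" "F t \<le> m" for t m
    unfolding b_def by (rule Greatest_le_nat[of _ _ L]) (use that in auto)
  have bM: "b M = L" using bmax[of L M] bound bP[of M] by auto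
  have bmono: "b m \<le> b (Suc m)" for m
    using bP[of m] bmax[of "b m" "Suc m"] by auto
  \<comment> \<open>A block starts right after the previous one; if its level is not attained, it
    repeats the last vertex of the previous block.\<close>
  define a where "a m = (case m of 0 \<Rightarrow> 0 | Suc m' \<Rightarrow> if b m = b m' then b m' else Suc (b m'))" for m
  have "a m \<le> b m \<and> F (a m) = F (b m)" for m
  proof (cases m)
    case 0
    then show ?thesis using bP[of 0] mono[of 0 "b 0"] by (auto simp: a_def)
  next
    case (Suc m')
    show ?thesis
    proof (cases "b m = b m'")
      case True
      then show ?thesis using Suc by (simp add: a_def)
    next
      case False
      then have lt: "b m' < b m" using bmono[of m'] Suc by auto
      then have am: "a m = Suc (b m')" "Suc (b m') \<le> b m" using Suc False by (auto simp: a_def)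
      have "\<not> F (Suc (b m')) \<le> m'" using bmax[of "Suc (b m')" m'] am(2) bP[of m] by auto
      moreover have "F (b m) \<le> m" using bP[of m] lt by auto
      moreover have "F (Suc (b m')) \<le> F (b m)" using mono am(2) bP by blast
      ultimately show ?thesis using am Suc by auto
    qed
  qed
  moreover have "a (Suc m) = b m \<or> a (Suc m) = Suc (b m)" for m by (auto simp: a_def)
  ultimately show ?thesis using bM bP by (rule_tac exI[of _ a], rule_tac exI[of _ b]) (auto simp: a_def)
qed

section \<open>Segmentation of shortest paths\<close>

locale spaths = dgraph +
  fixes k :: nat and s t :: "nat \<Rightarrow> nat" and f :: "nat \<Rightarrow> nat \<Rightarrow> nat"
  assumes paths: "\<And>i. i < k \<Longrightarrow> spath (f i) (s i) (t i)"
begin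

definition d :: "nat \<Rightarrow> nat \<Rightarrow> int" where "d i v = int (gdist (s i) v)"
definition L :: "nat \<Rightarrow> nat" where "L i = gdist (s i) (t i)"

text \<open>The two coordinates: the difference of the distances for \<sigma> = 1, their sum for
  \<sigma> = -1.\<close>

definition H :: "nat \<Rightarrow> nat \<Rightarrow> int \<Rightarrow> nat \<Rightarrow> int" where
  "H i l \<sigma> v = d i v - \<sigma> * d l v"

text \<open>The detour through \<open>v\<close> has the length of the replaced piece, so the
  rerouted path is still a shortest path from \<open>s i\<close> and \<open>d i\<close> grows along
  it at unit speed.\<close>

lemma along:
  assumes "i < k" "a \<le> b" "b \<le> L i" "in_interval v (f i a) (f i b)"
  shows "d i v = d i (f i a) + int (gdist (f i a) v)" "d i (f i b) = d i v + int (gdist v (f i b))"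
    "conn (s i) v"
proof -
  have sp: "spath (f i) (s i) (t i)" using paths assms(1) .
  have c: "conn (s i) (f i a)" "gdist (s i) (f i a) = a" "gdist (s i) (f i b) = b" "gdist (f i a) (f i b) = b - a"
    using spath_conn0[OF sp] spath_gdist0[OF sp] spath_gdist[OF sp] assms(2,3) unfolding L_def by auto
  have v: "conn (f i a) v" "conn v (f i b)" "gdist (f i a) v + gdist v (f i b) = b - a"
    using assms(4) c(4) by (auto simp: in_interval_def)
  show sv: "conn (s i) v" using c(1) v(1) conn_trans by blast
  have "gdist (s i) v \<le> a + gdist (f i a) v" "b \<le> gdist (s i) v + gdist v (f i b)"
    using gdist_triangle[OF c(1) v(1)] gdist_triangle[OF sv v(2)] c by auto
  then show "d i v = d i (f i a) + int (gdist (f i a) v)" "d i (f i b) = d i v + int (gdist v (f i b))"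
    using v(3) c assms(2) unfolding d_def by auto
qed

text \<open>While \<open>d i\<close> grows by the full distance from \<open>x\<close> to
  \<open>v\<close>, \<open>d l\<close> changes by at most that amount.\<close>

lemma H_mono:
  assumes "\<sigma> \<in> {1, -1}" "conn x v" "d i v = d i x + int (gdist x v)"
  shows "H i l \<sigma> x \<le> H i l \<sigma> v"
  using assms(1,3) gdist_lipschitz[OF assms(2), of "s l"] unfolding H_def d_def by auto

lemma H_between:
  assumes "i < k" "a \<le> b" "b \<le> L i" "in_interval v (f i a) (f i b)" "\<sigma> \<in> {1, -1}"
  shows "H i l \<sigma> (f i a) \<le> H i l \<sigma> v" "H i l \<sigma> v \<le> H i l \<sigma> (f i b)"
  using H_mono[OF assms(5)] along[OF assms(1-4)] assms(4) by (auto simp: in_interval_def)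

lemma in_interval_path:
  assumes "i < k" "a \<le> b" "b \<le> c" "c \<le> L i"
  shows "in_interval (f i b) (f i a) (f i c)"
  using spath_conn[OF paths[OF assms(1)]] spath_gdist[OF paths[OF assms(1)]] assms
  unfolding in_interval_def L_def by auto

lemma H_path_mono:
  assumes "i < k" "a \<le> b" "b \<le> L i" "\<sigma> \<in> {1, -1}"
  shows "H i l \<sigma> (f i a) \<le> H i l \<sigma> (f i b)"
  using H_between(1)[OF assms(1-3) in_interval_path[OF assms(1,2) order.refl assms(3)] assms(4)] .

section \<open>Separating lines and their compositions\<close>

text \<open>
  Along the path \<open>i\<close> both \<open>d i - d j\<close> and \<open>d i + d j\<close> are nondecreasing; along the path \<open>j\<close> the
  former is nonincreasing.
\<close>

definition crossing :: "nat \<Rightarrow> nat \<Rightarrow> int \<Rightarrow> int \<Rightarrow> bool" where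
  "crossing i j u0 w0 \<longleftrightarrow> (\<forall>a\<le>L i. \<forall>b\<le>L j.
     sgn (H i j 1 (f i a) - u0) = sgn (H i j 1 (f j b) - u0) \<longrightarrow>
     sgn (H i j (-1) (f i a) - w0) = sgn (H i j (-1) (f j b) - w0) \<longrightarrow>
     H i j 1 (f i a) = u0 \<or> H i j (-1) (f i a) = w0)"

definition cross_pt :: "nat \<Rightarrow> nat \<Rightarrow> int \<times> int" where
  "cross_pt i j = (SOME c. crossing i j (fst c) (snd c))"

lemma crossing_cross_pt:
  assumes ij: "i < k" "j < k"
  shows "crossing i j (fst (cross_pt i j)) (snd (cross_pt i j))"
proof -
  have sw: "H i j 1 x = - H j i 1 x" "H i j (-1) x = H j i (-1) x" for x
    by (auto simp: H_def)
  have "\<exists>u0 w0. crossing i j u0 w0"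
    unfolding crossing_def
  proof (rule separating_point)
    show "H i j 1 (f i a) \<le> H i j 1 (f i b) \<and> H i j (-1) (f i a) \<le> H i j (-1) (f i b)"
      if "a \<le> b" "b \<le> L i" for a b
      using H_path_mono[OF ij(1) that] by simp
    show "H i j 1 (f j b) \<le> H i j 1 (f j a) \<and> H i j (-1) (f j a) \<le> H i j (-1) (f j b)"
      if "a \<le> b" "b \<le> L j" for a b
      unfolding sw using H_path_mono[OF ij(2) that] by simp
  qed
  then have "\<exists>c. crossing i j (fst c) (snd c)" by auto
  then show ?thesis unfolding cross_pt_def by (rule someI_ex)
qed

text \<open>Both lines of every pair, each also written from the side of \<open>j\<close>:
  exchanging the indices negates the difference and keeps the sum.\<close>

definition base :: "(nat \<times> nat \<times> int \<times> int) set" where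
  "base = (\<Union>i<k. \<Union>j<k. {(i, j, 1, fst (cross_pt i j)), (i, j, -1, snd (cross_pt i j)),
     (j, i, 1, - fst (cross_pt i j)), (j, i, -1, snd (cross_pt i j))})"

lemma base_intros:
  assumes "i < k" "j < k"
  shows "(i, j, 1, fst (cross_pt i j)) \<in> base" "(i, j, -1, snd (cross_pt i j)) \<in> base"
    "(j, i, 1, - fst (cross_pt i j)) \<in> base" "(j, i, -1, snd (cross_pt i j)) \<in> base"
  using assms unfolding base_def by blast+

lemma base_props:
  assumes "(i, j, \<sigma>, \<kappa>) \<in> base"
  shows "i < k" "j < k" "\<sigma> \<in> {1, -1}" "(j, i, \<sigma>, - \<sigma> * \<kappa>) \<in> base"
proof -
  obtain i' j' where ij: "i' < k" "j' < k" and "(i, j, \<sigma>, \<kappa>) \<in> {(i', j', 1, fst (cross_pt i' j')),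
     (i', j', -1, snd (cross_pt i' j')), (j', i', 1, - fst (cross_pt i' j')), (j', i', -1, snd (cross_pt i' j'))}"
    using assms unfolding base_def by blast
  then show "i < k" "j < k" "\<sigma> \<in> {1, -1}" "(j, i, \<sigma>, - \<sigma> * \<kappa>) \<in> base"
    using base_intros[OF ij] by auto
qed

lemma finite_base: "finite base" unfolding base_def by auto

lemma card_base: "card base \<le> 4 * k * k"
proof -
  have c4: "card {p, q, r, x} \<le> 4" for p q r x :: "nat \<times> nat \<times> int \<times> int"
    by (simp add: card_insert_if)
  have "card base \<le> (\<Sum>i<k. card (\<Union>j<k. {(i, j, 1 :: int, fst (cross_pt i j)), (i, j, -1, snd (cross_pt i j)),
     (j, i, 1, - fst (cross_pt i j)), (j, i, -1, snd (cross_pt i j))}))"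
    unfolding base_def by (rule card_UN_le) simp
  also have "\<dots> \<le> (\<Sum>i<k. (\<Sum>j<k. card {(i, j, 1 :: int, fst (cross_pt i j)), (i, j, -1, snd (cross_pt i j)),
     (j, i, 1, - fst (cross_pt i j)), (j, i, -1, snd (cross_pt i j))}))"
    by (intro sum_mono card_UN_le) simp
  also have "\<dots> \<le> (\<Sum>i<k. (\<Sum>j<k. 4))" by (intro sum_mono c4)
  finally show ?thesis by (simp add: algebra_simps)
qed

text \<open>
  The entries \<open>j\<close> and \<open>j'\<close> may differ: the set \<open>relations\<close> only has to contain the meaningful
  compositions, and superfluous relations just refine the blocks.
\<close>

fun compose :: "(nat \<times> int \<times> int) \<times> (nat \<times> nat \<times> int \<times> int) \<Rightarrow> nat \<times> int \<times> int" where
  "compose ((j, \<sigma>', \<kappa>'), (j', l, \<sigma>, \<kappa>)) = (l, \<sigma>' * \<sigma>, \<kappa>' + \<sigma>' * \<kappa>)"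

text \<open>A triple (l, \<sigma>, \<kappa>) stands for the equation d i - \<sigma> * d l =
  \<kappa>, obtained by composing at most \<open>m\<close> base lines. The starting triple is the
  trivial equation d i - d i = 0.\<close>

primrec relations :: "nat \<Rightarrow> nat \<Rightarrow> (nat \<times> int \<times> int) set" where
  "relations i 0 = {(i, 1, 0)}"
| "relations i (Suc m) = relations i m \<union> compose ` (relations i m \<times> base)"

lemma relations_mono: "m \<le> m' \<Longrightarrow> relations i m \<subseteq> relations i m'"
  by (rule lift_Suc_mono_le) auto

lemma finite_rels: "finite (relations i m)"
  by (induction m) (auto simp: finite_base)

lemma relations_sign: "(l, \<sigma>, \<kappa>) \<in> relations i m \<Longrightarrow> \<sigma> \<in> {1, -1}"
proof (induction m arbitrary: l \<sigma> \<kappa>)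
  case (Suc m)
  show ?case
  proof (cases "(l, \<sigma>, \<kappa>) \<in> relations i m")
    case False
    then obtain j \<sigma>' \<kappa>' j' \<sigma>'' \<kappa>'' where *: "(j, \<sigma>', \<kappa>') \<in> relations i m" "(j', l, \<sigma>'', \<kappa>'') \<in> base"
      "\<sigma> = \<sigma>' * \<sigma>''"
      using Suc.prems by auto
    show ?thesis using Suc.IH[OF *(1)] base_props(3)[OF *(2)] *(3) by auto
  qed (use Suc.IH in auto)
qed simp

lemma relations_compose:
  "(j, \<sigma>', \<kappa>') \<in> relations i m \<Longrightarrow> (j, l, \<sigma>, \<kappa>) \<in> base \<Longrightarrow> (l, \<sigma>' * \<sigma>, \<kappa>' + \<sigma>' * \<kappa>) \<in> relations i (Suc m)"
  by (force simp: image_iff)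

lemma card_rels: "card (relations i m) \<le> (1 + 4 * k * k) ^ m"
proof (induction m)
  case (Suc m)
  have "card (relations i (Suc m)) \<le> card (relations i m) + card (compose ` (relations i m \<times> base))"
    by (simp add: card_Un_le)
  also have "card (compose ` (relations i m \<times> base)) \<le> card (relations i m) * card base"
    using card_image_le[of "relations i m \<times> base" compose] by (simp add: finite_rels finite_base card_cartesian_product)
  also have "card (relations i m) + card (relations i m) * card base = card (relations i m) * (1 + card base)"
    by simp
  also have "\<dots> \<le> (1 + 4 * k * k) ^ m * (1 + 4 * k * k)"
    by (intro mult_mono Suc.IH) (use card_base in auto)
  finally show ?case by (simp add: mult.commute)
qed simp

text \<open>There are at most k * k links between the k indices, so a chain of links can be
  shortened to at most this length; see \<open>link_star\<close>.\<close>

abbreviation "depth \<equiv> k * k"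

section \<open>Blocks of constant signature\<close>

text \<open>
  Each summand is monotone along the path \<open>i\<close>, so \<open>signature\<close> determines the sign of every relation.
\<close>

definition signature :: "nat \<Rightarrow> nat \<Rightarrow> nat" where
  "signature i v = (\<Sum>(l, \<sigma>, \<kappa>)\<in>relations i depth. nat (1 + sgn (H i l \<sigma> v - \<kappa>)))"

lemma sgn_mono_int: "(x::int) \<le> y \<Longrightarrow> sgn x \<le> sgn y"
  by (auto simp: sgn_if)

text \<open>The summands are 0, 1 or 2. This is the origin of the factor 2 in the number of
  blocks.\<close>

lemma signature_le: "signature i v \<le> 2 * (1 + 4 * k * k) ^ depth"
proof -
  have "signature i v \<le> (\<Sum>r\<in>relations i depth. 2)"
    unfolding signature_def by (rule sum_mono) (auto simp: sgn_if)
  also have "\<dots> \<le> 2 * (1 + 4 * k * k) ^ depth" using card_rels[of i depth] by simp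
  finally show ?thesis .
qed

lemma signature_term_mono:
  assumes "i < k" "a \<le> b" "b \<le> L i" "(l, \<sigma>, \<kappa>) \<in> relations i m"
  shows "nat (1 + sgn (H i l \<sigma> (f i a) - \<kappa>)) \<le> nat (1 + sgn (H i l \<sigma> (f i b) - \<kappa>))"
  using H_path_mono[OF assms(1-3) relations_sign[OF assms(4)], of l]
  by (intro nat_mono add_left_mono sgn_mono_int) simp

lemma signature_mono:
  assumes "i < k" "a \<le> b" "b \<le> L i"
  shows "signature i (f i a) \<le> signature i (f i b)"
  unfolding signature_def
  by (rule sum_mono) (use signature_term_mono[OF assms] in auto)

text \<open>The summands are monotone, so equal signatures at the ends force equal summands. At
  \<open>v\<close> each \<open>H\<close> is squeezed between its values at the ends, for whichever
  route \<open>v\<close> belongs to.\<close>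

lemma block_sgn:
  assumes i: "i < k" "a \<le> b" "b \<le> L i" and eq: "signature i (f i a) = signature i (f i b)"
    and v: "in_interval v (f i a) (f i b)" and r: "(l, \<sigma>, \<kappa>) \<in> relations i depth"
  shows "sgn (H i l \<sigma> v - \<kappa>) = sgn (H i l \<sigma> (f i a) - \<kappa>)"
proof -
  let ?g = "\<lambda>v (l, \<sigma>, \<kappa>). nat (1 + sgn (H i l \<sigma> v - \<kappa>))"
  have "?g (f i a) (l, \<sigma>, \<kappa>) = ?g (f i b) (l, \<sigma>, \<kappa>)"
  proof (rule sum_mono_inv[OF _ _ r finite_rels])
    show "sum (?g (f i a)) (relations i depth) = sum (?g (f i b)) (relations i depth)"
      using eq unfolding signature_def .
    show "?g (f i a) r \<le> ?g (f i b) r" if "r \<in> relations i depth" for r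
      using that signature_term_mono[OF i] by (cases r) auto
  qed
  then have e: "sgn (H i l \<sigma> (f i a) - \<kappa>) = sgn (H i l \<sigma> (f i b) - \<kappa>)"
    by (auto simp: sgn_if split: if_splits)
  have "sgn (H i l \<sigma> (f i a) - \<kappa>) \<le> sgn (H i l \<sigma> v - \<kappa>)"
    "sgn (H i l \<sigma> v - \<kappa>) \<le> sgn (H i l \<sigma> (f i b) - \<kappa>)"
    using H_between[OF i v relations_sign[OF r], of l] by (auto intro!: sgn_mono_int)
  then show ?thesis using e by simp
qed

section \<open>Linked terminals and common roots\<close>

text \<open>
  The relations that hold at \<open>v\<close> propagate to the whole block of \<open>v\<close>, hence so does the component of
  \<open>i\<close> in the graph \<open>link v\<close>, whose least element serves as the common root of conflicting blocks.
\<close>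

definition link :: "nat \<Rightarrow> (nat \<times> nat) set" where
  "link v = {(j, l). conn (s j) v \<and> conn (s l) v \<and> (\<exists>\<sigma> \<kappa>. (j, l, \<sigma>, \<kappa>) \<in> base \<and> H j l \<sigma> v = \<kappa>)}"

lemma link_bound: "link v \<subseteq> {..<k} \<times> {..<k}"
  unfolding link_def using base_props(1,2) by blast

lemma sym_link: "sym (link v)"
proof (rule symI)
  fix j l assume "(j, l) \<in> link v"
  then obtain \<sigma> where *: "conn (s j) v" "conn (s l) v" "(j, l, \<sigma>, H j l \<sigma> v) \<in> base"
    by (auto simp: link_def)
  have "H l j \<sigma> v = - \<sigma> * H j l \<sigma> v"
    using base_props(3)[OF *(3)] by (auto simp: H_def)
  then show "(l, j) \<in> link v" using * base_props(4)[OF *(3)]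
    unfolding link_def mem_Collect_eq case_prod_conv by metis
qed

text \<open>The composition of the chain is an equation that holds at \<open>v\<close>, so it has
  sign 0 on the whole block, in particular at \<open>w\<close>. Subtracting the equation of the
  shorter chain leaves the last link at \<open>w\<close>. The bound on \<open>m\<close> ensures that
  the signature counts the composition.\<close>

lemma link_const:
  assumes i: "i < k" "a \<le> b" "b \<le> L i" and eq: "signature i (f i a) = signature i (f i b)"
    and v: "in_interval v (f i a) (f i b)" "in_interval w (f i a) (f i b)"
  shows "(i, l) \<in> link v ^^ m \<Longrightarrow> m \<le> depth \<Longrightarrow>
    (i, l) \<in> link w ^^ m \<and> (\<exists>\<sigma> \<kappa>. (l, \<sigma>, \<kappa>) \<in> relations i m \<and> H i l \<sigma> v = \<kappa> \<and> H i l \<sigma> w = \<kappa>)"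
proof (induction m arbitrary: l)
  case 0
  then show ?case by (auto simp: H_def)
next
  case (Suc m)
  obtain j where j: "(i, j) \<in> link v ^^ m" "(j, l) \<in> link v" using Suc.prems(1) by auto
  obtain \<sigma>' \<kappa>' where IH: "(i, j) \<in> link w ^^ m" "(j, \<sigma>', \<kappa>') \<in> relations i m"
    "H i j \<sigma>' v = \<kappa>'" "H i j \<sigma>' w = \<kappa>'"
    using Suc.IH[OF j(1)] Suc.prems(2) by auto
  obtain \<sigma> \<kappa> where b: "conn (s j) v" "conn (s l) v" "(j, l, \<sigma>, \<kappa>) \<in> base" "H j l \<sigma> v = \<kappa>"
    using j(2) by (auto simp: link_def)
  have s': "\<sigma>' \<in> {1, -1}" using relations_sign[OF IH(2)] .
  have R: "(l, \<sigma>' * \<sigma>, \<kappa>' + \<sigma>' * \<kappa>) \<in> relations i (Suc m)" using relations_compose[OF IH(2) b(3)] .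
  have comp: "H i l (\<sigma>' * \<sigma>) x = H i j \<sigma>' x + \<sigma>' * H j l \<sigma> x" for x
    by (simp add: H_def algebra_simps)
  have Hv: "H i l (\<sigma>' * \<sigma>) v = \<kappa>' + \<sigma>' * \<kappa>" using comp[of v] IH(3) b(4) by simp
  have R': "(l, \<sigma>' * \<sigma>, \<kappa>' + \<sigma>' * \<kappa>) \<in> relations i depth"
    using R relations_mono[OF Suc.prems(2)] by blast
  have "sgn (H i l (\<sigma>' * \<sigma>) w - (\<kappa>' + \<sigma>' * \<kappa>)) = 0"
    using block_sgn[OF i eq v(1) R'] block_sgn[OF i eq v(2) R'] Hv by simp
  then have Hw: "H i l (\<sigma>' * \<sigma>) w = \<kappa>' + \<sigma>' * \<kappa>" by (simp add: sgn_if split: if_splits)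
  then have "H j l \<sigma> w = \<kappa>" using comp[of w] IH(4) s' by auto
  moreover have "conn v w" using v unfolding in_interval_def by (meson conn_sym conn_trans)
  ultimately have "(j, l) \<in> link w" using b conn_trans unfolding link_def by blast
  then have "(i, l) \<in> link w ^^ Suc m" using IH(1) by auto
  then show ?case using R Hv Hw by blast
qed

lemma link_star:
  assumes "(i, l) \<in> (link v)\<^sup>*"
  shows "\<exists>m\<le>depth. (i, l) \<in> link v ^^ m"
proof -
  have finite_link: "finite (link v)" using link_bound by (rule finite_subset) simp
  have "card (link v) \<le> depth"
    using card_mono[OF _ link_bound, of v] by (simp add: card_cartesian_product)
  moreover obtain m where "m \<le> card (link v)" "(i, l) \<in> link v ^^ m"
    using assms unfolding rtrancl_finite_eq_relpow[OF finite_link] by blast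
  ultimately show ?thesis by (meson order_trans)
qed

lemma link_star_const:
  assumes i: "i < k" "a \<le> b" "b \<le> L i" and eq: "signature i (f i a) = signature i (f i b)"
    and v: "in_interval v (f i a) (f i b)" "in_interval w (f i a) (f i b)"
  shows "(link v)\<^sup>* `` {i} = (link w)\<^sup>* `` {i}"
proof -
  have "(i, l) \<in> (link w)\<^sup>*" if "in_interval v (f i a) (f i b)" "in_interval w (f i a) (f i b)" "(i, l) \<in> (link v)\<^sup>*" for l v w
    using link_star[OF that(3)] link_const[OF i eq that(1,2)] by (meson relpow_imp_rtrancl)
  then show ?thesis using v by blast
qed

definition root_index :: "nat \<Rightarrow> nat \<Rightarrow> nat" where "root_index i v = Min ((link v)\<^sup>* `` {i})"

lemma root_index_star:
  assumes "i < k"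
  shows "(i, root_index i v) \<in> (link v)\<^sup>*" "root_index i v < k"
proof -
  have sub: "(link v)\<^sup>* `` {i} \<subseteq> {..<k}"
  proof
    fix x assume "x \<in> (link v)\<^sup>* `` {i}"
    then have "(i, x) \<in> (link v)\<^sup>*" by simp
    then show "x \<in> {..<k}" using assms link_bound by (cases rule: rtranclE) auto
  qed
  have "root_index i v \<in> (link v)\<^sup>* `` {i}"
    unfolding root_index_def by (rule Min_in) (use finite_subset[OF sub] in auto)
  then show "(i, root_index i v) \<in> (link v)\<^sup>*" "root_index i v < k" using sub by auto
qed

text \<open>The chain from \<open>i\<close> to the root gives d i - \<sigma> * d l = \<kappa> at
  both ends. Since \<open>d i\<close> grows at unit speed, the distance from the root grows or falls
  at unit speed, according to \<sigma>.\<close>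

lemma root_index_diag:
  assumes i: "i < k" "a \<le> b" "b \<le> L i" and eq: "signature i (f i a) = signature i (f i b)"
  defines "z \<equiv> s (root_index i (f i a))"
  shows "conn z (f i a)" "gdist z (f i b) = gdist z (f i a) + gdist (f i a) (f i b) \<or>
    gdist z (f i a) = gdist z (f i b) + gdist (f i a) (f i b)"
proof -
  let ?l = "root_index i (f i a)"
  have I: "in_interval (f i a) (f i a) (f i b)" "in_interval (f i b) (f i a) (f i b)"
    using in_interval_path[OF i(1) order.refl i(2,3)] in_interval_path[OF i(1,2) order.refl i(3)] by auto
  obtain m where m: "m \<le> depth" "(i, ?l) \<in> link (f i a) ^^ m"
    using link_star[OF root_index_star(1)[OF i(1)]] by blast
  obtain \<sigma> \<kappa> where r: "(?l, \<sigma>, \<kappa>) \<in> relations i m" "H i ?l \<sigma> (f i a) = \<kappa>" "H i ?l \<sigma> (f i b) = \<kappa>"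
    using link_const[OF i eq I m(2,1)] by blast
  have "d i (f i b) = d i (f i a) + int (gdist (f i a) (f i b))" using along(1)[OF i I(2)] .
  then show "gdist z (f i b) = gdist z (f i a) + gdist (f i a) (f i b) \<or>
    gdist z (f i a) = gdist z (f i b) + gdist (f i a) (f i b)"
    using r(2,3) relations_sign[OF r(1)] unfolding H_def d_def z_def by auto
  have ci: "conn (s i) (f i a)" using along(3)[OF i I(1)] .
  \<comment> \<open>The last link of a nontrivial chain contains the connection with the terminal of
    the root.\<close>
  show "conn z (f i a)"
  proof (cases "?l = i")
    case False
    then obtain j where "(j, ?l) \<in> link (f i a)"
      using root_index_star(1)[OF i(1), of "f i a"] by (metis rtranclE)
    then show ?thesis by (auto simp: z_def link_def)
  qed (use ci in \<open>simp add: z_def\<close>)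
qed

lemma relations_base:
  assumes "(i, l, \<sigma>, \<kappa>) \<in> base"
  shows "(l, \<sigma>, \<kappa>) \<in> relations i depth"
proof -
  have "(l, \<sigma>, \<kappa>) \<in> relations i (Suc 0)" using relations_compose[of i 1 0 i 0 l \<sigma> \<kappa>] assms by simp
  moreover have "Suc 0 \<le> depth" using base_props(1)[OF assms] by (cases k) auto
  ultimately show ?thesis using relations_mono by blast
qed

text \<open>The common vertex \<open>v\<close> need not lie on either given path, but it lies on the
  same sides of both lines as the starts of both blocks. By the choice of the crossing point this is
  possible only on a line, so \<open>i\<close> and \<open>j\<close> are linked at \<open>v\<close>.
  Their common component at \<open>v\<close> is then carried along both blocks.\<close>

lemma root_index_eq:
  assumes i: "i < k" "a \<le> b" "b \<le> L i" and eqi: "signature i (f i a) = signature i (f i b)"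
    and j: "j < k" "a' \<le> b'" "b' \<le> L j" and eqj: "signature j (f j a') = signature j (f j b')"
    and v: "in_interval v (f i a) (f i b)" "in_interval v (f j a') (f j b')"
  shows "root_index i (f i a) = root_index j (f j a')"
proof -
  define u0 w0 where "u0 = fst (cross_pt i j)" and "w0 = snd (cross_pt i j)"
  note b = base_intros[OF i(1) j(1), folded u0_def w0_def]
  have sw: "H i j 1 x - u0 = - (H j i 1 x - - u0)" "H i j (-1) x = H j i (-1) x" for x
    by (auto simp: H_def)
  have neg: "sgn (- x) = - sgn x" for x :: int by (simp add: sgn_if)
  have "sgn (H i j 1 (f i a) - u0) = sgn (H i j 1 v - u0)"
    "sgn (H i j (-1) (f i a) - w0) = sgn (H i j (-1) v - w0)"
    using block_sgn[OF i eqi v(1)] relations_base b by auto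
  moreover have "sgn (H i j 1 (f j a') - u0) = sgn (H i j 1 v - u0)"
    "sgn (H i j (-1) (f j a') - w0) = sgn (H i j (-1) v - w0)"
    unfolding sw neg
    using block_sgn[OF j eqj v(2) relations_base[OF b(3)]] block_sgn[OF j eqj v(2) relations_base[OF b(4)]]
    by simp_all
  moreover have "a \<le> L i" "a' \<le> L j" using i j by auto
  ultimately have "H i j 1 (f i a) = u0 \<or> H i j (-1) (f i a) = w0"
    using crossing_cross_pt[OF i(1) j(1)] unfolding crossing_def u0_def w0_def by metis
  then have "H i j 1 v = u0 \<or> H i j (-1) v = w0"
    using \<open>sgn (H i j 1 (f i a) - u0) = sgn (H i j 1 v - u0)\<close>
      \<open>sgn (H i j (-1) (f i a) - w0) = sgn (H i j (-1) v - w0)\<close>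
    by (auto simp: sgn_if split: if_splits)
  moreover have "conn (s i) v" "conn (s j) v" using along(3)[OF i v(1)] along(3)[OF j v(2)] by auto
  ultimately have ij: "(i, j) \<in> link v" using b unfolding link_def by blast
  have ji: "(j, i) \<in> link v" using sym_link ij by (rule symD)
  have "(link v)\<^sup>* `` {i} = (link v)\<^sup>* `` {j}"
    using converse_rtrancl_into_rtrancl[OF ij] converse_rtrancl_into_rtrancl[OF ji] by blast
  moreover have "(link v)\<^sup>* `` {i} = (link (f i a))\<^sup>* `` {i}"
    by (rule link_star_const[OF i eqi v(1)]) (use in_interval_path[OF i(1) order.refl i(2,3)] in simp)
  moreover have "(link v)\<^sup>* `` {j} = (link (f j a'))\<^sup>* `` {j}"
    by (rule link_star_const[OF j eqj v(2)]) (use in_interval_path[OF j(1) order.refl j(2,3)] in simp)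
  ultimately show ?thesis unfolding root_index_def by simp
qed

text \<open>The interface to the algorithm, in which signatures and links no longer appear.
  Signatures range over 0, ..., M, hence the last block has number \<open>M\<close> and a path has
  \<open>Suc M\<close> blocks.\<close>

theorem segmentation:
  defines "M \<equiv> 2 * (1 + 4 * k * k) ^ (k * k)"
  shows "\<exists>a b z. \<forall>i<k. a i 0 = 0 \<and> b i M = L i \<and>
    (\<forall>m. a i m \<le> b i m \<and> b i m \<le> L i \<and> (\<exists>l<k. z i m = s l) \<and> conn (z i m) (f i (a i m)) \<and>
      (gdist (z i m) (f i (b i m)) = gdist (z i m) (f i (a i m)) + gdist (f i (a i m)) (f i (b i m)) \<or>
       gdist (z i m) (f i (a i m)) = gdist (z i m) (f i (b i m)) + gdist (f i (a i m)) (f i (b i m))) \<and>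
      (a i (Suc m) = b i m \<or> a i (Suc m) = Suc (b i m)) \<and>
      (\<forall>j<k. \<forall>m'. z i m = z j m' \<or>
        \<not> (\<exists>v. in_interval v (f i (a i m)) (f i (b i m)) \<and> in_interval v (f j (a j m')) (f j (b j m')))))"
    (is "\<exists>a b z. \<forall>i<k. ?P a b z i")
proof -
  have "\<exists>a b. a 0 = 0 \<and> b M = L i \<and>
      (\<forall>m. a m \<le> b m \<and> b m \<le> L i \<and> signature i (f i (a m)) = signature i (f i (b m))) \<and>
      (\<forall>m. a (Suc m) = b m \<or> a (Suc m) = Suc (b m))" if "i < k" for i
    using level_blocks[of "L i" "\<lambda>x. signature i (f i x)" M] signature_mono[OF that] signature_le[of i] unfolding M_def by auto
  then obtain a b where ab: "\<And>i. i < k \<Longrightarrow> a i 0 = 0 \<and> b i M = L i \<and>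
      (\<forall>m. a i m \<le> b i m \<and> b i m \<le> L i \<and> signature i (f i (a i m)) = signature i (f i (b i m))) \<and>
      (\<forall>m. a i (Suc m) = b i m \<or> a i (Suc m) = Suc (b i m))"
    by metis
  define z where "z i m = s (root_index i (f i (a i m)))" for i m
  show ?thesis
  proof (rule exI[of _ a], rule exI[of _ b], rule exI[of _ z], intro allI impI)
    fix i assume i: "i < k"
    note abi = ab[OF i]
    have "z i m = z j m' \<or>
        \<not> (\<exists>v. in_interval v (f i (a i m)) (f i (b i m)) \<and> in_interval v (f j (a j m')) (f j (b j m')))"
      if "j < k" for m j m'
      unfolding z_def using root_index_eq[OF i _ _ _ that, of "a i m" "b i m" "a j m'" "b j m'"] abi ab[OF that]
      by metis
    moreover have "\<exists>l<k. z i m = s l" for m unfolding z_def using root_index_star(2)[OF i] by blast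
    moreover note root_index_diag[OF i, of "a i m" "b i m" for m]
    ultimately show "?P a b z i"
      using abi unfolding z_def by blast
  qed
qed

end

section \<open>Sweeping over a guessed segmentation\<close>

locale terminals = dgraph +
  fixes k M :: nat and s t :: "nat \<Rightarrow> nat"
  assumes st: "\<And>i. i < k \<Longrightarrow> s i < n \<and> t i < n"
begin

definition solvable :: bool where
  "solvable \<longleftrightarrow> (\<exists>f. \<forall>i<k. spath (f i) (s i) (t i) \<and> (\<forall>j<k. j \<noteq> i \<longrightarrow>
     (\<forall>a b. 0 < a \<longrightarrow> a < gdist (s i) (t i) \<longrightarrow> b \<le> gdist (s j) (t j) \<longrightarrow> f i a \<noteq> f j b)))"

abbreviation K :: nat where "K \<equiv> k * Suc M"
abbreviation path_of :: "nat \<Rightarrow> nat" where "path_of S \<equiv> S div Suc M"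

text \<open>
  The pebble of a block starts at \<open>lo\<close>, ends at \<open>hi\<close>, and is at distance \<open>\<tau>\<close> from the root \<open>z\<close> of the block
  at time \<open>\<tau>\<close> while it is on its way. Pebbles of blocks with the same root can thus visit a vertex only at
  the same time. Block \<open>m\<close> of path \<open>i\<close> has the index \<open>i * Suc M + m\<close>.
\<close>

definition position_ok :: "nat \<Rightarrow> nat \<Rightarrow> nat \<Rightarrow> nat \<Rightarrow> nat \<Rightarrow> bool" where
  "position_ok \<tau> lo hi z p \<longleftrightarrow> (\<exists>a<n. \<exists>b<n. is_gdist a z lo \<and> is_gdist b z hi \<and>
     (\<tau> \<le> a \<longrightarrow> p = lo) \<and> (a < \<tau> \<and> \<tau> < b \<longrightarrow> is_gdist \<tau> z p) \<and> (b \<le> \<tau> \<longrightarrow> p = hi))"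

text \<open>Paths may share endpoints. An inner vertex of a shortest path differs from its ends, so
  the test can be made on vertices without positions.\<close>

definition collision_ok :: "(nat \<Rightarrow> nat) \<Rightarrow> nat \<Rightarrow> nat \<Rightarrow> bool" where
  "collision_ok p S S' \<longleftrightarrow> (p S = p S' \<longrightarrow> (p S = s (path_of S) \<or> p S = t (path_of S)) \<and> (p S = s (path_of S') \<or> p S = t (path_of S')))"

definition sweep_ok :: "nat \<Rightarrow> (nat \<Rightarrow> nat) \<Rightarrow> (nat \<Rightarrow> nat) \<Rightarrow> (nat \<Rightarrow> nat) \<Rightarrow> (nat \<Rightarrow> nat) \<Rightarrow> bool" where
  "sweep_ok \<tau> lo hi z p \<longleftrightarrow> (\<forall>S<K. position_ok \<tau> (lo S) (hi S) (z S) (p S)) \<and>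
     (\<forall>S<K. \<forall>S'<K. path_of S \<noteq> path_of S' \<longrightarrow> collision_ok p S S')"

definition sweep_step :: "(nat \<Rightarrow> nat) \<Rightarrow> (nat \<Rightarrow> nat) \<Rightarrow> bool" where
  "sweep_step p' p \<longleftrightarrow> (\<forall>S<K. p' S = p S \<or> (p' S, p S) \<in> A)"

definition sweep :: "nat \<Rightarrow> (nat \<Rightarrow> nat) \<Rightarrow> (nat \<Rightarrow> nat) \<Rightarrow> (nat \<Rightarrow> nat) \<Rightarrow> (nat \<Rightarrow> nat) \<Rightarrow> bool" where
  "sweep \<tau> lo hi z p \<longleftrightarrow> (\<exists>q. (\<forall>S<K. q \<tau> S = p S) \<and> (\<forall>\<tau>'\<le>\<tau>. sweep_ok \<tau>' lo hi z (q \<tau>')) \<and>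
     (\<forall>\<tau>'<\<tau>. sweep_step (q \<tau>') (q (Suc \<tau>'))))"

definition between :: "nat \<Rightarrow> nat \<Rightarrow> nat \<Rightarrow> bool" where
  "between v x y \<longleftrightarrow> (\<exists>a<n. \<exists>b<n. \<exists>c<n. is_gdist a x v \<and> is_gdist b v y \<and> is_gdist c x y \<and> a + b = c)"

text \<open>The pairs \<open>lo\<close>, \<open>hi\<close> and \<open>x\<close>, \<open>y\<close>
  are the same two ends, ordered by the distance from the root and along the path: a block may run
  towards its root. The conditions make the blocks concatenate to a shortest path whichever shortest
  paths the pebbles take. Blocks with the same root are left to the sweep.\<close>

definition valid :: "(nat \<Rightarrow> nat) \<Rightarrow> (nat \<Rightarrow> nat) \<Rightarrow> (nat \<Rightarrow> nat) \<Rightarrow> (nat \<Rightarrow> nat) \<Rightarrow> (nat \<Rightarrow> nat) \<Rightarrow> bool" where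
  "valid lo hi z x y \<longleftrightarrow>
     (\<forall>S<K. between (lo S) (z S) (hi S)) \<and>
     (\<forall>S<K. (x S = lo S \<and> y S = hi S \<or> x S = hi S \<and> y S = lo S) \<and> between (x S) (s (path_of S)) (y S)) \<and>
     (\<forall>i<k. x (i * Suc M) = s i \<and> y (i * Suc M + M) = t i) \<and>
     (\<forall>i<k. \<forall>m<M. y (i * Suc M + m) = x (i * Suc M + Suc m) \<or>
        (y (i * Suc M + m), x (i * Suc M + Suc m)) \<in> A \<and>
        (\<exists>a<n. \<exists>b<n. is_gdist a (s i) (y (i * Suc M + m)) \<and> is_gdist b (s i) (x (i * Suc M + Suc m)) \<and> Suc a = b)) \<and>
     (\<forall>S<K. \<forall>S'<K. path_of S \<noteq> path_of S' \<longrightarrow> z S = z S' \<or> \<not> (\<exists>v<n. between v (x S) (y S) \<and> between v (x S') (y S')))"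

definition accepted :: bool where
  "accepted \<longleftrightarrow> (\<exists>lo hi z p x y. (\<forall>S<K. lo S < n \<and> hi S < n \<and> z S < n \<and> p S < n \<and> x S < n \<and> y S < n) \<and>
     sweep (n - 1) lo hi z p \<and> valid lo hi z x y)"

lemma K_less: "S < K \<Longrightarrow> path_of S < k"
  by (simp add: less_mult_imp_div_less)

lemma segment_index:
  assumes "i < k" "m \<le> M"
  shows "i * Suc M + m < K" "path_of (i * Suc M + m) = i" "(i * Suc M + m) mod Suc M = m"
proof -
  have "i * Suc M + m < Suc i * Suc M" using assms by simp
  also have "\<dots> \<le> K" using assms by (intro mult_le_mono1) simp
  finally show "i * Suc M + m < K" .
  show "path_of (i * Suc M + m) = i" "(i * Suc M + m) mod Suc M = m"
    using assms by (simp_all add: div_mult_self3[of "Suc M" m i, simplified add.commute] del: mult_Suc_right)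
qed

lemma between_iff: "x < n \<Longrightarrow> between v x y \<longleftrightarrow> in_interval v x y"
proof
  assume x: "x < n" and v: "in_interval v x y"
  then have c: "conn x v" "conn v y" "conn x y" by (auto simp: in_interval_def intro: conn_trans)
  then have "gdist x v < n" "gdist v y < n" "gdist x y < n" using x gdist_less conn_less by blast+
  then show "between v x y" using v c unfolding between_def in_interval_def is_gdist_iff by blast
qed (auto simp: between_def in_interval_def is_gdist_iff)

lemma in_interval_sym: "in_interval v x y \<longleftrightarrow> in_interval v y x"
  unfolding in_interval_def using conn_sym gdist_sym by (metis add.commute)

text \<open>The vertices visited by the pebbles of one path contain a shortest path. A vertex
  visited for two paths lies in the intervals of two blocks, which therefore have the same root;
  both pebbles are there at the time given by its distance from the root, when the collision was
  checked.\<close>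

lemma accepted_imp_solvable:
  assumes accepted shows solvable
proof -
  obtain lo hi z p x y where bd: "\<And>S. S < K \<Longrightarrow> lo S < n \<and> hi S < n \<and> z S < n \<and> p S < n \<and> x S < n \<and> y S < n"
    and sw: "sweep (n - 1) lo hi z p" and v: "valid lo hi z x y"
    using assms unfolding accepted_def by blast
  note v' = v[unfolded valid_def]
  note v1 = v'[THEN conjunct1] and v2 = v'[THEN conjunct2, THEN conjunct1]
    and v3 = v'[THEN conjunct2, THEN conjunct2, THEN conjunct1]
    and v4 = v'[THEN conjunct2, THEN conjunct2, THEN conjunct2, THEN conjunct1]
    and v5 = v'[THEN conjunct2, THEN conjunct2, THEN conjunct2, THEN conjunct2]
  obtain q where q: "\<And>\<tau>. \<tau> \<le> n - 1 \<Longrightarrow> sweep_ok \<tau> lo hi z (q \<tau>)" "\<And>\<tau>. \<tau> < n - 1 \<Longrightarrow> sweep_step (q \<tau>) (q (Suc \<tau>))"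
    using sw unfolding sweep_def by blast
  define \<alpha> \<beta> where "\<alpha> S = gdist (z S) (lo S)" and "\<beta> S = gdist (z S) (hi S)" for S
  have zz: "conn (z S) (lo S)" "conn (z S) (hi S)" "conn (lo S) (hi S)" "\<beta> S = \<alpha> S + gdist (lo S) (hi S)" "\<beta> S < n"
    if S: "S < K" for S
    using v1[rule_format, OF S] unfolding between_def is_gdist_iff \<alpha>_def \<beta>_def by auto
  have xy: "x S = lo S \<and> y S = hi S \<or> x S = hi S \<and> y S = lo S"
    "conn (s (path_of S)) (x S)" "conn (s (path_of S)) (y S)"
    "gdist (s (path_of S)) (y S) = gdist (s (path_of S)) (x S) + gdist (x S) (y S)" if "S < K" for S
    using v2[rule_format, OF that] unfolding between_def is_gdist_iff by auto
  have pos: "q (\<alpha> S) S = lo S" "q (\<beta> S) S = hi S"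
    "\<And>\<tau>. \<alpha> S \<le> \<tau> \<Longrightarrow> \<tau> \<le> \<beta> S \<Longrightarrow> conn (z S) (q \<tau> S) \<and> gdist (z S) (q \<tau> S) = \<tau>" if S: "S < K" for S
  proof -
    have ok: "(\<tau> \<le> \<alpha> S \<longrightarrow> q \<tau> S = lo S) \<and> (\<alpha> S < \<tau> \<and> \<tau> < \<beta> S \<longrightarrow> is_gdist \<tau> (z S) (q \<tau> S)) \<and> (\<beta> S \<le> \<tau> \<longrightarrow> q \<tau> S = hi S)"
      if "\<tau> \<le> n - 1" for \<tau>
      using q(1)[OF that] S unfolding sweep_ok_def position_ok_def is_gdist_iff \<alpha>_def \<beta>_def by blast
    have le: "\<alpha> S \<le> n - 1" "\<beta> S \<le> n - 1" using zz(4,5)[OF S] by auto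
    show 1: "q (\<alpha> S) S = lo S" "q (\<beta> S) S = hi S" using ok le by auto
    fix \<tau> assume \<tau>: "\<alpha> S \<le> \<tau>" "\<tau> \<le> \<beta> S"
    then consider "\<tau> = \<alpha> S" | "\<tau> = \<beta> S" | "\<alpha> S < \<tau> \<and> \<tau> < \<beta> S" by linarith
    then show "conn (z S) (q \<tau> S) \<and> gdist (z S) (q \<tau> S) = \<tau>"
    proof cases
      case 1
      then show ?thesis using \<open>q (\<alpha> S) S = lo S\<close> zz(1)[OF S] by (simp add: \<alpha>_def)
    next
      case 2
      then show ?thesis using \<open>q (\<beta> S) S = hi S\<close> zz(2)[OF S] by (simp add: \<beta>_def)
    next
      case 3
      then show ?thesis using ok[of \<tau>] \<tau> le by (simp add: is_gdist_iff)
    qed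
  qed
  \<comment> \<open>Vertices visited for path \<open>i\<close>; \<open>AT i\<close> restricts the
    graph to them, so that walks in \<open>AT i\<close> inherit the disjointness.\<close>
  define T where "T i = {v. \<exists>S<K. path_of S = i \<and> (\<exists>\<tau>. \<alpha> S \<le> \<tau> \<and> \<tau> \<le> \<beta> S \<and> q \<tau> S = v)}" for i
  define AT where "AT i = A \<inter> T i \<times> T i" for i
  have symAT: "sym (AT i)" for i using A_sym unfolding AT_def sym_def by blast
  have inT: "q \<tau> S \<in> T (path_of S)" if "S < K" "\<alpha> S \<le> \<tau>" "\<tau> \<le> \<beta> S" for \<tau> S
    unfolding T_def using that by blast
  have seg: "(q \<tau> S, q \<tau>' S) \<in> AT (path_of S) ^^ (\<tau>' - \<tau>)"
    if S: "S < K" and \<tau>: "\<alpha> S \<le> \<tau>" "\<tau> \<le> \<tau>'" "\<tau>' \<le> \<beta> S" for \<tau> \<tau>' S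
    using \<tau>(2,3)
  proof (induction \<tau>' rule: dec_induct)
    case (step m)
    have mm: "\<alpha> S \<le> m" "m \<le> \<beta> S" "\<alpha> S \<le> Suc m" "m < n - 1" using step \<tau> zz(5)[OF S] by auto
    \<comment> \<open>A pebble on its way changes its distance from the root at each step, so it
      cannot rest and must use an arc.\<close>
    have "q m S \<noteq> q (Suc m) S" using pos(3)[OF S mm(1,2)] pos(3)[OF S mm(3) step.prems] by auto
    then have "(q m S, q (Suc m) S) \<in> A" using q(2)[OF mm(4)] S unfolding sweep_step_def by blast
    then have "(q m S, q (Suc m) S) \<in> AT (path_of S)"
      using inT[OF S mm(1,2)] inT[OF S mm(3) step.prems] by (simp add: AT_def)
    then show ?case using step by (auto simp: Suc_diff_le)
  qed simp
  have AT_A: "(u, v) \<in> AT i ^^ m \<Longrightarrow> (u, v) \<in> A ^^ m" for u v i m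
    by (induction m arbitrary: v) (auto simp: AT_def)
  have segxy: "(x S, y S) \<in> AT (path_of S) ^^ gdist (x S) (y S)" if S: "S < K" for S
  proof -
    have "(lo S, hi S) \<in> AT (path_of S) ^^ gdist (lo S) (hi S)"
      using seg[OF S order.refl _ order.refl] pos(1,2)[OF S] zz(4)[OF S] by simp
    then show ?thesis using xy(1)[OF S] sym_relpow[OF symAT] gdist_sym by metis
  qed
  have xyT: "x S \<in> T (path_of S)" "y S \<in> T (path_of S)" if S: "S < K" for S
    using xy(1)[OF S] inT[OF S, of "\<alpha> S"] inT[OF S, of "\<beta> S"] pos(1,2)[OF S] zz(4)[OF S] by auto
  have qI: "in_interval (q \<tau> S) (x S) (y S)" if S: "S < K" and \<tau>: "\<alpha> S \<le> \<tau>" "\<tau> \<le> \<beta> S" for \<tau> S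
  proof -
    have 1: "(lo S, q \<tau> S) \<in> A ^^ (\<tau> - \<alpha> S)" "(q \<tau> S, hi S) \<in> A ^^ (\<beta> S - \<tau>)"
      using seg[OF S order.refl \<tau>] seg[OF S \<tau>] pos(1,2)[OF S] by (auto intro!: AT_A)
    have c: "conn (lo S) (q \<tau> S)" "conn (q \<tau> S) (hi S)" using 1 relpow_conn by blast+
    have "gdist (lo S) (q \<tau> S) \<le> \<tau> - \<alpha> S" "gdist (q \<tau> S) (hi S) \<le> \<beta> S - \<tau>" using 1 gdist_le by blast+
    then have "in_interval (q \<tau> S) (lo S) (hi S)"
      using gdist_triangle[OF c] c \<tau> zz(4)[OF S] unfolding in_interval_def by simp
    then show ?thesis using xy(1)[OF S] in_interval_sym by metis
  qed
  have common: "(v = s i \<or> v = t i) \<and> (v = s j \<or> v = t j)" if vT: "v \<in> T i" "v \<in> T j" "i \<noteq> j" for v i j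
  proof -
    obtain S \<tau> where S: "S < K" "path_of S = i" "\<alpha> S \<le> \<tau>" "\<tau> \<le> \<beta> S" "q \<tau> S = v" using vT(1) unfolding T_def by blast
    obtain S' \<tau>' where S': "S' < K" "path_of S' = j" "\<alpha> S' \<le> \<tau>'" "\<tau>' \<le> \<beta> S'" "q \<tau>' S' = v"
      using vT(2) unfolding T_def by blast
    have "in_interval v (x S) (y S)" "in_interval v (x S') (y S')"
      using qI[OF S(1,3,4)] qI[OF S'(1,3,4)] S(5) S'(5) by auto
    then have B: "between v (x S) (y S)" "between v (x S') (y S')" "v < n"
      using between_iff bd S(1) S'(1) conn_less unfolding in_interval_def by blast+
    have "z S = z S'"
      using v5 S(1,2) S'(1,2) vT(3) B by blast
    \<comment> \<open>Both times are the distance of \<open>v\<close> from the common root.\<close>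
    then have "\<tau> = \<tau>'" using pos(3)[OF S(1,3,4)] pos(3)[OF S'(1,3,4)] S(5) S'(5) by metis
    moreover have "collision_ok (q \<tau>) S S'"
      using q(1)[of \<tau>] S S' vT(3) zz(5)[OF S(1)] unfolding sweep_ok_def by fastforce
    ultimately show ?thesis using S S' unfolding collision_ok_def by metis
  qed
  \<comment> \<open>The walks of the blocks add up to exactly the distance from \<open>s i\<close>,
    so the concatenation is a shortest path.\<close>
  have chain: "(s i, y (i * Suc M + m)) \<in> AT i ^^ gdist (s i) (y (i * Suc M + m))" if i: "i < k" and "m \<le> M" for i m
    using \<open>m \<le> M\<close>
  proof (induction m)
    note SK = segment_index(1)[OF i] and SP = segment_index(2)[OF i]
    {
      case 0
      have "x (i * Suc M) = s i" using v3 i by blast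
      then show ?case using segxy[OF SK[of 0]] xy(4)[OF SK[of 0]] SP[of 0] by simp
    next
      case (Suc m)
      let ?S = "i * Suc M + m" and ?S' = "i * Suc M + Suc m"
      have K: "?S < K" "?S' < K" and P: "path_of ?S = i" "path_of ?S' = i"
        using SK[of m] SK[of "Suc m"] SP[of m] SP[of "Suc m"] Suc.prems by auto
      have IH: "(s i, y ?S) \<in> AT i ^^ gdist (s i) (y ?S)" using Suc by simp
      have "(s i, x ?S') \<in> AT i ^^ gdist (s i) (x ?S')"
      proof (cases "y ?S = x ?S'")
        case False
        then have e: "(y ?S, x ?S') \<in> A" "Suc (gdist (s i) (y ?S)) = gdist (s i) (x ?S')"
          using v4[rule_format, OF i, of m] Suc.prems unfolding is_gdist_iff by auto
        then have "(y ?S, x ?S') \<in> AT i" using xyT(2)[OF K(1)] xyT(1)[OF K(2)] P by (simp add: AT_def)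
        then show ?thesis using IH e(2) by (metis relpow_Suc_I)
      qed (use IH in simp)
      then have "(s i, y ?S') \<in> AT i ^^ (gdist (s i) (x ?S') + gdist (x ?S') (y ?S'))"
        using segxy[OF K(2)] unfolding P relpow_add by blast
      then show ?case using xy(4)[OF K(2)] P by simp
    }
  qed
  have "\<exists>f. spath f (s i) (t i) \<and> (\<forall>a\<le>gdist (s i) (t i). f a \<in> T i)" if i: "i < k" for i
  proof -
    have yt: "y (i * Suc M + M) = t i" and xs: "x (i * Suc M) = s i" using v3 i by blast+
    have "(s i, t i) \<in> AT i ^^ gdist (s i) (t i)" using chain[OF i order.refl] yt by simp
    then obtain f where f: "f 0 = s i" "f (gdist (s i) (t i)) = t i" "\<forall>a<gdist (s i) (t i). (f a, f (Suc a)) \<in> AT i"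
      unfolding relpow_fun_conv by blast
    have "i * Suc M < K" using i by (intro mult_less_mono1) auto
    then have sT: "s i \<in> T i" using xyT(1)[of "i * Suc M"] xs by (simp del: mult_Suc_right)
    have "f a \<in> T i" if "a \<le> gdist (s i) (t i)" for a
      using f(1,3) sT that unfolding AT_def by (cases a) auto
    moreover have "conn (s i) (t i)" using \<open>(s i, t i) \<in> AT i ^^ gdist (s i) (t i)\<close> AT_A relpow_conn by blast
    ultimately show ?thesis using f unfolding spath_def AT_def by blast
  qed
  then obtain f where f: "\<And>i. i < k \<Longrightarrow> spath (f i) (s i) (t i) \<and> (\<forall>a\<le>gdist (s i) (t i). f i a \<in> T i)"
    by metis
  show solvable
    unfolding solvable_def
  proof (rule exI[of _ f], intro allI impI conjI)
    fix i assume i: "i < k"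
    show "spath (f i) (s i) (t i)" using f[OF i] by blast
    fix j a b assume j: "j < k" "j \<noteq> i" and ab: "0 < a" "a < gdist (s i) (t i)" "b \<le> gdist (s j) (t j)"
    show "f i a \<noteq> f j b"
    proof
      assume "f i a = f j b"
      then have "f i a = s i \<or> f i a = t i"
        using common[of "f i a" i j] f[OF i] f[OF j(1)] ab j(2) by (metis less_imp_le)
      moreover have "gdist (s i) (f i a) = a" using spath_gdist0[of "f i" "s i" "t i" a] f[OF i] ab by simp
      ultimately show False using ab by auto
    qed
  qed
qed

text \<open>The blocks are those of \<open>segmentation\<close>, and the pebbles follow the given
  solution.\<close>

lemma solvable_imp_accepted:
  assumes solvable and M: "M = 2 * (1 + 4 * k * k) ^ (k * k)"
  shows accepted
proof -
  obtain f where F: "\<forall>i<k. spath (f i) (s i) (t i) \<and> (\<forall>j<k. j \<noteq> i \<longrightarrow>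
     (\<forall>a b. 0 < a \<longrightarrow> a < gdist (s i) (t i) \<longrightarrow> b \<le> gdist (s j) (t j) \<longrightarrow> f i a \<noteq> f j b))"
    using assms(1) unfolding solvable_def by (rule exE)
  have f: "spath (f i) (s i) (t i)" if "i < k" for i
    using F that by simp
  have disj: "f i a \<noteq> f j b" if "i < k" "j < k" "j \<noteq> i" "0 < a" "a < gdist (s i) (t i)" "b \<le> gdist (s j) (t j)" for i j a b
    using F that by simp
  interpret P: spaths n A k s t f by unfold_locales (rule f)
  define L where "L i = gdist (s i) (t i)" for i
  have PL: "P.L = L" by (simp add: fun_eq_iff L_def P.L_def)
  obtain a b z where abz: "\<And>i. i < k \<Longrightarrow> a i 0 = 0 \<and> b i M = L i"
    and ab: "\<And>i m. i < k \<Longrightarrow> a i m \<le> b i m \<and> b i m \<le> L i"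
    and z1: "\<And>i m. i < k \<Longrightarrow> (\<exists>l<k. z i m = s l) \<and> conn (z i m) (f i (a i m))"
    and z2: "\<And>i m. i < k \<Longrightarrow> gdist (z i m) (f i (b i m)) = gdist (z i m) (f i (a i m)) + gdist (f i (a i m)) (f i (b i m)) \<or>
       gdist (z i m) (f i (a i m)) = gdist (z i m) (f i (b i m)) + gdist (f i (a i m)) (f i (b i m))"
    and nxt: "\<And>i m. i < k \<Longrightarrow> a i (Suc m) = b i m \<or> a i (Suc m) = Suc (b i m)"
    and sep: "\<And>i m j m'. i < k \<Longrightarrow> j < k \<Longrightarrow> z i m = z j m' \<or>
        \<not> (\<exists>v. in_interval v (f i (a i m)) (f i (b i m)) \<and> in_interval v (f j (a j m')) (f j (b j m')))"
    using P.segmentation[folded M, unfolded PL] by blast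
  define ia ib where "ia S = a (path_of S) (S mod Suc M)" and "ib S = b (path_of S) (S mod Suc M)" for S
  define Z where "Z S = z (path_of S) (S mod Suc M)" for S
  define x y where "x S = f (path_of S) (ia S)" and "y S = f (path_of S) (ib S)" for S
  \<comment> \<open>Whether the distance from the root grows along the block. If not, the pebble
    runs backwards through the path.\<close>
  define up where "up S \<longleftrightarrow> gdist (Z S) (x S) \<le> gdist (Z S) (y S)" for S
  define lo hi where "lo S = (if up S then x S else y S)" and "hi S = (if up S then y S else x S)" for S
  \<comment> \<open>Number of steps made by time \<tau>: truncated subtraction keeps it 0 before the
    start, the minimum stops it on arrival.\<close>
  define r where "r \<tau> S = min \<tau> (gdist (Z S) (hi S)) - gdist (Z S) (lo S)" for \<tau> S
  define ix where "ix \<tau> S = (if up S then ia S + r \<tau> S else ib S - r \<tau> S)" for \<tau> S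
  define q where "q \<tau> S = f (path_of S) (ix \<tau> S)" for \<tau> S
  have i: "ia S \<le> ib S" "ib S \<le> L (path_of S)" if "S < K" for S
    using ab[OF K_less[OF that]] by (auto simp: ia_def ib_def)
  have fs: "f (path_of S) c < n" if "S < K" "c \<le> L (path_of S)" for S c
    using spath_less[OF f] st K_less that unfolding L_def by blast
  have xy: "gdist (x S) (y S) = ib S - ia S" "conn (x S) (y S)" "x S < n" "y S < n"
    "conn (s (path_of S)) (x S)" "conn (s (path_of S)) (y S)" "gdist (s (path_of S)) (x S) = ia S" "gdist (s (path_of S)) (y S) = ib S"
    if S: "S < K" for S
    using spath_gdist[OF f[OF K_less[OF S]]] spath_conn[OF f[OF K_less[OF S]]] spath_conn0[OF f[OF K_less[OF S]]]
      spath_gdist0[OF f[OF K_less[OF S]]] i[OF S] fs[OF S] unfolding x_def y_def L_def by auto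
  have zc: "conn (Z S) (x S)" "conn (Z S) (y S)" "Z S < n" if S: "S < K" for S
  proof -
    show 1: "conn (Z S) (x S)" using z1[OF K_less[OF S]] unfolding Z_def x_def ia_def by blast
    then show "conn (Z S) (y S)" using xy(2)[OF S] conn_trans by blast
    show "Z S < n" using z1[OF K_less[OF S], of "S mod Suc M"] st unfolding Z_def by auto
  qed
  have lh: "gdist (Z S) (hi S) = gdist (Z S) (lo S) + (ib S - ia S)" "conn (Z S) (lo S)" "conn (Z S) (hi S)"
    "conn (lo S) (hi S)" "gdist (lo S) (hi S) = ib S - ia S" "lo S < n" "hi S < n" if S: "S < K" for S
    using z2[OF K_less[OF S], of "S mod Suc M", folded Z_def ia_def ib_def, folded x_def y_def]
      zc[OF S] xy[OF S] conn_sym[OF xy(2)[OF S]] gdist_sym[of "x S" "y S"] unfolding lo_def hi_def up_def by auto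
  have r_le: "r \<tau> S \<le> ib S - ia S" if "S < K" for \<tau> S
    using lh(1)[OF that] unfolding r_def by auto
  have ix_le: "ia S \<le> ix \<tau> S" "ix \<tau> S \<le> ib S" if "S < K" for \<tau> S
    using r_le[OF that, of \<tau>] i[OF that] unfolding ix_def by auto
  have qn: "q \<tau> S < n" if "S < K" for \<tau> S
    using fs[OF that, of "ix \<tau> S"] ix_le[OF that, of \<tau>] i[OF that] unfolding q_def by auto
  have lvl: "conn (Z S) (q \<tau> S)" "gdist (Z S) (q \<tau> S) = gdist (Z S) (lo S) + r \<tau> S" if S: "S < K" for \<tau> S
  proof -
    note sp = f[OF K_less[OF S]]
    have e: "gdist (x S) (q \<tau> S) = ix \<tau> S - ia S" "conn (x S) (q \<tau> S)"
      "gdist (q \<tau> S) (y S) = ib S - ix \<tau> S" "conn (q \<tau> S) (y S)"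
      using spath_gdist[OF sp] spath_conn[OF sp] ix_le[OF S, of \<tau>] i[OF S] unfolding q_def x_def y_def L_def by auto
    show c: "conn (Z S) (q \<tau> S)" using e(2) zc(1)[OF S] conn_trans by blast
    have e': "gdist (q \<tau> S) (x S) = ix \<tau> S - ia S" "conn (q \<tau> S) (x S)"
      "gdist (y S) (q \<tau> S) = ib S - ix \<tau> S" "conn (y S) (q \<tau> S)"
      using e gdist_sym conn_sym by metis+
    \<comment> \<open>One triangle inequality through the lower end bounds the distance from above,
      one through the upper end from below.\<close>
    show "gdist (Z S) (q \<tau> S) = gdist (Z S) (lo S) + r \<tau> S"
    proof (cases "up S")
      case True
      then show ?thesis
        using gdist_triangle[OF zc(1)[OF S] e(2)] gdist_triangle[OF c e(4)] e(1,3) lh(1)[OF S] r_le[OF S, of \<tau>] i[OF S]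
        unfolding lo_def hi_def ix_def by simp
    next
      case False
      then show ?thesis
        using gdist_triangle[OF zc(2)[OF S] e'(4)] gdist_triangle[OF c e'(2)] e'(1,3) lh(1)[OF S] r_le[OF S, of \<tau>] i[OF S]
        unfolding lo_def hi_def ix_def by simp
    qed
  qed
  have qlo: "q \<tau> S = lo S" if "S < K" "\<tau> \<le> gdist (Z S) (lo S)" for \<tau> S
    using that unfolding q_def ix_def r_def lo_def x_def y_def by auto
  have qhi: "q \<tau> S = hi S" if S: "S < K" "gdist (Z S) (hi S) \<le> \<tau>" for \<tau> S
  proof -
    have "r \<tau> S = ib S - ia S" using S lh(1)[OF S(1)] by (simp add: r_def)
    then show ?thesis using i[OF S(1)] unfolding q_def ix_def hi_def x_def y_def by auto
  qed
  have ok: "position_ok \<tau> (lo S) (hi S) (Z S) (q \<tau> S)" if S: "S < K" for \<tau> S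
    unfolding position_ok_def is_gdist_iff
  proof (intro exI conjI)
    show "gdist (Z S) (lo S) < n" "gdist (Z S) (hi S) < n" using gdist_less lh zc(3) S by blast+
    show "\<tau> \<le> gdist (Z S) (lo S) \<longrightarrow> q \<tau> S = lo S" "gdist (Z S) (hi S) \<le> \<tau> \<longrightarrow> q \<tau> S = hi S"
      using qlo[OF S] qhi[OF S] by auto
    show "gdist (Z S) (lo S) < \<tau> \<and> \<tau> < gdist (Z S) (hi S) \<longrightarrow> conn (Z S) (q \<tau> S) \<and> gdist (Z S) (q \<tau> S) = \<tau>"
      using lvl[OF S, of \<tau>] by (auto simp: r_def)
  qed (use lh[OF S] in auto)
  have ends: "f i c = s i \<or> f i c = t i" if "i < k" "j < k" "j \<noteq> i" "c \<le> L i" "e \<le> L j" "f i c = f j e" for i j c e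
  proof -
    have "\<not> (0 < c \<and> c < L i)" using disj[OF that(1-3), of c e] that unfolding L_def by blast
    then have "c = 0 \<or> c = L i" using that by auto
    then show ?thesis using f[OF that(1)] unfolding spath_def L_def by auto
  qed
  have co: "collision_ok (q \<tau>) S S'" if S: "S < K" "S' < K" "path_of S \<noteq> path_of S'" for \<tau> S S'
  proof -
    \<comment> \<open>At every time, also while waiting, a pebble stands on its solution path, so
      the disjointness of the paths settles all collisions.\<close>
    have l: "ix \<tau> S \<le> L (path_of S)" "ix \<tau> S' \<le> L (path_of S')"
      using ix_le[OF S(1), of \<tau>] ix_le[OF S(2), of \<tau>] i[OF S(1)] i[OF S(2)] by auto
    show ?thesis
      using ends[OF K_less[OF S(1)] K_less[OF S(2)] S(3)[symmetric] l]
        ends[OF K_less[OF S(2)] K_less[OF S(1)] S(3) l(2,1)] unfolding collision_ok_def q_def by metis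
  qed
  have stp: "sweep_step (q \<tau>) (q (Suc \<tau>))" for \<tau>
    unfolding sweep_step_def
  proof (intro allI impI)
    fix S assume S: "S < K"
    have "r (Suc \<tau>) S = r \<tau> S \<or> r (Suc \<tau>) S = Suc (r \<tau> S)" unfolding r_def by linarith
    then have "ix (Suc \<tau>) S = ix \<tau> S \<or> ix (Suc \<tau>) S = Suc (ix \<tau> S) \<or> ix \<tau> S = Suc (ix (Suc \<tau>) S)"
      using r_le[OF S, of "Suc \<tau>"] unfolding ix_def by auto
    moreover have "(f (path_of S) c, f (path_of S) (Suc c)) \<in> A" if "Suc c \<le> ib S" for c
      using f[OF K_less[OF S]] that i[OF S] unfolding spath_def L_def by auto
    ultimately show "q \<tau> S = q (Suc \<tau>) S \<or> (q \<tau> S, q (Suc \<tau>) S) \<in> A"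
      using ix_le(2)[OF S, of \<tau>] ix_le(2)[OF S, of "Suc \<tau>"] symD[OF A_sym] unfolding q_def by metis
  qed
  have sw: "sweep (n - 1) lo hi Z (q (n - 1))"
    unfolding sweep_def sweep_ok_def using ok co stp by (intro exI[of _ q]) blast
  have "valid lo hi Z x y"
    unfolding valid_def
  proof (intro conjI allI impI)
    fix S assume S: "S < K"
    show "between (lo S) (Z S) (hi S)" using between_iff[OF zc(3)[OF S]] lh[OF S] by (simp add: in_interval_def)
    show "x S = lo S \<and> y S = hi S \<or> x S = hi S \<and> y S = lo S" by (auto simp: lo_def hi_def)
    show "between (x S) (s (path_of S)) (y S)"
      using between_iff[of "s (path_of S)"] st[OF K_less[OF S]] xy[OF S] i[OF S] by (simp add: in_interval_def)
  next
    fix i assume i: "i < k"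
    have "x (i * Suc M) = f i 0" using segment_index(2,3)[OF i, of 0] abz[OF i] by (simp add: x_def ia_def)
    then show "x (i * Suc M) = s i" using f[OF i] by (simp add: spath_def)
    have "y (i * Suc M + M) = f i (L i)" using segment_index(2,3)[OF i order.refl] abz[OF i] by (simp add: y_def ib_def)
    then show "y (i * Suc M + M) = t i" using f[OF i] by (simp add: spath_def L_def)
  next
    fix i' m assume i': "i' < k" "m < M"
    let ?S = "i' * Suc M + m" and ?S' = "i' * Suc M + Suc m"
    have d: "?S < K" "path_of ?S = i'" "?S mod Suc M = m" using segment_index[OF i'(1), of m] i'(2) by auto
    have d': "?S' < K" "path_of ?S' = i'" "?S' mod Suc M = Suc m" using segment_index[OF i'(1), of "Suc m"] i'(2) by auto
    have e: "ia ?S' = ib ?S \<or> ia ?S' = Suc (ib ?S)"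
      using nxt[OF i'(1), of m] unfolding ia_def ib_def d d' .
    show "y ?S = x ?S' \<or> (y ?S, x ?S') \<in> A \<and>
        (\<exists>a<n. \<exists>b<n. is_gdist a (s i') (y ?S) \<and> is_gdist b (s i') (x ?S') \<and> Suc a = b)"
    proof (cases "ia ?S' = ib ?S")
      case True
      then show ?thesis unfolding x_def y_def d d' by simp
    next
      case False
      then have e: "ia ?S' = Suc (ib ?S)" using e by simp
      have "(y ?S, x ?S') \<in> A"
        using f[OF i'(1)] i[OF d'(1)] e unfolding x_def y_def d d' spath_def L_def by auto
      moreover have "gdist (s i') (y ?S) < n" "gdist (s i') (x ?S') < n" "conn (s i') (y ?S)" "conn (s i') (x ?S')"
        using gdist_less xy[OF d(1), unfolded d(2)] xy[OF d'(1), unfolded d'(2)] st[OF i'(1)] by blast+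
      moreover have "Suc (gdist (s i') (y ?S)) = gdist (s i') (x ?S')"
        using xy(8)[OF d(1), unfolded d(2)] xy(7)[OF d'(1), unfolded d'(2)] e by simp
      ultimately show ?thesis unfolding is_gdist_iff by metis
    qed
  next
    fix S S' assume S: "S < K" "S' < K" "path_of S \<noteq> path_of S'"
    have "Z S = Z S' \<or> \<not> (\<exists>v. in_interval v (x S) (y S) \<and> in_interval v (x S') (y S'))"
      unfolding Z_def x_def y_def ia_def ib_def using sep K_less S by blast
    then show "Z S = Z S' \<or> \<not> (\<exists>v<n. between v (x S) (y S) \<and> between v (x S') (y S'))"
      using between_iff[OF xy(3)[OF S(1)]] between_iff[OF xy(3)[OF S(2)]] by blast
  qed
  moreover have "\<forall>S<K. lo S < n \<and> hi S < n \<and> Z S < n \<and> q (n - 1) S < n \<and> x S < n \<and> y S < n"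
    using qn zc(3) lh(6,7) xy(3,4) by simp
  ultimately show accepted unfolding accepted_def using sw by blast
qed

section \<open>Recursion for the reachable configurations\<close>

lemma sweep_0: "sweep 0 lo hi z p \<longleftrightarrow> sweep_ok 0 lo hi z p"
proof -
  have cong: "sweep_ok \<tau> lo hi z q \<longleftrightarrow> sweep_ok \<tau> lo hi z p" if "\<forall>S<K. q S = p S" for q p \<tau>
    using that unfolding sweep_ok_def collision_ok_def by auto
  show ?thesis unfolding sweep_def using cong by (auto intro!: exI[of _ "\<lambda>_. p"])
qed

lemma sweep_ok_cong:
  assumes "\<And>S. S < K \<Longrightarrow> lo S = lo' S \<and> hi S = hi' S \<and> z S = z' S \<and> p S = p' S"
  shows "sweep_ok \<tau> lo hi z p \<longleftrightarrow> sweep_ok \<tau> lo' hi' z' p'"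
  using assms unfolding sweep_ok_def collision_ok_def by auto

lemma sweep_cong:
  assumes "\<And>S. S < K \<Longrightarrow> lo S = lo' S \<and> hi S = hi' S \<and> z S = z' S \<and> p S = p' S"
  shows "sweep \<tau> lo hi z p \<longleftrightarrow> sweep \<tau> lo' hi' z' p'"
proof -
  have "sweep_ok \<tau> lo hi z q \<longleftrightarrow> sweep_ok \<tau> lo' hi' z' q" for \<tau> q
    by (rule sweep_ok_cong) (use assms in auto)
  then show ?thesis using assms unfolding sweep_def by auto
qed

text \<open>A sweep may pass through arbitrary functions. That their values are vertices follows
  here, so that the previous configuration in \<open>sweep_Suc\<close> can be quantified over
  {..<n}.\<close>

lemma sweep_ok_bound:
  assumes "\<And>S. S < K \<Longrightarrow> lo S < n \<and> hi S < n \<and> z S < n" "sweep_ok \<tau> lo hi z p" "S < K"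
  shows "p S < n"
proof -
  have "p S = lo S \<or> p S = hi S \<or> conn (z S) (p S)"
    using assms(2,3) unfolding sweep_ok_def position_ok_def is_gdist_iff by (meson not_le)
  then show ?thesis using assms(1)[OF assms(3)] conn_less by auto
qed

lemma sweep_Suc:
  assumes "\<And>S. S < K \<Longrightarrow> lo S < n \<and> hi S < n \<and> z S < n"
  shows "sweep (Suc \<tau>) lo hi z p \<longleftrightarrow>
    sweep_ok (Suc \<tau>) lo hi z p \<and> (\<exists>p'. (\<forall>S<K. p' S < n) \<and> sweep \<tau> lo hi z p' \<and> sweep_step p' p)" (is "?l \<longleftrightarrow> ?r")
proof
  assume ?l
  then obtain q where q: "\<And>S. S < K \<Longrightarrow> q (Suc \<tau>) S = p S" "\<forall>\<tau>'\<le>Suc \<tau>. sweep_ok \<tau>' lo hi z (q \<tau>')"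
     "\<forall>\<tau>'<Suc \<tau>. sweep_step (q \<tau>') (q (Suc \<tau>'))"
    unfolding sweep_def by blast
  have "sweep_ok (Suc \<tau>) lo hi z p" using sweep_ok_cong[of lo lo hi hi z z "q (Suc \<tau>)" p] q(1,2) by auto
  moreover have "\<forall>S<K. q \<tau> S < n"
    using sweep_ok_bound[of lo hi z \<tau> "q \<tau>"] assms q(2) by simp
  moreover have "sweep \<tau> lo hi z (q \<tau>)" unfolding sweep_def using q by (intro exI[of _ q]) auto
  moreover have "sweep_step (q \<tau>) p" using q(1) q(3)[rule_format, of \<tau>] unfolding sweep_step_def by simp
  ultimately show ?r by blast
next
  assume ?r
  then obtain p' where r: "sweep_ok (Suc \<tau>) lo hi z p" "sweep \<tau> lo hi z p'" "sweep_step p' p" by blast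
  then obtain q where q: "\<And>S. S < K \<Longrightarrow> q \<tau> S = p' S" "\<forall>\<tau>'\<le>\<tau>. sweep_ok \<tau>' lo hi z (q \<tau>')"
     "\<forall>\<tau>'<\<tau>. sweep_step (q \<tau>') (q (Suc \<tau>'))"
    unfolding sweep_def by blast
  have "sweep_step (q \<tau>) p" using r(3) q(1) unfolding sweep_step_def by auto
  then show ?l unfolding sweep_def
    using q r(1) by (intro exI[of _ "q(Suc \<tau> := p)"]) (auto simp: le_Suc_eq less_Suc_eq)
qed

end

section \<open>The sweep as a formula\<close>

text \<open>By \<open>horner_inj\<close> no other vector writes to the cell, and the cell was zero
  before.\<close>

lemma filled_in:
  assumes "ws \<in> D" "D \<subseteq> vecs n m" "\<And>a. base \<le> a \<Longrightarrow> \<mu> a = 0"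
  shows "filled n base P \<mu> D (base + horner n ws) \<noteq> 0 \<longleftrightarrow> P ws"
proof -
  have "(\<exists>vs\<in>D. base + horner n ws = base + horner n vs \<and> P vs) \<longleftrightarrow> P ws"
    using assms(1,2) horner_inj[of ws _ n] unfolding vecs_def by auto blast+
  then show ?thesis using assms(3)[of "base + horner n ws"] unfolding filled_def by simp
qed

lemma filled_below:
  assumes "a < base"
  shows "filled n base P \<mu> D a = \<mu> a"
proof -
  have "\<not> (\<exists>ws\<in>D. a = base + horner n ws \<and> P ws)" using assms by auto
  then show ?thesis by (simp only: filled_def if_False)
qed

lemma filled_above:
  assumes "base + n ^ m \<le> a" "D \<subseteq> vecs n m"
  shows "filled n base P \<mu> D a = \<mu> a"
proof -
  have "a \<noteq> base + horner n ws" if "ws \<in> D" for ws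
  proof -
    have "length ws = m" "set ws \<subseteq> {..<n}" using subsetD[OF assms(2) that] by (auto simp: vecs_def)
    then have "base + horner n ws < a" using horner_less[of ws n] assms(1) by simp
    then show ?thesis by simp
  qed
  then have "\<not> (\<exists>ws\<in>D. a = base + horner n ws \<and> P ws)" by blast
  then show ?thesis by (simp only: filled_def if_False)
qed

abbreviation (input) "vA \<equiv> 5 :: nat"
abbreviation (input) "vE \<equiv> 6 :: nat"
abbreviation (input) "vR \<equiv> 7 :: nat"

text \<open>
  The families \<open>c\<close> of variables \<open>V c j\<close> are: 0, 1 terminals; 2, 3, 4 values of \<open>lo\<close>, \<open>hi\<close>, \<open>z\<close>; 5, 6 current and
  previous positions; 7, 8 first and last vertices of the blocks. Below 20, variables 10 and 11 are times,
  12 to 14 distances, and 15 to 17 vertices.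
\<close>

definition V :: "nat \<Rightarrow> nat \<Rightarrow> nat" where "V c j = 20 + c + 10 * j"

lemma V_eq:
  assumes "c < 10" "c' < 10"
  shows "V c j = V c' j' \<longleftrightarrow> c = c' \<and> j = j'"
proof
  assume "V c j = V c' j'"
  then have *: "c + 10 * j = c' + 10 * j'" by (simp add: V_def)
  have "c = (c + 10 * j) mod 10" "c' = (c' + 10 * j') mod 10" using assms by simp_all
  then show "c = c' \<and> j = j'" using * by simp
qed simp

lemma V_ge: "20 \<le> V c j" by (simp add: V_def)

lemma V_neq [simp]: "v < 20 \<Longrightarrow> V c j \<noteq> v" "v < 20 \<Longrightarrow> v \<noteq> V c j"
  using V_ge[of c j] by auto

text \<open>Here \<open>cross_pt\<close> is a variable, standing for an arbitrary set of
  indices.\<close>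

lemma notin_V [simp]: "v < 20 \<Longrightarrow> v \<notin> V c ` cross_pt"
  using V_ge by (metis image_iff not_le)

lemma V_notin [simp]: "c < 10 \<Longrightarrow> c' < 10 \<Longrightarrow> c \<noteq> c' \<Longrightarrow> V c S \<notin> V c' ` cross_pt"
  by (auto simp: V_eq)

text \<open>An opaque form of a table lookup, for which the contents of the tables can be stated as
  rewrite rules.\<close>

definition nonzero :: "(nat \<Rightarrow> nat) \<Rightarrow> nat \<Rightarrow> bool" where "nonzero \<mu> a \<longleftrightarrow> \<mu> a \<noteq> 0"

lemma sat_Tab: "sat n \<mu> e (Tab b rs) \<longleftrightarrow> nonzero \<mu> (e b + horner n (map e rs))"
  by (simp add: nonzero_def)

declare sat.simps(2) [simp del] and sat_Tab [simp]

section \<open>Derived connectives\<close>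

definition "Tru = Le vZ vZ vZ vZ"
definition "Eqv a b = Conj (Le a vZ b vZ) (Le b vZ a vZ)"
definition "Leq a b = Le a vZ b vZ"
definition "Lss a b = Le a vO b vZ"
definition "Plus a b c = Conj (Le a b c vZ) (Le c vZ a b)"
definition "Dis f g = Neg (Conj (Neg f) (Neg g))"
definition "Imp f g = Neg (Conj f (Neg g))"
definition "conjs fs = foldr Conj fs Tru"
definition "Exs vs f = foldr Ex vs f"

lemma sat_basic [simp]:
  "sat n \<mu> e Tru"
  "sat n \<mu> e (Dis f g) \<longleftrightarrow> sat n \<mu> e f \<or> sat n \<mu> e g"
  "sat n \<mu> e (Imp f g) \<longleftrightarrow> (sat n \<mu> e f \<longrightarrow> sat n \<mu> e g)"
  "e vZ = 0 \<Longrightarrow> sat n \<mu> e (Eqv a b) \<longleftrightarrow> e a = e b"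
  "e vZ = 0 \<Longrightarrow> sat n \<mu> e (Leq a b) \<longleftrightarrow> e a \<le> e b"
  "e vZ = 0 \<Longrightarrow> e vO = 1 \<Longrightarrow> sat n \<mu> e (Lss a b) \<longleftrightarrow> e a < e b"
  "e vZ = 0 \<Longrightarrow> sat n \<mu> e (Plus a b c) \<longleftrightarrow> e a + e b = e c"
  by (auto simp: Tru_def Dis_def Imp_def Eqv_def Leq_def Lss_def Plus_def)

lemma sat_conjs [simp]: "sat n \<mu> e (conjs fs) \<longleftrightarrow> (\<forall>f\<in>set fs. sat n \<mu> e f)"
  by (induction fs) (auto simp: conjs_def)

lemma sat_conjs_Cons: "sat n \<mu> e (conjs (f # fs)) \<longleftrightarrow> sat n \<mu> e f \<and> sat n \<mu> e (conjs fs)"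
  and sat_conjs_Nil: "sat n \<mu> e (conjs []) \<longleftrightarrow> True"
  by simp_all

lemma sat_conjs_map:
  "(\<And>i. i < m \<Longrightarrow> sat n \<mu> e (f i) \<longleftrightarrow> P i) \<Longrightarrow> sat n \<mu> e (conjs (map f [0..<m])) \<longleftrightarrow> (\<forall>i<m. P i)"
  by auto

text \<open>A block of quantifiers amounts to the choice of one environment, even if a variable is
  repeated.\<close>

lemma sat_Exs: "sat n \<mu> e (Exs vs f) \<longleftrightarrow>
   (\<exists>e'. (\<forall>v. v \<notin> set vs \<longrightarrow> e' v = e v) \<and> (\<forall>v\<in>set vs. e' v < n) \<and> sat n \<mu> e' f)"
proof (induction vs arbitrary: e)
  case Nil
  have "(\<forall>v. e' v = e v) \<longleftrightarrow> e' = e" for e' by auto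
  then show ?case by (simp add: Exs_def)
next
  case (Cons v vs)
  have "sat n \<mu> e (Exs (v # vs) f) \<longleftrightarrow> (\<exists>x<n. sat n \<mu> (e(v := x)) (Exs vs f))"
    by (simp add: Exs_def)
  also have "\<dots> \<longleftrightarrow> (\<exists>x<n. \<exists>e'. (\<forall>u. u \<notin> set vs \<longrightarrow> e' u = (e(v := x)) u) \<and> (\<forall>u\<in>set vs. e' u < n) \<and> sat n \<mu> e' f)"
    unfolding Cons.IH ..
  also have "\<dots> \<longleftrightarrow> (\<exists>e'. (\<forall>u. u \<notin> set (v # vs) \<longrightarrow> e' u = e u) \<and> (\<forall>u\<in>set (v # vs). e' u < n) \<and> sat n \<mu> e' f)"
    (is "?l \<longleftrightarrow> ?r")
  proof
    assume ?l
    then obtain x e' where x: "x < n" "\<forall>u. u \<notin> set vs \<longrightarrow> e' u = (e(v := x)) u" "\<forall>u\<in>set vs. e' u < n" "sat n \<mu> e' f"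
      by blast
    have "e' v < n" using x(1-3) by (cases "v \<in> set vs") auto
    then show ?r using x by (intro exI[of _ e']) auto
  next
    assume ?r
    then obtain e' where "\<forall>u. u \<notin> set (v # vs) \<longrightarrow> e' u = e u" "\<forall>u\<in>set (v # vs). e' u < n" "sat n \<mu> e' f"
      by blast
    then show ?l by (intro exI[of _ "e' v"] conjI exI[of _ e']) auto
  qed
  finally show ?case .
qed

text \<open>Breadth-first search: the distance is \<open>10\<close> iff some neighbour of the target
  is at distance one less and no smaller value is the distance. Only lower rows of the table are
  looked up.\<close>

definition dist_fm :: fm where
  "dist_fm = Dis (Conj (Eqv 10 vZ) (Eqv 16 17))
    (Conj (Ex 11 (Conj (Plus 11 vO 10) (Ex 15 (Conj (Tab vE [11, 16, 15]) (Tab vA [15, 17])))))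
      (Neg (Ex 11 (Conj (Lss 11 10) (Tab vE [11, 16, 17])))))"

text \<open>The time comes first because rows are filled in its order. Family \<open>c\<close> is 5
  for current and 6 for previous positions.\<close>

definition rsR :: "nat \<Rightarrow> nat \<Rightarrow> nat \<Rightarrow> nat list" where
  "rsR K \<tau> c = \<tau> # map (V 2) [0..<K] @ map (V 3) [0..<K] @ map (V 4) [0..<K] @ map (V c) [0..<K]"

definition position_fm :: "nat \<Rightarrow> fm" where
  "position_fm S = Ex 12 (Ex 13 (conjs [Tab vE [12, V 4 S, V 2 S], Tab vE [13, V 4 S, V 3 S],
     Imp (Leq 10 12) (Eqv (V 5 S) (V 2 S)),
     Imp (Conj (Lss 12 10) (Lss 10 13)) (Tab vE [10, V 4 S, V 5 S]),
     Imp (Leq 13 10) (Eqv (V 5 S) (V 3 S))]))"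

definition collision_fm :: "nat \<Rightarrow> nat \<Rightarrow> nat \<Rightarrow> fm" where
  "collision_fm M S S' = (if S div Suc M = S' div Suc M then Tru else Imp (Eqv (V 5 S) (V 5 S'))
     (Conj (Dis (Eqv (V 5 S) (V 0 (S div Suc M))) (Eqv (V 5 S) (V 1 (S div Suc M))))
           (Dis (Eqv (V 5 S) (V 0 (S' div Suc M))) (Eqv (V 5 S) (V 1 (S' div Suc M))))))"

definition sweep_ok_fm :: "nat \<Rightarrow> nat \<Rightarrow> fm" where
  "sweep_ok_fm M K = Conj (conjs (map position_fm [0..<K]))
     (conjs (map (\<lambda>S. conjs (map (collision_fm M S) [0..<K])) [0..<K]))"

definition step_fm :: "nat \<Rightarrow> fm" where
  "step_fm S = Dis (Eqv (V 6 S) (V 5 S)) (Tab vA [V 6 S, V 5 S])"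

text \<open>The right-hand sides of \<open>sweep_0\<close> and \<open>sweep_Suc\<close>: variable 11
  is the preceding time, and the previous configuration is looked up in its row.\<close>

definition sweep_fm :: "nat \<Rightarrow> nat \<Rightarrow> fm" where
  "sweep_fm M K = Conj (sweep_ok_fm M K) (Dis (Eqv 10 vZ) (Ex 11 (Conj (Plus 11 vO 10)
     (Exs (map (V 6) [0..<K]) (Conj (Tab vR (rsR K 11 6)) (conjs (map step_fm [0..<K])))))))"

definition interval_fm :: "nat \<Rightarrow> nat \<Rightarrow> nat \<Rightarrow> fm" where
  "interval_fm v x y = Ex 12 (Ex 13 (Ex 14 (conjs [Tab vE [12, x, v], Tab vE [13, v, y], Tab vE [14, x, y], Plus 12 13 14])))"

definition diagonal_fm :: "nat \<Rightarrow> fm" where "diagonal_fm S = interval_fm (V 2 S) (V 4 S) (V 3 S)"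

definition orientation_fm :: "nat \<Rightarrow> nat \<Rightarrow> fm" where
  "orientation_fm M S = Conj (Dis (Conj (Eqv (V 7 S) (V 2 S)) (Eqv (V 8 S) (V 3 S)))
       (Conj (Eqv (V 7 S) (V 3 S)) (Eqv (V 8 S) (V 2 S))))
     (interval_fm (V 7 S) (V 0 (S div Suc M)) (V 8 S))"

definition ends_fm :: "nat \<Rightarrow> nat \<Rightarrow> fm" where
  "ends_fm M i = Conj (Eqv (V 7 (i * Suc M)) (V 0 i)) (Eqv (V 8 (i * Suc M + M)) (V 1 i))"

definition next_fm :: "nat \<Rightarrow> nat \<Rightarrow> nat \<Rightarrow> fm" where
  "next_fm M i m = Dis (Eqv (V 8 (i * Suc M + m)) (V 7 (i * Suc M + Suc m)))
     (Conj (Tab vA [V 8 (i * Suc M + m), V 7 (i * Suc M + Suc m)])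
       (Ex 12 (Ex 13 (conjs [Tab vE [12, V 0 i, V 8 (i * Suc M + m)],
          Tab vE [13, V 0 i, V 7 (i * Suc M + Suc m)], Plus 12 vO 13]))))"

definition separated_fm :: "nat \<Rightarrow> nat \<Rightarrow> nat \<Rightarrow> fm" where
  "separated_fm M S S' = (if S div Suc M = S' div Suc M then Tru else Dis (Eqv (V 4 S) (V 4 S'))
     (Neg (Ex 15 (Conj (interval_fm 15 (V 7 S) (V 8 S)) (interval_fm 15 (V 7 S') (V 8 S'))))))"

definition valid_fm :: "nat \<Rightarrow> nat \<Rightarrow> fm" where
  "valid_fm k M = (let K = k * Suc M in conjs [conjs (map diagonal_fm [0..<K]), conjs (map (orientation_fm M) [0..<K]),
     conjs (map (ends_fm M) [0..<k]), conjs (map (\<lambda>i. conjs (map (next_fm M i) [0..<M])) [0..<k]),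
     conjs (map (\<lambda>S. conjs (map (separated_fm M S) [0..<K])) [0..<K])])"

definition guessed :: "nat \<Rightarrow> nat list" where
  "guessed K = concat (map (\<lambda>c. map (V c) [0..<K]) [2, 3, 4, 5, 7, 8])"

text \<open>The last time is n - 1, because every pebble has arrived by then;
  \<open>Plus 10 vO vN\<close> selects this value.\<close>

definition accept_fm :: "nat \<Rightarrow> nat \<Rightarrow> fm" where
  "accept_fm k M = Exs (guessed (k * Suc M)) (Ex 10 (conjs [Plus 10 vO vN, Tab vR (rsR (k * Suc M) 10 5), valid_fm k M]))"

section \<open>Correctness of the formulas\<close>

context terminals
begin

definition dist_table :: "nat list \<Rightarrow> bool" where "dist_table vs \<longleftrightarrow> is_gdist (vs ! 0) (vs ! 1) (vs ! 2)"

definition sweep_table :: "nat list \<Rightarrow> bool" where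
  "sweep_table vs \<longleftrightarrow> sweep (vs ! 0) (\<lambda>S. vs ! (1 + S)) (\<lambda>S. vs ! (1 + K + S)) (\<lambda>S. vs ! (1 + 2 * K + S))
     (\<lambda>S. vs ! (1 + 3 * K + S))"

abbreviation (input) vals :: "(nat \<Rightarrow> nat) \<Rightarrow> nat \<Rightarrow> nat \<Rightarrow> nat" where "vals e c \<equiv> \<lambda>S. e (V c S)"

lemma sweep_table_map: "sweep_table (map e (rsR K \<tau> c)) \<longleftrightarrow>
   sweep (e \<tau>) (vals e 2) (vals e 3) (vals e 4) (vals e c)"
proof -
  have 0: "map e (rsR K \<tau> c) ! 0 = e \<tau>" by (simp add: rsR_def)
  have 1: "map e (rsR K \<tau> c) ! (1 + S) = e (V 2 S)" "map e (rsR K \<tau> c) ! (1 + K + S) = e (V 3 S)"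
    "map e (rsR K \<tau> c) ! (1 + 2 * K + S) = e (V 4 S)" "map e (rsR K \<tau> c) ! (1 + 3 * K + S) = e (V c S)"
    if "S < K" for S
    using that unfolding rsR_def by (simp_all add: nth_append del: mult_Suc_right)
  show ?thesis unfolding sweep_table_def 0 by (rule sweep_cong) (simp only: 1 simp_thms)
qed

text \<open>The memory layout: the adjacency matrix is followed by the distance table and then by
  the sweep table.\<close>

definition envOK :: "(nat \<Rightarrow> nat) \<Rightarrow> bool" where
  "envOK e \<longleftrightarrow> e vZ = 0 \<and> e vO = 1 \<and> e vN = n \<and> e vE = e vA + n ^ 2 \<and> e vR = e vE + n ^ 3 \<and>
     (\<forall>i<k. e (V 0 i) = s i \<and> e (V 1 i) = t i)"

definition adjOK :: "nat \<Rightarrow> (nat \<Rightarrow> nat) \<Rightarrow> bool" where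
  "adjOK b \<mu> \<longleftrightarrow> (\<forall>u<n. \<forall>v<n. nonzero \<mu> (b + horner n [u, v]) \<longleftrightarrow> (u, v) \<in> A)"

definition distOK :: "nat \<Rightarrow> (nat \<Rightarrow> nat) \<Rightarrow> bool" where
  "distOK b \<mu> \<longleftrightarrow> (\<forall>a<n. \<forall>u<n. \<forall>v<n. nonzero \<mu> (b + horner n [a, u, v]) \<longleftrightarrow> is_gdist a u v)"

lemma is_gdist_0: "is_gdist 0 u v \<longleftrightarrow> u = v" by (auto simp: is_gdist_def)

text \<open>The predecessor of \<open>v\<close> on a shortest walk is at distance exactly
  \<open>a\<close> from \<open>u\<close>, since a shorter walk to it would shorten the walk to
  \<open>v\<close>.\<close>

lemma is_gdist_Suc:
  assumes "u < n"
  shows "is_gdist (Suc a) u v \<longleftrightarrow> (\<exists>w<n. is_gdist a u w \<and> (w, v) \<in> A) \<and> \<not> (\<exists>b\<le>a. is_gdist b u v)"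
proof
  assume *: "is_gdist (Suc a) u v"
  then obtain w where w: "(u, w) \<in> A ^^ a" "(w, v) \<in> A" by (auto simp: is_gdist_def)
  have "gdist u w = a"
  proof (rule ccontr)
    assume "gdist u w \<noteq> a"
    then have "gdist u w < a" using gdist_le[OF w(1)] by simp
    moreover have "(u, v) \<in> A ^^ Suc (gdist u w)" using gdist_relpow[OF relpow_conn[OF w(1)]] w(2) by auto
    ultimately show False using * unfolding is_gdist_def by (meson Suc_less_eq)
  qed
  then have "is_gdist a u w" using relpow_conn[OF w(1)] by (simp add: is_gdist_iff)
  moreover have "w < n" using w(2) A_sub by auto
  ultimately show "(\<exists>w<n. is_gdist a u w \<and> (w, v) \<in> A) \<and> \<not> (\<exists>b\<le>a. is_gdist b u v)"
    using w(2) * by (auto simp: is_gdist_iff)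
next
  assume *: "(\<exists>w<n. is_gdist a u w \<and> (w, v) \<in> A) \<and> \<not> (\<exists>b\<le>a. is_gdist b u v)"
  then have p: "(u, v) \<in> A ^^ Suc a" by (auto simp: is_gdist_def)
  then have "conn u v" "gdist u v \<le> Suc a" using relpow_conn gdist_le by blast+
  then show "is_gdist (Suc a) u v" using * unfolding is_gdist_iff by (metis le_Suc_eq)
qed

lemma horner_bound: "u < n \<Longrightarrow> v < n \<Longrightarrow> horner n [u, v] < n ^ 2"
  "a < n \<Longrightarrow> u < n \<Longrightarrow> v < n \<Longrightarrow> horner n [a, u, v] < n ^ 3"
  using horner_less[of "[u, v]" n] horner_less[of "[a, u, v]" n] by (auto simp: power2_eq_square power3_eq_cube)

text \<open>The table is only partly filled, but every lookup in it is guarded by a comparison that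
  puts it into a lower row. The matrix lies below the table and is not affected by filling.\<close>

lemma sat_dist_fm:
  assumes e: "envOK e" and v: "e 10 < n" "e 16 < n" "e 17 < n"
    and D: "D \<subseteq> vecs n 3" "below n 3 (e 10) \<subseteq> D"
    and adj: "adjOK (e vA) \<mu>" and zero: "\<And>a. e vE \<le> a \<Longrightarrow> \<mu> a = 0"
  shows "sat n (filled n (e vE) dist_table \<mu> D) e dist_fm \<longleftrightarrow> dist_table [e 10, e 16, e 17]"
proof -
  let ?\<mu> = "filled n (e vE) dist_table \<mu> D"
  have Aa: "nonzero ?\<mu> (e vA + horner n [x, y]) \<longleftrightarrow> (x, y) \<in> A" if "x < n" "y < n" for x y
    using adj filled_below[of "e vA + horner n [x, y]" "e vE" n dist_table \<mu> D] e horner_bound(1)[OF that] that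
    unfolding adjOK_def envOK_def nonzero_def by auto
  have E: "nonzero ?\<mu> (e vE + horner n [a, x, y]) \<longleftrightarrow> is_gdist a x y" if "a < e 10" "x < n" "y < n" for a x y
  proof -
    have "[a, x, y] \<in> D"
      by (rule subsetD[OF D(2)]) (use that v in \<open>simp add: below_def vecs_def\<close>)
    from filled_in[OF this D(1) zero] show ?thesis by (simp add: dist_table_def nonzero_def)
  qed
  have ev: "e vZ = 0" "e vO = 1" using e by (auto simp: envOK_def)
  have "sat n ?\<mu> e dist_fm \<longleftrightarrow> e 10 = 0 \<and> e 16 = e 17 \<or>
     (\<exists>a<n. a + 1 = e 10 \<and> (\<exists>w<n. is_gdist a (e 16) w \<and> (w, e 17) \<in> A)) \<and>
     \<not> (\<exists>a<n. a < e 10 \<and> is_gdist a (e 16) (e 17))"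
    using v unfolding dist_fm_def by (simp add: ev E Aa cong: conj_cong)
  also have "\<dots> \<longleftrightarrow> is_gdist (e 10) (e 16) (e 17)"
  proof (cases "e 10")
    case 0
    then show ?thesis using is_gdist_0 by auto
  next
    case (Suc a)
    have "(\<exists>b<n. b < e 10 \<and> is_gdist b (e 16) (e 17)) \<longleftrightarrow> (\<exists>b\<le>a. is_gdist b (e 16) (e 17))"
      using Suc v(1) by (metis Suc_leI le_imp_less_Suc less_Suc_eq_le less_trans order_le_less_trans)
    then show ?thesis using is_gdist_Suc[OF v(2), of a "e 17"] Suc v(1) by auto
  qed
  finally show ?thesis by (simp add: dist_table_def)
qed

text \<open>Writes the function \<open>p\<close> into the family \<open>c\<close>; the quotient
  inverts \<open>V c\<close>.\<close>

definition setV :: "nat \<Rightarrow> (nat \<Rightarrow> nat) \<Rightarrow> (nat \<Rightarrow> nat) \<Rightarrow> nat \<Rightarrow> nat" where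
  "setV c p e = (\<lambda>v. if v \<in> V c ` {..<K} then p ((v - 20 - c) div 10) else e v)"

lemma setV_same: "S < K \<Longrightarrow> setV c p e (V c S) = p S"
  by (auto simp: setV_def V_def)

lemma setV_other: "c < 10 \<Longrightarrow> c' < 10 \<Longrightarrow> c' \<noteq> c \<Longrightarrow> setV c p e (V c' S) = e (V c' S)"
  by (auto simp: setV_def V_eq)

definition bounded :: "nat \<Rightarrow> (nat \<Rightarrow> nat) \<Rightarrow> bool" where
  "bounded c e \<longleftrightarrow> (\<forall>S<K. e (V c S) < n)"

lemma sat_position_fm:
  assumes e: "envOK e" and \<mu>: "distOK (e vE) \<mu>" and b: "e 10 < n" "bounded 2 e" "bounded 3 e" "bounded 4 e" "bounded 5 e"
    and S: "S < K"
  shows "sat n \<mu> e (position_fm S) \<longleftrightarrow> position_ok (e 10) (e (V 2 S)) (e (V 3 S)) (e (V 4 S)) (e (V 5 S))"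
proof -
  have E: "nonzero \<mu> (e vE + horner n [a, x, y]) \<longleftrightarrow> is_gdist a x y" if "a < n" "x < n" "y < n" for a x y
    using \<mu> that unfolding distOK_def by blast
  have v: "e (V 2 S) < n" "e (V 3 S) < n" "e (V 4 S) < n" "e (V 5 S) < n"
    using b S unfolding bounded_def by blast+
  have ev: "e vZ = 0" "e vO = 1" using e by (auto simp: envOK_def)
  show ?thesis using b(1) v unfolding position_fm_def position_ok_def
    by (simp add: ev E cong: conj_cong)
qed

lemma sat_collision_fm:
  assumes e: "envOK e" and S: "S < K" "S' < K"
  shows "sat n \<mu> e (collision_fm M S S') \<longleftrightarrow> (path_of S \<noteq> path_of S' \<longrightarrow> collision_ok (vals e 5) S S')"
  using e K_less[OF S(1)] K_less[OF S(2)] unfolding collision_fm_def collision_ok_def envOK_def by simp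

lemma sat_sweep_ok_fm:
  assumes "envOK e" "distOK (e vE) \<mu>" "e 10 < n" "bounded 2 e" "bounded 3 e" "bounded 4 e" "bounded 5 e"
  shows "sat n \<mu> e (sweep_ok_fm M K) \<longleftrightarrow>
    sweep_ok (e 10) (vals e 2) (vals e 3) (vals e 4) (vals e 5)"
  using sat_position_fm[OF assms] sat_collision_fm[OF assms(1)] unfolding sweep_ok_fm_def sweep_ok_def
  by (auto simp del: mult_Suc_right)

lemma in_vecs: "map e (rsR K \<tau> c) \<in> vecs n (1 + 4 * K) \<longleftrightarrow>
    e \<tau> < n \<and> bounded 2 e \<and> bounded 3 e \<and> bounded 4 e \<and> bounded c e"
  unfolding vecs_def rsR_def bounded_def
  by (auto simp: image_subset_iff simp del: mult_Suc_right)

lemma adjOK_filled: "b + n ^ 2 \<le> base \<Longrightarrow> adjOK b (filled n base P \<mu> D) \<longleftrightarrow> adjOK b \<mu>"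
proof -
  assume *: "b + n ^ 2 \<le> base"
  have "filled n base P \<mu> D (b + horner n [u, v]) = \<mu> (b + horner n [u, v])" if "u < n" "v < n" for u v
    by (rule filled_below) (use horner_bound(1)[OF that] * in linarith)
  then show ?thesis unfolding adjOK_def nonzero_def by simp
qed

lemma distOK_filled: "b + n ^ 3 \<le> base \<Longrightarrow> distOK b (filled n base P \<mu> D) \<longleftrightarrow> distOK b \<mu>"
proof -
  assume *: "b + n ^ 3 \<le> base"
  have "filled n base P \<mu> D (b + horner n [a, u, v]) = \<mu> (b + horner n [a, u, v])"
    if "a < n" "u < n" "v < n" for a u v
    by (rule filled_below) (use horner_bound(2)[OF that] * in linarith)
  then show ?thesis unfolding distOK_def nonzero_def by simp
qed

lemma sat_sweep_fm:
  assumes e: "envOK e" and b: "e 10 < n" "bounded 2 e" "bounded 3 e" "bounded 4 e" "bounded 5 e"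
    and D: "D \<subseteq> vecs n (1 + 4 * K)" "below n (1 + 4 * K) (e 10) \<subseteq> D"
    and adj: "adjOK (e vA) \<mu>" and dist: "distOK (e vE) \<mu>" and zero: "\<And>a. e vR \<le> a \<Longrightarrow> \<mu> a = 0"
  shows "sat n (filled n (e vR) sweep_table \<mu> D) e (sweep_fm M K) \<longleftrightarrow> sweep_table (map e (rsR K 10 5))"
proof -
  let ?\<mu> = "filled n (e vR) sweep_table \<mu> D"
  let ?lo = "vals e 2" and ?hi = "vals e 3" and ?z = "vals e 4" and ?p = "vals e 5"
  have address_prog: "e vE = e vA + n ^ 2" "e vR = e vE + n ^ 3" using e by (auto simp: envOK_def)
  have adj': "adjOK (e vA) ?\<mu>"
    using adj adjOK_filled[of "e vA" "e vR"] address_prog by simp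
  have dist': "distOK (e vE) ?\<mu>"
    using dist distOK_filled[of "e vE" "e vR"] address_prog by simp
  have Aa: "nonzero ?\<mu> (e vA + horner n [x, y]) \<longleftrightarrow> (x, y) \<in> A" if "x < n" "y < n" for x y
    using adj' that unfolding adjOK_def by blast
  \<comment> \<open>The environments that differ from \<open>e\<close> in family 6 and the time 11
    correspond to the previous configurations \<open>p'\<close>.\<close>
  have step: "(\<exists>e'. (\<forall>v. v \<notin> set (map (V 6) [0..<K]) \<longrightarrow> e' v = (e(11 := a)) v) \<and>
      (\<forall>v\<in>set (map (V 6) [0..<K]). e' v < n) \<and>
      sat n ?\<mu> e' (Conj (Tab vR (rsR K 11 6)) (conjs (map step_fm [0..<K])))) \<longleftrightarrow>
    (\<exists>p'. (\<forall>S<K. p' S < n) \<and> sweep a ?lo ?hi ?z p' \<and> sweep_step p' ?p)" (is "?l \<longleftrightarrow> ?r")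
    if a: "a < e 10" for a
  proof -
    have dsp_prog: "sat n ?\<mu> e' (Conj (Tab vR (rsR K 11 6)) (conjs (map step_fm [0..<K]))) \<longleftrightarrow>
        sweep a ?lo ?hi ?z (vals e' 6) \<and> sweep_step (vals e' 6) ?p"
      if e': "\<And>v. v \<notin> V 6 ` {..<K} \<Longrightarrow> e' v = (e(11 := a)) v" and b6: "bounded 6 e'" for e'
    proof -
      have low: "v < 20 \<Longrightarrow> e' v = (e(11 := a)) v" for v by (rule e') (rule notin_V)
      have oth: "c < 10 \<Longrightarrow> c \<noteq> 6 \<Longrightarrow> e' (V c S) = e (V c S)" for c S
        using e'[of "V c S"] by simp
      have bb: "bounded 2 e'" "bounded 3 e'" "bounded 4 e'" using b oth unfolding bounded_def by auto
      have "map e' (rsR K 11 6) \<in> vecs n (1 + 4 * K)" unfolding in_vecs using low a b bb b6 by simp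
      moreover have "hd (map e' (rsR K 11 6)) = a" using low by (simp add: rsR_def)
      \<comment> \<open>The entry belongs to the row \<open>a\<close>, which is lower than the
        current one and hence already filled.\<close>
      ultimately have "map e' (rsR K 11 6) \<in> D" using D(2) a unfolding below_def by auto
      from filled_in[OF this D(1) zero]
      have "nonzero ?\<mu> (e vR + horner n (map e' (rsR K 11 6))) \<longleftrightarrow> sweep_table (map e' (rsR K 11 6))"
        unfolding nonzero_def by simp
      also have "\<dots> \<longleftrightarrow> sweep a ?lo ?hi ?z (vals e' 6)"
        unfolding sweep_table_map using oth low by (simp add: fun_eq_iff)
      finally have 1: "sat n ?\<mu> e' (Tab vR (rsR K 11 6)) \<longleftrightarrow> sweep a ?lo ?hi ?z (vals e' 6)"
        using low by simp
      have "sat n ?\<mu> e' (step_fm S) \<longleftrightarrow> e' (V 6 S) = ?p S \<or> (e' (V 6 S), ?p S) \<in> A" if "S < K" for S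
      proof -
        have "e' vZ = 0" "e' vA = e vA" "e' (V 5 S) = ?p S" "?p S < n" "e' (V 6 S) < n"
          using low oth e b(5) b6 that unfolding envOK_def bounded_def by simp_all
        then show ?thesis unfolding step_fm_def by (simp add: Aa)
      qed
      then have 2: "sat n ?\<mu> e' (conjs (map step_fm [0..<K])) \<longleftrightarrow> sweep_step (vals e' 6) ?p"
        unfolding sweep_step_def by (auto simp del: mult_Suc_right)
      show ?thesis using 1 2 by (simp only: sat.simps)
    qed
    have set6: "set (map (V 6) [0..<K]) = V 6 ` {..<K}" by (simp add: atLeast0LessThan del: mult_Suc_right)
    show ?thesis
    proof
      assume ?l
      then obtain e' where e': "\<And>v. v \<notin> V 6 ` {..<K} \<Longrightarrow> e' v = (e(11 := a)) v"
        "\<forall>v\<in>V 6 ` {..<K}. e' v < n" "sat n ?\<mu> e' (Conj (Tab vR (rsR K 11 6)) (conjs (map step_fm [0..<K])))"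
        unfolding set6 by blast
      then have "bounded 6 e'" by (simp add: bounded_def)
      then have b6: "bounded 6 e'" .
      have "sweep a ?lo ?hi ?z (vals e' 6)" "sweep_step (vals e' 6) ?p"
        using iffD1[OF dsp_prog[OF e'(1) b6] e'(3)] by auto
      then show ?r using b6[unfolded bounded_def] by (intro exI[of _ "vals e' 6"] conjI)
    next
      assume ?r
      then obtain p' where p': "\<forall>S<K. p' S < n" "sweep a ?lo ?hi ?z p'" "sweep_step p' ?p" by blast
      define e' where "e' = setV 6 p' (e(11 := a))"
      have out: "\<And>v. v \<notin> V 6 ` {..<K} \<Longrightarrow> e' v = (e(11 := a)) v" by (simp add: e'_def setV_def)
      have same: "S < K \<Longrightarrow> e' (V 6 S) = p' S" for S unfolding e'_def by (rule setV_same)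
      have b6: "bounded 6 e'" using p'(1) same unfolding bounded_def by simp
      have "sweep a ?lo ?hi ?z (vals e' 6) \<longleftrightarrow> sweep a ?lo ?hi ?z p'"
        by (rule sweep_cong) (use same in simp)
      moreover have "sweep_step (vals e' 6) ?p" using p'(3) same unfolding sweep_step_def by simp
      ultimately have "sat n ?\<mu> e' (Conj (Tab vR (rsR K 11 6)) (conjs (map step_fm [0..<K])))"
        using dsp_prog[OF out b6] p'(2) by blast
      then show ?l unfolding set6 using out b6 unfolding bounded_def by (intro exI[of _ e']) blast
    qed
  qed
  have ok: "sat n ?\<mu> e (sweep_ok_fm M K) \<longleftrightarrow> sweep_ok (e 10) ?lo ?hi ?z ?p" by (rule sat_sweep_ok_fm[OF e dist' b])
  have vals: "?lo S < n \<and> ?hi S < n \<and> ?z S < n" if "S < K" for S using b that unfolding bounded_def by blast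
  have "sat n ?\<mu> e (sweep_fm M K) \<longleftrightarrow> sweep_ok (e 10) ?lo ?hi ?z ?p \<and> (e 10 = 0 \<or> (\<exists>a<n. a + 1 = e 10 \<and>
     (\<exists>p'. (\<forall>S<K. p' S < n) \<and> sweep a ?lo ?hi ?z p' \<and> sweep_step p' ?p)))"
  proof -
    have "sat n ?\<mu> (e(11 := a)) (Conj (Plus 11 vO 10) (Exs (map (V 6) [0..<K]) (Conj (Tab vR (rsR K 11 6)) (conjs (map step_fm [0..<K])))))
      \<longleftrightarrow> a + 1 = e 10 \<and> (\<exists>p'. (\<forall>S<K. p' S < n) \<and> sweep a ?lo ?hi ?z p' \<and> sweep_step p' ?p)" for a
    proof -
      have 1: "sat n ?\<mu> (e(11 := a)) (Plus 11 vO 10) \<longleftrightarrow> a + 1 = e 10" using e by (simp add: envOK_def)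
      show ?thesis
      proof (cases "a + 1 = e 10")
        case True
        then have "a < e 10" by simp
        show ?thesis unfolding sat.simps(4)[of _ _ _ "Plus 11 vO 10"] sat_Exs 1 step[OF \<open>a < e 10\<close>] ..
      qed (simp only: sat.simps(4)[of _ _ _ "Plus 11 vO 10"] 1 simp_thms)
    qed
    moreover have "sat n ?\<mu> e (Eqv 10 vZ) \<longleftrightarrow> e 10 = 0" using e by (simp add: envOK_def)
    ultimately show ?thesis unfolding sweep_fm_def sat.simps(4,5) sat_basic(2) ok by blast
  qed
  also have "\<dots> \<longleftrightarrow> sweep (e 10) ?lo ?hi ?z ?p"
  proof (cases "e 10")
    case 0
    then show ?thesis using sweep_0 by simp
  next
    case (Suc a)
    then show ?thesis using sweep_Suc[of ?lo ?hi ?z a ?p, OF vals] b(1) by auto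
  qed
  also have "\<dots> \<longleftrightarrow> sweep_table (map e (rsR K 10 5))" by (simp only: sweep_table_map)
  finally show ?thesis .
qed

lemma sat_interval_fm:
  assumes "envOK e" "distOK (e vE) \<mu>" "e v < n" "e x < n" "e y < n" "v \<notin> {12, 13, 14}" "20 \<le> x" "20 \<le> y"
  shows "sat n \<mu> e (interval_fm v x y) \<longleftrightarrow> between (e v) (e x) (e y)"
proof -
  have E: "nonzero \<mu> (e vE + horner n [a, x, y]) \<longleftrightarrow> is_gdist a x y" if "a < n" "x < n" "y < n" for a x y
    using assms(2) that unfolding distOK_def by blast
  have ev: "e vZ = 0" "e vO = 1" using assms(1) by (auto simp: envOK_def)
  show ?thesis using assms(3-8) unfolding interval_fm_def between_def by (simp add: ev E cong: conj_cong)
qed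

lemma sat_valid_fm:
  assumes e: "envOK e" and adj: "adjOK (e vA) \<mu>" and dist: "distOK (e vE) \<mu>"
    and b: "bounded 2 e" "bounded 3 e" "bounded 4 e" "bounded 7 e" "bounded 8 e"
  shows "sat n \<mu> e (valid_fm k M) \<longleftrightarrow>
    valid (vals e 2) (vals e 3) (vals e 4) (vals e 7) (vals e 8)"
proof -
  have E: "nonzero \<mu> (e vE + horner n [a, x, y]) \<longleftrightarrow> is_gdist a x y" if "a < n" "x < n" "y < n" for a x y
    using dist that unfolding distOK_def by blast
  have Aa: "nonzero \<mu> (e vA + horner n [x, y]) \<longleftrightarrow> (x, y) \<in> A" if "x < n" "y < n" for x y
    using adj that unfolding adjOK_def by blast
  have ev: "e vZ = 0" "e vO = 1" using e by (auto simp: envOK_def)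
  have eV: "e (V 0 i) = s i" "e (V (Suc 0) i) = t i" if "i < k" for i using e that by (auto simp: envOK_def)
  have v: "e (V 2 S) < n" "e (V 3 S) < n" "e (V 4 S) < n" "e (V 7 S) < n" "e (V 8 S) < n" if "S < K" for S
    using b that unfolding bounded_def by blast+
  have 1: "sat n \<mu> e (diagonal_fm S) \<longleftrightarrow> between (e (V 2 S)) (e (V 4 S)) (e (V 3 S))" if "S < K" for S
    unfolding diagonal_fm_def by (rule sat_interval_fm[OF e dist]) (use v[OF that] V_ge in simp_all)
  have 2: "sat n \<mu> e (orientation_fm M S) \<longleftrightarrow> (e (V 7 S) = e (V 2 S) \<and> e (V 8 S) = e (V 3 S) \<or>
       e (V 7 S) = e (V 3 S) \<and> e (V 8 S) = e (V 2 S)) \<and> between (e (V 7 S)) (s (path_of S)) (e (V 8 S))" if "S < K" for S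
    unfolding orientation_fm_def using sat_interval_fm[OF e dist, of "V 7 S" "V 0 (path_of S)" "V 8 S"] V_ge
      v[OF that] st[OF K_less[OF that]] eV[OF K_less[OF that]] by (simp add: ev)
  have 3: "sat n \<mu> e (ends_fm M i) \<longleftrightarrow> e (V 7 (i * Suc M)) = s i \<and> e (V 8 (i * Suc M + M)) = t i" if "i < k" for i
    unfolding ends_fm_def using eV[OF that] by (simp add: ev)
  have 4: "sat n \<mu> e (next_fm M i m) \<longleftrightarrow> e (V 8 (i * Suc M + m)) = e (V 7 (i * Suc M + Suc m)) \<or>
        (e (V 8 (i * Suc M + m)), e (V 7 (i * Suc M + Suc m))) \<in> A \<and>
        (\<exists>a<n. \<exists>b<n. is_gdist a (s i) (e (V 8 (i * Suc M + m))) \<and> is_gdist b (s i) (e (V 7 (i * Suc M + Suc m))) \<and> Suc a = b)"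
    if i: "i < k" "m < M" for i m
  proof -
    have S: "i * Suc M + m < K" "i * Suc M + Suc m < K"
      using segment_index(1)[OF i(1), of m] segment_index(1)[OF i(1), of "Suc m"] i(2) by auto
    define S S' where "S = i * Suc M + m" and "S' = i * Suc M + Suc m"
    show ?thesis
      unfolding next_fm_def S_def[symmetric] S'_def[symmetric]
      using v[OF S(1)] v[OF S(2)] st[OF i(1)] eV[OF i(1)]
      unfolding S_def[symmetric] S'_def[symmetric]
      by (simp add: ev E Aa cong: conj_cong)
  qed
  have 5: "sat n \<mu> e (separated_fm M S S') \<longleftrightarrow> (path_of S \<noteq> path_of S' \<longrightarrow> e (V 4 S) = e (V 4 S') \<or>
     \<not> (\<exists>v<n. between v (e (V 7 S)) (e (V 8 S)) \<and> between v (e (V 7 S')) (e (V 8 S'))))"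
    if S: "S < K" "S' < K" for S S'
  proof -
    have "sat n \<mu> (e(15 := x)) (interval_fm 15 (V 7 S) (V 8 S)) \<longleftrightarrow> between x (e (V 7 S)) (e (V 8 S))"
      if "x < n" "S < K" for x S
      using sat_interval_fm[of "e(15 := x)" \<mu> 15 "V 7 S" "V 8 S"] e dist v[OF that(2)] that(1) V_ge
      by (simp add: envOK_def)
    then show ?thesis unfolding separated_fm_def using S by (auto simp: ev)
  qed
  show ?thesis
    unfolding valid_fm_def Let_def sat_conjs_Cons sat_conjs_Nil valid_def simp_thms
    by (intro arg_cong2[where f = "(\<and>)"] sat_conjs_map 1 2 3 4 5)
qed

lemma set_guessed: "set (guessed K) = (\<Union>c\<in>{2, 3, 4, 5, 7, 8}. V c ` {..<K})"
  unfolding guessed_def by (auto simp del: mult_Suc_right)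

lemma sat_accept_fm:
  assumes e: "envOK e" and adj: "adjOK (e vA) \<mu>" and dist: "distOK (e vE) \<mu>"
    and tab: "\<And>vs. vs \<in> vecs n (1 + 4 * K) \<Longrightarrow> nonzero \<mu> (e vR + horner n vs) \<longleftrightarrow> sweep_table vs"
    and n: "0 < n"
  shows "sat n \<mu> e (accept_fm k M) \<longleftrightarrow> accepted"
proof -
  have inner: "sat n \<mu> e' (Ex 10 (conjs [Plus 10 vO vN, Tab vR (rsR K 10 5), valid_fm k M])) \<longleftrightarrow>
      sweep (n - 1) (vals e' 2) (vals e' 3) (vals e' 4) (vals e' 5) \<and>
      valid (vals e' 2) (vals e' 3) (vals e' 4) (vals e' 7) (vals e' 8)"
    if out: "\<And>v. v \<notin> set (guessed K) \<Longrightarrow> e' v = e v"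
      and b: "bounded 2 e'" "bounded 3 e'" "bounded 4 e'" "bounded 5 e'" "bounded 7 e'" "bounded 8 e'" for e'
  proof -
    have low: "v < 20 \<Longrightarrow> e' v = e v" for v by (rule out) (simp add: set_guessed del: mult_Suc_right)
    have 01: "e' (V 0 i) = e (V 0 i)" "e' (V 1 i) = e (V 1 i)" for i
      by (rule out, simp add: set_guessed del: mult_Suc_right)+
    have "sat n \<mu> (e'(10 := x)) (conjs [Plus 10 vO vN, Tab vR (rsR K 10 5), valid_fm k M]) \<longleftrightarrow>
      x = n - 1 \<and> sweep (n - 1) (vals e' 2) (vals e' 3) (vals e' 4) (vals e' 5) \<and>
      valid (vals e' 2) (vals e' 3) (vals e' 4) (vals e' 7) (vals e' 8)" (is "_ = ?r")
      if x: "x < n" for x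
    proof -
      let ?e = "e'(10 := x)"
      have eOK: "envOK ?e" using e low 01 unfolding envOK_def by simp
      have bb: "bounded 2 ?e" "bounded 3 ?e" "bounded 4 ?e" "bounded 5 ?e" "bounded 7 ?e" "bounded 8 ?e"
        using b unfolding bounded_def by simp_all
      have "sat n \<mu> ?e (valid_fm k M) \<longleftrightarrow>
        valid (vals e' 2) (vals e' 3) (vals e' 4) (vals e' 7) (vals e' 8)"
        using sat_valid_fm[OF eOK _ _ bb(1-3,5,6), of \<mu>] adj dist low by simp
      moreover have "sat n \<mu> ?e (Tab vR (rsR K 10 5)) \<longleftrightarrow>
        sweep x (vals e' 2) (vals e' 3) (vals e' 4) (vals e' 5)"
        using tab[of "map ?e (rsR K 10 5)"] in_vecs[of ?e 10 5] sweep_table_map[of ?e 10 5] x bb low by simp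
      moreover have "sat n \<mu> ?e (Plus 10 vO vN) \<longleftrightarrow> x = n - 1"
        using e low n unfolding envOK_def by auto
      ultimately show ?thesis by auto
    qed
    then show ?thesis unfolding sat.simps(5) using n by (metis diff_less zero_less_one)
  qed
  have bnd: "(\<forall>v\<in>set (guessed K). e' v < n) \<longleftrightarrow> bounded 2 e' \<and> bounded 3 e' \<and> bounded 4 e' \<and> bounded 5 e' \<and> bounded 7 e' \<and> bounded 8 e'" for e'
    unfolding set_guessed bounded_def by auto
  show ?thesis
  proof
    assume "sat n \<mu> e (accept_fm k M)"
    then obtain e' where e': "\<And>v. v \<notin> set (guessed K) \<Longrightarrow> e' v = e v" "\<forall>v\<in>set (guessed K). e' v < n"
      "sat n \<mu> e' (Ex 10 (conjs [Plus 10 vO vN, Tab vR (rsR K 10 5), valid_fm k M]))"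
      unfolding accept_fm_def sat_Exs by blast
    note b = e'(2)[unfolded bnd]
    then have b': "bounded 2 e'" "bounded 3 e'" "bounded 4 e'" "bounded 5 e'" "bounded 7 e'" "bounded 8 e'"
      by simp_all
    have "\<forall>S<K. e' (V 2 S) < n \<and> e' (V 3 S) < n \<and> e' (V 4 S) < n \<and> e' (V 5 S) < n \<and> e' (V 7 S) < n \<and> e' (V 8 S) < n"
      using b' unfolding bounded_def by simp
    moreover have "sweep (n - 1) (vals e' 2) (vals e' 3) (vals e' 4) (vals e' 5)"
      "valid (vals e' 2) (vals e' 3) (vals e' 4) (vals e' 7) (vals e' 8)"
      using iffD1[OF inner[of e', OF _ b'] e'(3)] e'(1) by auto
    ultimately show accepted unfolding accepted_def by meson
  next
    assume accepted
    then obtain lo hi z p x y where a: "\<And>S. S < K \<Longrightarrow> lo S < n \<and> hi S < n \<and> z S < n \<and> p S < n \<and> x S < n \<and> y S < n"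
      "sweep (n - 1) lo hi z p" "valid lo hi z x y"
      unfolding accepted_def by blast
    define e' where "e' = setV 8 y (setV 7 x (setV 5 p (setV 4 z (setV 3 hi (setV 2 lo e)))))"
    have out: "e' v = e v" if "v \<notin> set (guessed K)" for v
      using that unfolding e'_def set_guessed by (simp add: setV_def)
    have eq: "e' (V 2 S) = lo S" "e' (V 3 S) = hi S" "e' (V 4 S) = z S" "e' (V 5 S) = p S" "e' (V 7 S) = x S" "e' (V 8 S) = y S"
      if "S < K" for S
      unfolding e'_def by (simp_all add: setV_other setV_same[OF that])
    have b: "bounded 2 e'" "bounded 3 e'" "bounded 4 e'" "bounded 5 e'" "bounded 7 e'" "bounded 8 e'"
      using a(1) eq unfolding bounded_def by auto
    have "sweep (n - 1) (vals e' 2) (vals e' 3) (vals e' 4) (vals e' 5)"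
      using a(2) sweep_cong[of "vals e' 2" lo "vals e' 3" hi "vals e' 4" z "vals e' 5" p] eq by blast
    moreover have "valid (vals e' 2) (vals e' 3) (vals e' 4) (vals e' 7) (vals e' 8)"
    proof -
      have i: "i * Suc M < K" "i * Suc M + M < K" if "i < k" for i
        using segment_index(1)[OF that, of 0] segment_index(1)[OF that, of M] by auto
      have j: "i * Suc M + m < K" "i * Suc M + Suc m < K" if "i < k" "m < M" for i m
        using segment_index(1)[OF that(1), of m] segment_index(1)[OF that(1), of "Suc m"] that(2) by auto
      show ?thesis using a(3) unfolding valid_def by (simp add: eq i j del: mult_Suc_right add_Suc_right cong: conj_cong)
    qed
    ultimately show "sat n \<mu> e (accept_fm k M)"
      unfolding accept_fm_def sat_Exs using inner[of e', OF out b] out b bnd by blast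
  qed
qed

end

section \<open>The program\<close>

lemma wf_conjs [simp]: "wf_fm (conjs fs) \<longleftrightarrow> (\<forall>f\<in>set fs. wf_fm f)"
  by (induction fs) (auto simp: conjs_def Tru_def)

lemma wf_Exs [simp]: "wf_fm (Exs vs f) \<longleftrightarrow> (\<forall>v\<in>set vs. 5 \<le> v) \<and> wf_fm f"
  by (induction vs) (auto simp: Exs_def)

lemma wf_basic [simp]: "wf_fm Tru" "wf_fm (Eqv a b)" "wf_fm (Leq a b)" "wf_fm (Lss a b)" "wf_fm (Plus a b c)"
  "wf_fm (Dis f g) \<longleftrightarrow> wf_fm f \<and> wf_fm g" "wf_fm (Imp f g) \<longleftrightarrow> wf_fm f \<and> wf_fm g"
  by (auto simp: Tru_def Eqv_def Leq_def Lss_def Plus_def Dis_def Imp_def)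

lemma V_ge5 [simp]: "5 \<le> V c j" by (simp add: V_def)

lemma wf_dist_fm: "wf_fm dist_fm" by (simp add: dist_fm_def)

lemma wf_sweep_fm: "wf_fm (sweep_fm M K)"
  by (auto simp: sweep_fm_def sweep_ok_fm_def position_fm_def collision_fm_def step_fm_def)

lemma wf_accept_fm: "wf_fm (accept_fm k M)"
  by (auto simp: accept_fm_def valid_fm_def Let_def diagonal_fm_def orientation_fm_def ends_fm_def next_fm_def separated_fm_def interval_fm_def guessed_def)

primrec load_terminals :: "nat \<Rightarrow> prog" where
  "load_terminals 0 = Imm (sc 0) 0"
| "load_terminals (Suc i) = Seq (load_terminals i) (Seq (Imm (sc 0) (1 + 2 * i)) (Seq (Load (vr (V 0 i)) (sc 0))
     (Seq (Imm (sc 0) (2 + 2 * i)) (Load (vr (V 1 i)) (sc 0)))))"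

lemma runs_load_terminals:
  "runs (load_terminals i) (\<rho>, \<mu>) (4 * i + 1) (\<lambda>\<sigma>. \<exists>\<rho>'. \<sigma> = (\<rho>', \<mu>) \<and> (\<forall>v<20. \<rho>' (vr v) = \<rho> (vr v)) \<and>
     (\<forall>j<i. \<rho>' (vr (V 0 j)) = \<mu> (1 + 2 * j) \<and> \<rho>' (vr (V 1 j)) = \<mu> (2 + 2 * j)))"
proof (induction i)
  case 0
  show ?case by (auto intro!: runs_Imm)
next
  case (Suc i)
  show ?case
    unfolding load_terminals.simps
    apply (rule runs_Seq[where ?T1.0 = "4 * i + 1" and ?T2.0 = 4])
     apply (rule runs_mono[OF Suc.IH order.refl])
     apply (elim exE conjE)
    subgoal for \<sigma> \<rho>'
      apply hypsubst
      apply (rule runs_Seq[where ?T1.0 = 1 and ?T2.0 = 3])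
       apply (rule runs_Imm, simp)
       apply (rule runs_Seq[where ?T1.0 = 1 and ?T2.0 = 2])
        apply (rule runs_Load, simp)
        apply (rule runs_Seq[where ?T1.0 = 1 and ?T2.0 = 1])
         apply (rule runs_Imm, simp)
         apply (rule runs_Load, simp)
         apply (intro exI conjI, rule refl)
      by (auto simp: V_eq less_Suc_eq)
    by simp
qed

text \<open>The sizes n^2 and n^3 of the tables are obtained as the base-n numerals 100 and 1000, so
  \<open>address_prog\<close> computes the starts of the next tables.\<close>

definition init_prog :: "nat \<Rightarrow> prog" where
  "init_prog k = Seq (Imm (vr vO) 1) (Seq (Load (vr vN) (vr vZ)) (Seq (load_terminals k) (Seq (Imm (vr vA) (1 + 2 * k))
     (Seq (address_prog 0 vA [vO, vZ, vZ]) (Seq (Add (vr vE) (sc 0) (vr vZ))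
     (Seq (address_prog 0 vE [vO, vZ, vZ, vZ]) (Add (vr vR) (sc 0) (vr vZ))))))))"

definition dsp_prog :: "nat \<Rightarrow> nat \<Rightarrow> prog" where
  "dsp_prog k M = (let K = k * Suc M in
     Seq (init_prog k) (Seq (fill 0 [10, 16, 17] (fill_step vE [10, 16, 17] dist_fm))
     (Seq (fill 0 (rsR K 10 5) (fill_step vR (rsR K 10 5) (sweep_fm M K)))
     (Seq (compile 0 (accept_fm k M)) (Add 0 (sc 0) (vr vZ))))))"

definition dsp_time :: "nat \<Rightarrow> nat \<Rightarrow> nat \<Rightarrow> nat" where
  "dsp_time n k M = (let K = k * Suc M in
     (4 * k + 7 * (3 * n + 4) + 12) + (fill_time n (fill_step_time n [10, 16, 17] dist_fm) [10, 16, 17] +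
     (fill_time n (fill_step_time n (rsR K 10 5) (sweep_fm M K)) (rsR K 10 5) + (fm_time n (accept_fm k M) + 1))))"

context terminals
begin

lemma runs_init_prog:
  assumes \<mu>: "\<mu> 0 = n" "\<And>i. i < k \<Longrightarrow> \<mu> (1 + 2 * i) = s i \<and> \<mu> (2 + 2 * i) = t i"
  shows "runs (init_prog k) ((\<lambda>_. 0), \<mu>) (4 * k + 7 * (3 * n + 4) + 12)
    (\<lambda>\<sigma>. \<exists>\<rho>. \<sigma> = (\<rho>, \<mu>) \<and> envOK (env \<rho>) \<and> \<rho> (vr vA) = 1 + 2 * k)"
  unfolding init_prog_def
  apply (rule runs_Seq[where ?T1.0 = 1 and ?T2.0 = "4 * k + 7 * (3 * n + 4) + 11"])
   apply (rule runs_Imm, simp)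
   apply (rule runs_Seq[where ?T1.0 = 1 and ?T2.0 = "4 * k + 7 * (3 * n + 4) + 10"])
    apply (rule runs_Load, simp)
    apply (rule runs_Seq[where ?T1.0 = "4 * k + 1" and ?T2.0 = "7 * (3 * n + 4) + 9"])
     apply (rule runs_mono[OF runs_load_terminals order.refl])
     apply (elim exE conjE)
  subgoal for \<sigma> \<rho>
    apply hypsubst
    apply (rule runs_Seq[where ?T1.0 = 1 and ?T2.0 = "7 * (3 * n + 4) + 8"])
     apply (rule runs_Imm, simp)
     apply (rule runs_Seq[where ?T1.0 = "3 * (3 * n + 4) + 3" and ?T2.0 = "4 * (3 * n + 4) + 5"])
      apply (rule runs_mono[where Q' = Q and Q = Q for Q])
        apply (rule runs_address_prog[where n = n])
    subgoal using \<mu>(1) by (simp add: std_def)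
    subgoal for \<rho>1
        apply (rule runs_Seq[where ?T1.0 = 1 and ?T2.0 = "4 * (3 * n + 4) + 4"])
         apply (rule runs_Add, simp)
         apply (rule runs_Seq[where ?T1.0 = "4 * (3 * n + 4) + 3" and ?T2.0 = 1])
          apply (rule runs_mono[where Q' = Q and Q = Q for Q])
            apply (rule runs_address_prog[where n = n])
      subgoal using \<mu>(1) by (simp add: std_def agree_def)
      subgoal for \<rho>2
          apply (rule runs_Add, simp)
          apply (intro exI conjI, rule refl)
        subgoal using \<mu> by (simp add: envOK_def agree_def horner_def power2_eq_square power3_eq_cube)
        subgoal by (simp add: agree_def)
        done
      by simp_all
    by simp_all
  by simp_all

lemma runs_dsp_prog:
  assumes \<mu>: "\<mu> 0 = n" "\<And>i. i < k \<Longrightarrow> \<mu> (1 + 2 * i) = s i \<and> \<mu> (2 + 2 * i) = t i"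
    and adj: "adjOK (1 + 2 * k) \<mu>" and zero: "\<And>a. 1 + 2 * k + n ^ 2 \<le> a \<Longrightarrow> \<mu> a = 0" and n: "0 < n"
  shows "runs (dsp_prog k M) ((\<lambda>_. 0), \<mu>) (dsp_time n k M) (\<lambda>\<sigma>. fst \<sigma> 0 \<noteq> 0 \<longleftrightarrow> accepted)"
proof -
  define bE where "bE = 1 + 2 * k + n ^ 2"
  define bR where "bR = bE + n ^ 3"
  \<comment> \<open>The memory after the first and after the second filling.\<close>
  define \<mu>1 where "\<mu>1 = filled n bE dist_table \<mu> (vecs n 3)"
  define \<mu>2 where "\<mu>2 = filled n bR sweep_table \<mu>1 (vecs n (1 + 4 * K))"
  have adj1: "adjOK (1 + 2 * k) \<mu>1" unfolding \<mu>1_def using adj adjOK_filled[of _ bE] by (simp add: bE_def)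
  have adj2: "adjOK (1 + 2 * k) \<mu>2" unfolding \<mu>2_def using adj1 adjOK_filled[of _ bR] by (simp add: bE_def bR_def)
  have dist1: "distOK bE \<mu>1"
    unfolding distOK_def \<mu>1_def nonzero_def
  proof (intro allI impI)
    fix a u v assume *: "a < n" "u < n" "v < n"
    have "[a, u, v] \<in> vecs n 3" using * by (simp add: vecs_def)
    from filled_in[OF this order.refl, of bE \<mu> dist_table] zero
    show "filled n bE dist_table \<mu> (vecs n 3) (bE + horner n [a, u, v]) \<noteq> 0 \<longleftrightarrow> is_gdist a u v"
      by (simp add: dist_table_def bE_def)
  qed
  have dist2: "distOK bE \<mu>2" unfolding \<mu>2_def using dist1 distOK_filled[of _ bR] by (simp add: bR_def)
  have zero1: "\<mu>1 a = 0" if "bR \<le> a" for a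
    using filled_above[of bE n 3 a "vecs n 3" dist_table \<mu>] zero[of a] that by (simp add: \<mu>1_def bE_def bR_def)
  have tab: "nonzero \<mu>2 (bR + horner n vs) \<longleftrightarrow> sweep_table vs" if "vs \<in> vecs n (1 + 4 * K)" for vs
    using filled_in[OF that order.refl zero1] unfolding \<mu>2_def nonzero_def by simp
  have envE: "env \<rho> vE = bE \<and> env \<rho> vR = bR" if "envOK (env \<rho>)" "\<rho> (vr vA) = 1 + 2 * k" for \<rho>
    using that unfolding envOK_def bE_def bR_def by simp
  have std: "std n \<rho>" if "envOK (env \<rho>)" for \<rho> using that unfolding envOK_def std_def by simp
  have f1: "runs (fill 0 [10, 16, 17] (fill_step vE [10, 16, 17] dist_fm)) (\<rho>, \<mu>)
      (fill_time n (fill_step_time n [10, 16, 17] dist_fm) [10, 16, 17])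
      (\<lambda>\<sigma>. \<exists>\<rho>'. \<sigma> = (\<rho>', \<mu>1) \<and> envOK (env \<rho>') \<and> \<rho>' (vr vA) = 1 + 2 * k)"
    if \<rho>: "envOK (env \<rho>)" "\<rho> (vr vA) = 1 + 2 * k" for \<rho>
  proof (rule runs_fill[where P = dist_table and n = n])
    show "wf_fm dist_fm" by (rule wf_dist_fm)
    show "std n \<rho>" using std \<rho> by blast
    fix \<rho>' D assume *: "agreeX 0 (set [10, 16, 17]) \<rho> \<rho>'" "\<forall>v\<in>set [10, 16, 17]. env \<rho>' v < n"
      "below n (length [10, 16, 17 :: nat]) (env \<rho>' (hd [10, 16, 17])) \<subseteq> D" "D \<subseteq> vecs n (length [10, 16, 17 :: nat])"
    have e: "envOK (env \<rho>')" "\<rho>' (vr vA) = 1 + 2 * k" "\<rho>' (vr vE) = \<rho> (vr vE)"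
      using \<rho> *(1) by (auto simp: envOK_def agreeX_def)
    show "sat n (filled n (\<rho> (vr vE)) dist_table \<mu> D) (env \<rho>') dist_fm \<longleftrightarrow> dist_table (map (env \<rho>') [10, 16, 17])"
      using sat_dist_fm[OF e(1), of D \<mu>] * e envE[OF e(1,2)] adj zero by (simp add: numeral_3_eq_3[symmetric] bE_def)
  next
    fix \<rho>' assume a: "agreeX 0 (set [10, 16, 17]) \<rho> \<rho>'"
    have e: "envOK (env \<rho>')" "\<rho>' (vr vA) = 1 + 2 * k" using \<rho> a by (auto simp: envOK_def agreeX_def)
    then show "\<exists>\<rho>''. (\<rho>', filled n (\<rho> (vr vE)) dist_table \<mu> (vecs n (length [10, 16, 17 :: nat]))) = (\<rho>'', \<mu>1) \<and>
       envOK (env \<rho>'') \<and> \<rho>'' (vr vA) = 1 + 2 * k"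
      using envE[OF \<rho>] by (simp add: \<mu>1_def numeral_3_eq_3)
  qed simp_all
  have set_rs: "set (rsR K 10 5) = {10} \<union> V 2 ` {..<K} \<union> V 3 ` {..<K} \<union> V 4 ` {..<K} \<union> V 5 ` {..<K}"
    by (auto simp: rsR_def simp del: mult_Suc_right)
  have len_rs: "length (rsR K 10 5) = 1 + 4 * K" by (simp add: rsR_def del: mult_Suc_right)
  have injV: "c < 10 \<Longrightarrow> distinct (map (V c) [0..<K])" for c
    by (auto simp: distinct_map inj_on_def V_eq)
  have disjV: "c < 10 \<Longrightarrow> c' < 10 \<Longrightarrow> c \<noteq> c' \<Longrightarrow> V c ` {0..<K} \<inter> V c' ` {0..<K} = {}" for c c'
    by (auto simp: V_eq)
  have dist_rs: "distinct (rsR K 10 5)"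
    unfolding rsR_def using injV disjV by (simp add: Int_Un_distrib del: mult_Suc_right distinct_upt distinct_map)
  have f2: "runs (fill 0 (rsR K 10 5) (fill_step vR (rsR K 10 5) (sweep_fm M K))) (\<rho>, \<mu>1)
      (fill_time n (fill_step_time n (rsR K 10 5) (sweep_fm M K)) (rsR K 10 5))
      (\<lambda>\<sigma>. \<exists>\<rho>'. \<sigma> = (\<rho>', \<mu>2) \<and> envOK (env \<rho>') \<and> \<rho>' (vr vA) = 1 + 2 * k)"
    if \<rho>: "envOK (env \<rho>)" "\<rho> (vr vA) = 1 + 2 * k" for \<rho>
  proof (rule runs_fill[where P = sweep_table and n = n])
    show "wf_fm (sweep_fm M K)" by (rule wf_sweep_fm)
    show "std n \<rho>" using std \<rho> by blast
    show "rsR K 10 5 \<noteq> []" by (simp add: rsR_def)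
    show "{vZ, vO, vN, vR} \<inter> set (rsR K 10 5) = {}" unfolding set_rs by simp
    have env': "envOK (env \<rho>') \<and> \<rho>' (vr vA) = 1 + 2 * k \<and> \<rho>' (vr vR) = \<rho> (vr vR)"
      if "agreeX 0 (set (rsR K 10 5)) \<rho> \<rho>'" for \<rho>'
    proof -
      have "\<rho>' (vr v) = \<rho> (vr v)" if "v < 10" for v
        using \<open>agreeX 0 (set (rsR K 10 5)) \<rho> \<rho>'\<close> that unfolding agreeX_def set_rs by simp
      moreover have "\<rho>' (vr (V c i)) = \<rho> (vr (V c i))" if "c < 2" for c i
        using \<open>agreeX 0 (set (rsR K 10 5)) \<rho> \<rho>'\<close> that unfolding agreeX_def set_rs by simp
      ultimately show ?thesis using \<rho> unfolding envOK_def by simp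
    qed
    {
      fix \<rho>' D assume *: "agreeX 0 (set (rsR K 10 5)) \<rho> \<rho>'" "\<forall>v\<in>set (rsR K 10 5). env \<rho>' v < n"
        "below n (length (rsR K 10 5)) (env \<rho>' (hd (rsR K 10 5))) \<subseteq> D" "D \<subseteq> vecs n (length (rsR K 10 5))"
      have e: "envOK (env \<rho>')" "\<rho>' (vr vA) = 1 + 2 * k" "\<rho>' (vr vR) = \<rho> (vr vR)" using env'[OF *(1)] by auto
      have b: "env \<rho>' 10 < n" "bounded 2 (env \<rho>')" "bounded 3 (env \<rho>')" "bounded 4 (env \<rho>')" "bounded 5 (env \<rho>')"
        using *(2) unfolding set_rs bounded_def by auto
      have D: "D \<subseteq> vecs n (1 + 4 * K)" "below n (1 + 4 * K) (env \<rho>' 10) \<subseteq> D"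
        using *(3,4) unfolding len_rs by (simp_all add: rsR_def del: mult_Suc_right)
      note eb = envE[OF e(1,2)]
      show "sat n (filled n (\<rho> (vr vR)) sweep_table \<mu>1 D) (env \<rho>') (sweep_fm M K) \<longleftrightarrow> sweep_table (map (env \<rho>') (rsR K 10 5))"
        using sat_sweep_fm[OF e(1) b D, of \<mu>1] adj1 dist1 zero1 e(2,3) eb by simp
    next
      fix \<rho>' assume a: "agreeX 0 (set (rsR K 10 5)) \<rho> \<rho>'"
      then show "\<exists>\<rho>''. (\<rho>', filled n (\<rho> (vr vR)) sweep_table \<mu>1 (vecs n (length (rsR K 10 5)))) = (\<rho>'', \<mu>2) \<and>
         envOK (env \<rho>'') \<and> \<rho>'' (vr vA) = 1 + 2 * k"
        using env'[OF a] envE[OF \<rho>] unfolding len_rs \<mu>2_def by simp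
    }
  qed (rule dist_rs)
  have f3: "runs (Seq (compile 0 (accept_fm k M)) (Add 0 (sc 0) (vr vZ))) (\<rho>, \<mu>2) (fm_time n (accept_fm k M) + 1)
      (\<lambda>\<sigma>. fst \<sigma> 0 \<noteq> 0 \<longleftrightarrow> accepted)" if \<rho>: "envOK (env \<rho>)" "\<rho> (vr vA) = 1 + 2 * k" for \<rho>
    apply (rule runs_Seq[OF _ order.refl])
    apply (rule runs_compile[OF wf_accept_fm std[OF \<rho>(1)]])
    apply (rule runs_Add, simp)
    subgoal for \<rho>'
      using sat_accept_fm[OF \<rho>(1), of \<mu>2] adj2 dist2 tab n envE[OF \<rho>] \<rho> by (simp add: agree_vr envOK_def)
    done
  show ?thesis
    unfolding dsp_prog_def dsp_time_def Let_def
    apply (rule runs_Seq[OF _ order.refl])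
    apply (rule runs_mono[OF runs_init_prog[OF \<mu>] order.refl], assumption)
    apply (elim exE conjE, hypsubst)
    apply (rule runs_Seq[OF _ order.refl])
    apply (rule runs_mono[OF f1 order.refl], assumption, assumption)
    apply (elim exE conjE, hypsubst)
    apply (rule runs_Seq[OF _ order.refl])
    apply (rule runs_mono[OF f2 order.refl], assumption, assumption)
    apply (elim exE conjE, hypsubst)
    by (rule f3)
qed

end

section \<open>Running time\<close>

text \<open>An exponent for \<open>fm_time\<close>. By the next two lemmas an additive constant c
  costs c and every addition costs one more.\<close>

primrec weight :: "fm \<Rightarrow> nat" where
  "weight (Le a b c d) = 4"
| "weight (Tab b rs) = length rs + 9"
| "weight (Neg f) = weight f + 2"
| "weight (Conj f g) = weight f + weight g + 4"
| "weight (Ex v f) = weight f + 13"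

text \<open>For n \<ge> 2 constants can be moved into the exponent; this is why running times are
  bounded for n \<ge> 2 only.\<close>

lemma le_power: "2 \<le> n \<Longrightarrow> m \<le> n ^ m" for m n :: nat
  by (meson less_exp less_imp_le order_trans power_mono zero_le)

lemma add_le_power: "2 \<le> n \<Longrightarrow> a \<le> n ^ p \<Longrightarrow> b \<le> n ^ q \<Longrightarrow> a + b \<le> n ^ (p + q + 1)" for a b n :: nat
proof -
  assume n: "2 \<le> n" and ab: "a \<le> n ^ p" "b \<le> n ^ q"
  have 1: "1 \<le> n ^ p" "1 \<le> n ^ q" using n by simp_all
  have "n ^ p * 1 \<le> n ^ p * n ^ q" "1 * n ^ q \<le> n ^ p * n ^ q"
    by (rule mult_le_mono2[OF 1(2)], rule mult_le_mono1[OF 1(1)])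
  then have "a + b \<le> n ^ p * n ^ q + n ^ p * n ^ q" using ab by linarith
  also have "\<dots> = 2 * (n ^ p * n ^ q)" by simp
  also have "\<dots> \<le> n * (n ^ p * n ^ q)" using n by (rule mult_le_mono1)
  finally show ?thesis by (simp add: power_add)
qed

lemma mult_le_power: "a \<le> n ^ p \<Longrightarrow> b \<le> n ^ q \<Longrightarrow> a * b \<le> n ^ (p + q)" for a b n :: nat
  by (simp add: power_add mult_le_mono)

lemma linear_le_power: "2 \<le> n \<Longrightarrow> 3 * n + 4 \<le> n ^ 4" for n :: nat
proof -
  assume n: "2 \<le> n"
  have "2 ^ 3 \<le> n ^ 3" using n by (rule power_mono) simp
  then have "8 * n \<le> n ^ 3 * n" by simp
  moreover have "3 * n + 4 \<le> 8 * n" using n by simp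
  ultimately show ?thesis by (simp add: power_Suc[symmetric] numeral_eq_Suc mult.commute)
qed

lemma fm_time_le: "2 \<le> n \<Longrightarrow> fm_time n f \<le> n ^ weight f"
proof (induction f)
  case (Le a b c d)
  then show ?case using le_power[of n 4] by simp
next
  case (Tab b rs)
  have "length rs * (3 * n + 4) + 4 \<le> n ^ ((length rs + 4) + 4 + 1)"
    by (rule add_le_power[OF Tab mult_le_power[OF le_power[OF Tab] linear_le_power[OF Tab]] le_power[OF Tab]])
  then show ?case by (simp add: ac_simps)
next
  case (Neg f)
  then show ?case using add_le_power[OF Neg.prems Neg.IH[OF Neg.prems] le_power[OF Neg.prems, of 1]] by simp
next
  case (Conj f g)
  note p = Conj.prems
  have "(fm_time n f + fm_time n g) + 2 \<le> n ^ ((weight f + weight g + 1) + 2 + 1)"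
    by (rule add_le_power[OF p add_le_power[OF p Conj.IH(1)[OF p] Conj.IH(2)[OF p]] le_power[OF p]])
  then show ?case by (simp add: eval_nat_numeral)
next
  case (Ex v f)
  note p = Ex.prems
  have "n * (fm_time n f + 4) + 6 \<le> n ^ ((1 + (weight f + 4 + 1)) + 6 + 1)"
    by (rule add_le_power[OF p mult_le_power[OF _ add_le_power[OF p Ex.IH[OF p] le_power[OF p]]] le_power[OF p]]) simp
  then show ?case by (simp add: eval_nat_numeral)
qed

lemma fill_step_time_le: "2 \<le> n \<Longrightarrow> fill_step_time n rs f \<le> n ^ (weight f + length rs + 11)"
proof -
  assume p: "2 \<le> n"
  have "fm_time n f + (length rs * (3 * n + 4) + 5) \<le> n ^ (weight f + ((length rs + 4) + 5 + 1) + 1)"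
    by (rule add_le_power[OF p fm_time_le[OF p] add_le_power[OF p mult_le_power[OF le_power[OF p] linear_le_power[OF p]] le_power[OF p]]])
  then show ?thesis by (simp add: fill_step_time_def eval_nat_numeral)
qed

lemma fill_time_le: "2 \<le> n \<Longrightarrow> x \<le> n ^ w \<Longrightarrow> fill_time n x rs \<le> n ^ (w + 9 * length rs)"
proof (induction rs)
  case (Cons r rs)
  note p = Cons.prems(1)
  have "n * (fill_time n x rs + 3) + 3 \<le> n ^ ((1 + ((w + 9 * length rs) + 3 + 1)) + 3 + 1)"
    by (rule add_le_power[OF p mult_le_power[OF _ add_le_power[OF p Cons.IH[OF Cons.prems] le_power[OF p]]] le_power[OF p]]) simp
  then show ?case by (simp add: eval_nat_numeral)
qed simp

lemma length_rsR: "length (rsR K \<tau> c) = 1 + 4 * K"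
  by (simp add: rsR_def)

definition dsp_weight :: "nat \<Rightarrow> nat \<Rightarrow> nat" where
  "dsp_weight k M = (let K = k * Suc M in 4 * k + weight dist_fm + 41 + weight (sweep_fm M K) + 40 * K + weight (accept_fm k M) + 100)"

lemma dsp_time_le: "2 \<le> n \<Longrightarrow> dsp_time n k M \<le> n ^ dsp_weight k M"
proof -
  assume p: "2 \<le> n"
  let ?K = "k * Suc M"
  have 1: "4 * k + 7 * (3 * n + 4) + 12 \<le> n ^ ((4 * k + (7 + 4) + 1) + 12 + 1)"
    by (rule add_le_power[OF p add_le_power[OF p le_power[OF p] mult_le_power[OF le_power[OF p] linear_le_power[OF p]]] le_power[OF p]])
  have 2: "fill_time n (fill_step_time n [10, 16, 17] dist_fm) [10, 16, 17] \<le> n ^ ((weight dist_fm + 3 + 11) + 27)"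
    using fill_time_le[OF p fill_step_time_le[OF p, of "[10, 16, 17]" dist_fm], of "[10, 16, 17]"] by simp
  have 3: "fill_time n (fill_step_time n (rsR ?K 10 5) (sweep_fm M ?K)) (rsR ?K 10 5) \<le> n ^ ((weight (sweep_fm M ?K) + (1 + 4 * ?K) + 11) + 9 * (1 + 4 * ?K))"
    using fill_time_le[OF p fill_step_time_le[OF p, of "rsR ?K 10 5" "sweep_fm M ?K"], of "rsR ?K 10 5"] unfolding length_rsR .
  have 4: "fm_time n (accept_fm k M) + 1 \<le> n ^ (weight (accept_fm k M) + 1 + 1)"
    by (rule add_le_power[OF p fm_time_le[OF p] le_power[OF p]])
  have "dsp_time n k M \<le> n ^ (((4 * k + (7 + 4) + 1) + 12 + 1) + (((weight dist_fm + 3 + 11) + 27) +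
     (((weight (sweep_fm M ?K) + (1 + 4 * ?K) + 11) + 9 * (1 + 4 * ?K)) + (weight (accept_fm k M) + 1 + 1) + 1) + 1) + 1)"
    unfolding dsp_time_def Let_def
    by (rule add_le_power[OF p 1 add_le_power[OF p 2 add_le_power[OF p 3 4]]])
  also have "\<dots> \<le> n ^ dsp_weight k M"
    by (rule power_increasing) (use p in \<open>simp_all add: dsp_weight_def Let_def\<close>)
  finally show ?thesis .
qed

lemma weight_basic [simp]:
  "weight Tru = 4" "weight (Eqv a b) = 12" "weight (Leq a b) = 4" "weight (Lss a b) = 4" "weight (Plus a b c) = 12"
  "weight (Dis f g) = weight f + weight g + 10" "weight (Imp f g) = weight f + weight g + 8"
  by (simp_all add: Tru_def Eqv_def Leq_def Lss_def Plus_def Dis_def Imp_def)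

lemma weight_conjs_Cons [simp]: "weight (conjs (f # fs)) = weight f + weight (conjs fs) + 4"
  and weight_conjs_Nil [simp]: "weight (conjs []) = 4"
  by (simp_all add: conjs_def)

lemma weight_Exs [simp]: "weight (Exs vs f) = 13 * length vs + weight f"
  by (induction vs) (simp_all add: Exs_def)

lemma weight_conjs_map: "(\<And>i. i < m \<Longrightarrow> weight (f i) \<le> B) \<Longrightarrow> weight (conjs (map f [0..<m])) \<le> m * (B + 4) + 4"
proof -
  assume B: "\<And>i. i < m \<Longrightarrow> weight (f i) \<le> B"
  have "weight (conjs (map f xs)) \<le> length xs * (B + 4) + 4" if "set xs \<subseteq> {..<m}" for xs
    using that by (induction xs) (auto simp: algebra_simps dest: B)
  from this[of "[0..<m]"] show ?thesis by (simp add: atLeast0LessThan)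
qed

text \<open>Each formula for one block or one pair of blocks has weight at most 300, a generous
  uniform bound. The quadratic growth comes from the conjunctions over all pairs.\<close>

lemma dsp_weight_le: "dsp_weight k M \<le> 10000 * (k * Suc M + 1) ^ 2"
proof -
  let ?K = "k * Suc M"
  have p: "weight (position_fm S) \<le> 300" "weight (collision_fm M S S') \<le> 300" "weight (step_fm S) \<le> 300" "weight (diagonal_fm S) \<le> 300" "weight (orientation_fm M S) \<le> 300"
    "weight (ends_fm M i) \<le> 300" "weight (next_fm M i m) \<le> 300" "weight (separated_fm M S S') \<le> 300" for S S' i m
    by (simp_all add: position_fm_def collision_fm_def step_fm_def diagonal_fm_def orientation_fm_def ends_fm_def next_fm_def separated_fm_def interval_fm_def)
  have ok: "weight (sweep_ok_fm M ?K) \<le> (?K * 304 + 4) + (?K * ((?K * 304 + 4) + 4) + 4) + 4"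
    unfolding sweep_ok_fm_def using weight_conjs_map[of ?K position_fm 300, OF p(1)]
      weight_conjs_map[of ?K "\<lambda>S. conjs (map (collision_fm M S) [0..<?K])" "?K * 304 + 4",
        OF order.trans[OF weight_conjs_map[of ?K _ 300, OF p(2)]]]
    by simp
  have sweep: "weight (sweep_fm M ?K) \<le> weight (sweep_ok_fm M ?K) + 13 * ?K + (1 + 4 * ?K + 9) + (?K * 304 + 4) + 100"
    unfolding sweep_fm_def using weight_conjs_map[of ?K step_fm 300, OF p(3)] by (simp add: length_rsR del: mult_Suc_right)
  have g: "length (guessed ?K) = 6 * ?K" by (simp add: guessed_def del: mult_Suc_right)
  have nx: "weight (conjs (map (\<lambda>i. conjs (map (next_fm M i) [0..<M])) [0..<k])) \<le> ?K * 312 + 4"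
  proof -
    have "weight (conjs (map (\<lambda>i. conjs (map (next_fm M i) [0..<M])) [0..<k])) \<le> k * ((M * 304 + 4) + 4) + 4"
      using weight_conjs_map[of k "\<lambda>i. conjs (map (next_fm M i) [0..<M])" "M * 304 + 4",
        OF order.trans[OF weight_conjs_map[of M _ 300, OF p(7)]]] by simp
    also have "\<dots> \<le> ?K * 312 + 4" by (simp add: algebra_simps)
    finally show ?thesis .
  qed
  have kK: "k \<le> ?K" by simp
  have v: "weight (valid_fm k M) \<le> (?K * 304 + 4) + (?K * 304 + 4) + (k * 304 + 4) + (?K * 312 + 4) +
      (?K * ((?K * 304 + 4) + 4) + 4) + 100"
    unfolding valid_fm_def Let_def
    using weight_conjs_map[of ?K diagonal_fm 300, OF p(4)] weight_conjs_map[of ?K "orientation_fm M" 300, OF p(5)]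
      weight_conjs_map[of k "ends_fm M" 300, OF p(6)] nx
      weight_conjs_map[of ?K "\<lambda>S. conjs (map (separated_fm M S) [0..<?K])" "?K * 304 + 4",
        OF order.trans[OF weight_conjs_map[of ?K _ 300, OF p(8)]]]
    by (simp del: mult_Suc_right)
  have acc: "weight (accept_fm k M) \<le> 13 * (6 * ?K) + (1 + 4 * ?K + 9) + weight (valid_fm k M) + 100"
    unfolding accept_fm_def by (simp add: length_rsR g del: mult_Suc_right)
  have dist: "weight dist_fm \<le> 300" by (simp add: dist_fm_def)
  have "dsp_weight k M \<le> 10000 + 10000 * ?K + 1000 * (?K * ?K)"
    unfolding dsp_weight_def Let_def using ok sweep v acc dist kK by (simp add: algebra_simps)
  also have "\<dots> \<le> 10000 * (?K + 1) ^ 2" by (simp add: power2_eq_square algebra_simps)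
  finally show ?thesis .
qed

section \<open>The size of the exponent\<close>

definition blocks :: "nat \<Rightarrow> nat" where "blocks k = 2 * (1 + 4 * k * k) ^ (k * k)"

lemma five_power: "4 \<le> k \<Longrightarrow> 10 * (k * k) + 6 \<le> (5::nat) ^ k"
proof (induction k rule: dec_induct)
  case (step k)
  have sq: "10 * (Suc k * Suc k) + 6 = 10 * (k * k) + 20 * k + 16" by simp
  have "10 * x + 20 * k + 16 \<le> 5 * (10 * x + 6)" if "k \<le> x" for x :: nat using that by simp
  from this[of "k * k"] have "10 * (Suc k * Suc k) + 6 \<le> 5 * (10 * (k * k) + 6)" unfolding sq by simp
  also have "\<dots> \<le> 5 * 5 ^ k" using step by simp
  finally show ?case by simp
qed simp

text \<open>From k = 4 on, constant factors are absorbed by powers of k: 1 + 4k^2 is at most k^5 and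
  the final factor 4 at most k^2. Squaring leaves the exponent 10k^2 + 6, which
  \<open>five_power\<close> compares with 5^k.\<close>

lemma exponent_le: "4 \<le> k \<Longrightarrow> 10000 * (k * Suc (blocks k) + 1) ^ 2 \<le> 10000 * k ^ (5 ^ k)"
proof -
  assume k: "4 \<le> k"
  have k2: "4 \<le> k ^ 2" using power_mono[OF k, of 2] by simp
  have k3: "5 \<le> k ^ 3" using power_mono[OF k, of 3] by simp
  have kk: "1 \<le> k * k" using k by (cases k) auto
  have "1 + 4 * k * k \<le> 5 * k ^ 2" using kk by (simp add: power2_eq_square)
  also have "\<dots> \<le> k ^ 3 * k ^ 2" using k3 by (rule mult_le_mono1)
  also have "\<dots> = k ^ 5" by (simp flip: power_add)
  finally have "(1 + 4 * k * k) ^ (k * k) \<le> (k ^ 5) ^ (k * k)" by (rule power_mono) simp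
  then have b: "blocks k \<le> 2 * k ^ (5 * (k * k))" unfolding blocks_def by (simp add: power_mult)
  have one: "1 \<le> k ^ (5 * (k * k))" using k by simp
  have "k * Suc (blocks k) + 1 \<le> k * (3 * k ^ (5 * (k * k))) + k * k ^ (5 * (k * k))"
  proof (rule add_mono)
    show "k * Suc (blocks k) \<le> k * (3 * k ^ (5 * (k * k)))"
      by (rule mult_le_mono2) (use b one in linarith)
    show "1 \<le> k * k ^ (5 * (k * k))" using k by simp
  qed
  also have "\<dots> = 4 * k ^ (5 * (k * k) + 1)" by simp
  also have "\<dots> \<le> k ^ 2 * k ^ (5 * (k * k) + 1)" using k2 by (rule mult_le_mono1)
  also have "\<dots> = k ^ (5 * (k * k) + 3)"
  proof -
    have "5 * (k * k) + 3 = 2 + (5 * (k * k) + 1)" by simp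
    then show ?thesis by (simp only: power_add)
  qed
  finally have "(k * Suc (blocks k) + 1) ^ 2 \<le> (k ^ (5 * (k * k) + 3)) ^ 2" by (rule power_mono) simp
  also have "\<dots> = k ^ (10 * (k * k) + 6)" by (simp flip: power_mult)
  also have "\<dots> \<le> k ^ (5 ^ k)" by (rule power_increasing[OF five_power[OF k]]) (use k in simp)
  finally show ?thesis by simp
qed

lemma exponent_bigo: "(\<lambda>k. real (10000 * (k * Suc (blocks k) + 1) ^ 2)) \<in> O(\<lambda>k. real (k ^ (5 ^ k)))"
proof (rule bigoI[where c = 10000])
  show "\<forall>\<^sub>F k in at_top. norm (real (10000 * (k * Suc (blocks k) + 1) ^ 2)) \<le> 10000 * norm (real (k ^ (5 ^ k)))"
    using eventually_ge_at_top[of 4]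
  proof eventually_elim
    case (elim k)
    have "real (10000 * (k * Suc (blocks k) + 1) ^ 2) \<le> real (10000 * k ^ (5 ^ k))"
      using exponent_le[OF elim] by (rule of_nat_mono)
    then show ?case by simp
  qed
qed

section \<open>From arc lists to vertex functions\<close>

lemma apath_with_proj: "pre_digraph.apath (with_proj G) u p v \<longleftrightarrow>
    u \<in> pverts G \<and> set p \<subseteq> parcs G \<and> pcas u p v \<and> distinct (pawalk_verts u p)"
  by (simp add: pre_digraph.apath_def pre_digraph.awalk_def cas_with_proj_eq awalk_verts_with_proj_eq)

lemma length_pawalk_verts [simp]: "length (pawalk_verts u p) = Suc (length p)"
  by (induction p arbitrary: u) auto

lemma pawalk_verts_nth:
  "pcas u p v \<Longrightarrow> pawalk_verts u p ! 0 = u \<and> pawalk_verts u p ! length p = v \<and>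
    (\<forall>j<length p. p ! j = (pawalk_verts u p ! j, pawalk_verts u p ! Suc j))"
proof (induction p arbitrary: u)
  case (Cons e p)
  have IH: "pawalk_verts (snd e) p ! 0 = snd e" "pawalk_verts (snd e) p ! length p = v"
    "\<forall>j<length p. p ! j = (pawalk_verts (snd e) p ! j, pawalk_verts (snd e) p ! Suc j)"
    using Cons.IH[of "snd e"] Cons.prems by auto
  show ?case using IH Cons.prems by (auto simp: nth_Cons' less_Suc_eq_0_disj prod_eq_iff)
qed simp

lemma pcas_map:
  "pcas (f a) (map (\<lambda>j. (f j, f (Suc j))) [a..<a + l]) (f (a + l))"
  "pawalk_verts (f a) (map (\<lambda>j. (f j, f (Suc j))) [a..<a + l]) = map f [a..<Suc (a + l)]"
proof (induction l arbitrary: a)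
  case (Suc l)
  {
    case 1
    show ?case using Suc.IH(1)[of "Suc a"] by (simp add: upt_conv_Cons del: upt_Suc)
  next
    case 2
    show ?case using Suc.IH(2)[of "Suc a"] by (simp add: upt_conv_Cons del: upt_Suc)
  }
qed simp_all

section \<open>Positions in the encoded input\<close>

lemma nth_concat_blocks:
  "i < length us \<Longrightarrow> v < n \<Longrightarrow> concat (map (\<lambda>u. map (f u) [0..<n]) us) ! (i * n + v) = f (us ! i) v"
proof (induction us arbitrary: i)
  case (Cons u us)
  show ?case
  proof (cases i)
    case 0
    then show ?thesis using Cons.prems by (simp add: nth_append)
  next
    case (Suc i')
    then show ?thesis using Cons by (simp add: nth_append)
  qed
qed simp

lemma length_concat_blocks: "length (concat (map (\<lambda>u. map (f u) [0..<n]) us)) = length us * n"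
  by (induction us) auto

lemma nth_concat_pairs:
  "i < length st \<Longrightarrow> concat (map (\<lambda>(s, t). [s, t]) st) ! (2 * i) = fst (st ! i) \<and>
     concat (map (\<lambda>(s, t). [s, t]) st) ! (2 * i + 1) = snd (st ! i)"
proof (induction st arbitrary: i)
  case (Cons x st)
  show ?case using Cons by (cases x; cases i) auto
qed simp

lemma length_concat_pairs: "length (concat (map (\<lambda>(s, t). [s, t]) st)) = 2 * length st"
  by (induction st) auto

locale dsp = fixes k :: nat and G :: "nat pair_pre_digraph" and ps :: "(nat \<times> nat) list"
  assumes is_instance: "is_instance k G ps" and k_pos: "1 \<le> k"
begin

definition n :: nat where "n = card (pverts G)"
definition src :: "nat \<Rightarrow> nat" where "src i = fst (ps ! i)"
definition tgt :: "nat \<Rightarrow> nat" where "tgt i = snd (ps ! i)"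

lemma pverts: "pverts G = {..<n}" and len: "length ps = k" and graph: "pair_graph G"
  and in_verts: "i < k \<Longrightarrow> src i < n \<and> tgt i < n"
  using is_instance unfolding is_instance_def n_def src_def tgt_def
  by (auto, (metis (no_types, lifting) mem_Sigma_iff nth_mem prod.collapse subsetD lessThan_iff)+)

sublocale terminals n "parcs G" k "blocks k" src tgt
proof
  interpret pair_graph G by (rule graph)
  show "parcs G \<subseteq> {..<n} \<times> {..<n}" using pverts wellformed' by auto
  show "sym (parcs G)" using pair_sym_arcs unfolding symmetric_def by simp
qed (use in_verts in blast)

lemma n_pos: "0 < n" using in_verts[of 0] k_pos by auto

lemma apath_walk:
  assumes "pre_digraph.apath (with_proj G) u p v"
  defines "f \<equiv> \<lambda>j. pawalk_verts u p ! j"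
  shows "f 0 = u" "f (length p) = v" "\<forall>j<length p. (f j, f (Suc j)) \<in> parcs G" "gdist u v \<le> length p" "conn u v"
proof -
  have *: "pcas u p v" "set p \<subseteq> parcs G" using assms(1) by (auto simp: apath_with_proj)
  show 1: "f 0 = u" "f (length p) = v" using pawalk_verts_nth[OF *(1)] by (auto simp: f_def)
  show 2: "\<forall>j<length p. (f j, f (Suc j)) \<in> parcs G"
    using pawalk_verts_nth[OF *(1)] *(2) unfolding f_def by (metis nth_mem subsetD)
  then have "(u, v) \<in> parcs G ^^ length p" unfolding relpow_fun_conv using 1 by blast
  then show "gdist u v \<le> length p" "conn u v" using gdist_le relpow_conn by blast+
qed

definition arcs_of :: "(nat \<Rightarrow> nat) \<Rightarrow> nat \<Rightarrow> (nat \<times> nat) list" where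
  "arcs_of f l = map (\<lambda>j. (f j, f (Suc j))) [0..<l]"

lemma verts_arcs_of: "pawalk_verts (f 0) (arcs_of f l) = map f [0..<Suc l]"
  using pcas_map(2)[of f 0 l] by (simp add: arcs_of_def)

text \<open>The vertices are pairwise distinct because they are at different distances from
  \<open>u\<close>.\<close>

lemma spath_apath:
  assumes f: "spath f u v" and u: "u < n"
  shows "pre_digraph.apath (with_proj G) u (arcs_of f (gdist u v)) v"
proof -
  have f0: "f 0 = u" "f (gdist u v) = v" "\<forall>i<gdist u v. (f i, f (Suc i)) \<in> parcs G" using f by (auto simp: spath_def)
  have "inj_on f {0..<Suc (gdist u v)}"
    by (rule inj_onI) (metis f spath_gdist0 atLeastLessThan_iff less_Suc_eq_le)
  then have "distinct (pawalk_verts (f 0) (arcs_of f (gdist u v)))"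
    unfolding verts_arcs_of by (simp add: distinct_map del: upt_Suc)
  moreover have "pcas (f 0) (arcs_of f (gdist u v)) (f (gdist u v))"
    using pcas_map(1)[of f 0 "gdist u v"] by (simp add: arcs_of_def)
  moreover have "set (arcs_of f (gdist u v)) \<subseteq> parcs G" using f0(3) by (auto simp: arcs_of_def)
  ultimately show ?thesis using f0 u pverts by (simp add: apath_with_proj)
qed

lemma shortest_path_iff:
  assumes "u < n"
  shows "pre_digraph.shortest_path (with_proj G) u p v \<longleftrightarrow>
    pre_digraph.apath (with_proj G) u p v \<and> length p = gdist u v"
proof
  assume *: "pre_digraph.shortest_path (with_proj G) u p v"
  then have ap: "pre_digraph.apath (with_proj G) u p v" by (simp add: pre_digraph.shortest_path_def)
  obtain f where "spath f u v" using spath_ex[OF apath_walk(5)[OF ap]] by blast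
  from spath_apath[OF this assms] have "length p \<le> length (arcs_of f (gdist u v))"
    using * unfolding pre_digraph.shortest_path_def by blast
  then show "pre_digraph.apath (with_proj G) u p v \<and> length p = gdist u v"
    using ap apath_walk(4)[OF ap] by (simp add: arcs_of_def)
next
  assume "pre_digraph.apath (with_proj G) u p v \<and> length p = gdist u v"
  then show "pre_digraph.shortest_path (with_proj G) u p v"
    unfolding pre_digraph.shortest_path_def using apath_walk(4) by metis
qed

text \<open>The inner vertices are the tails of all arcs but the first, which are the vertices at
  the positions strictly between the ends.\<close>

lemma set_inner_verts:
  assumes "pcas u p v"
  shows "set (pre_digraph.inner_verts (with_proj G) p) = {pawalk_verts u p ! a |a. 0 < a \<and> a < length p}"
proof -
  have "x \<in> set (tl (map fst p)) \<longleftrightarrow> (\<exists>a. 0 < a \<and> a < length p \<and> x = fst (p ! a))" for x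
  proof (cases p)
    case (Cons e p')
    have "(\<exists>a. 0 < a \<and> a < length p \<and> x = fst (p ! a)) \<longleftrightarrow> (\<exists>b<length p'. x = fst (p' ! b))" (is "?l \<longleftrightarrow> ?r")
    proof
      show "?l \<Longrightarrow> ?r" unfolding Cons by (auto simp: gr0_conv_Suc)
      assume ?r
      then obtain b where "b < length p'" "x = fst (p' ! b)" by blast
      then show ?l unfolding Cons by (intro exI[of _ "Suc b"]) simp
    qed
    moreover have "x \<in> set (tl (map fst p)) \<longleftrightarrow> (\<exists>b<length p'. x = fst (p' ! b))"
      unfolding Cons by (simp only: list.map list.sel in_set_conv_nth length_map) (metis nth_map)
    ultimately show ?thesis by (simp only:)
  qed simp
  then have "set (tl (map fst p)) = {fst (p ! a) |a. 0 < a \<and> a < length p}" by blast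
  also have "\<dots> = {pawalk_verts u p ! a |a. 0 < a \<and> a < length p}"
    using pawalk_verts_nth[OF assms] by (metis (no_types, lifting) fst_conv)
  finally show ?thesis by (simp add: inner_verts_with_proj_def)
qed

lemma set_pawalk_verts: "set (pawalk_verts u p) = {pawalk_verts u p ! b |b. b \<le> length p}"
  unfolding set_conv_nth by (auto simp: less_Suc_eq_le)

lemma disjoint_iff_solvable: "pre_digraph.has_disjoint_shortest_paths (with_proj G) ps \<longleftrightarrow> solvable"
proof
  assume "pre_digraph.has_disjoint_shortest_paths (with_proj G) ps"
  then obtain P where P: "\<And>i. i < k \<Longrightarrow> pre_digraph.shortest_path (with_proj G) (src i) (P ! i) (tgt i)"
    "\<And>i j. i < k \<Longrightarrow> j < k \<Longrightarrow> i \<noteq> j \<Longrightarrow>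
      set (pre_digraph.inner_verts (with_proj G) (P ! i)) \<inter> set (pawalk_verts (src j) (P ! j)) = {}"
    unfolding pre_digraph.has_disjoint_shortest_paths_def awalk_verts_with_proj_eq len src_def tgt_def by blast
  have ap: "pre_digraph.apath (with_proj G) (src i) (P ! i) (tgt i)" "length (P ! i) = gdist (src i) (tgt i)" if "i < k" for i
    using P(1)[OF that] shortest_path_iff in_verts that by blast+
  have c: "pcas (src i) (P ! i) (tgt i)" if "i < k" for i using ap(1)[OF that] by (simp add: apath_with_proj)
  define f where "f i j = pawalk_verts (src i) (P ! i) ! j" for i j
  show solvable
    unfolding solvable_def
  proof (rule exI[of _ f], intro allI impI conjI)
    fix i assume i: "i < k"
    show "spath (f i) (src i) (tgt i)"
      using apath_walk[OF ap(1)[OF i]] unfolding spath_def f_def ap(2)[OF i] by blast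
    fix j a b assume *: "j < k" "j \<noteq> i" "0 < a" "a < gdist (src i) (tgt i)" "b \<le> gdist (src j) (tgt j)"
    have "f i a \<in> set (pre_digraph.inner_verts (with_proj G) (P ! i))"
      unfolding set_inner_verts[OF c[OF i]] f_def ap(2)[OF i] using * by blast
    moreover have "f j b \<in> set (pawalk_verts (src j) (P ! j))"
      unfolding set_pawalk_verts f_def ap(2)[OF *(1)] using * by blast
    ultimately show "f i a \<noteq> f j b" using P(2)[OF i *(1)] *(2) by (metis IntI empty_iff)
  qed
next
  assume solvable
  then obtain f where F: "\<forall>i<k. spath (f i) (src i) (tgt i) \<and> (\<forall>j<k. j \<noteq> i \<longrightarrow>
     (\<forall>a b. 0 < a \<longrightarrow> a < gdist (src i) (tgt i) \<longrightarrow> b \<le> gdist (src j) (tgt j) \<longrightarrow> f i a \<noteq> f j b))"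
    unfolding solvable_def by (rule exE)
  define p where "p i = arcs_of (f i) (gdist (src i) (tgt i))" for i
  have ap: "pre_digraph.apath (with_proj G) (src i) (p i) (tgt i)" if "i < k" for i
    unfolding p_def using spath_apath F in_verts that by blast
  have lp: "length (p i) = gdist (src i) (tgt i)" for i by (simp add: p_def arcs_of_def)
  have nth: "pawalk_verts (src i) (p i) ! a = f i a" if "i < k" "a \<le> gdist (src i) (tgt i)" for i a
  proof -
    have "f i 0 = src i" using F that(1) by (simp add: spath_def)
    then have "pawalk_verts (src i) (p i) = map (f i) [0..<Suc (gdist (src i) (tgt i))]"
      using verts_arcs_of[of "f i" "gdist (src i) (tgt i)"] by (simp add: p_def)
    then show ?thesis using that(2) by (simp del: upt_Suc)
  qed
  show "pre_digraph.has_disjoint_shortest_paths (with_proj G) ps"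
    unfolding pre_digraph.has_disjoint_shortest_paths_def awalk_verts_with_proj_eq len
      src_def[symmetric] tgt_def[symmetric]
  proof (intro exI[of _ "map p [0..<k]"] conjI allI impI)
    fix i assume i: "i < k"
    show "pre_digraph.shortest_path (with_proj G) (src i) (map p [0..<k] ! i) (tgt i)"
      using shortest_path_iff in_verts ap lp i by simp
    fix j assume j: "j < k" "i \<noteq> j"
    have ci: "pcas (src i) (p i) (tgt i)" using ap[OF i] by (simp add: apath_with_proj)
    show "set (pre_digraph.inner_verts (with_proj G) (map p [0..<k] ! i)) \<inter> set (pawalk_verts (src j) (map p [0..<k] ! j)) = {}"
    proof -
      have "pawalk_verts (src i) (p i) ! a \<noteq> pawalk_verts (src j) (p j) ! b"
        if "0 < a" "a < length (p i)" "b \<le> length (p j)" for a b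
        using F i j that nth[OF i, of a] nth[OF j(1), of b] unfolding lp by simp
      then show ?thesis
        using i j set_inner_verts[OF ci] set_pawalk_verts[of "src j" "p j"] by auto
    qed
  qed simp
qed

lemma initial_memory:
  fixes xs defines "xs \<equiv> encode G ps"
  defines "\<mu> \<equiv> \<lambda>i. if i < length xs then xs ! i else 0"
  shows "\<mu> 0 = n" "\<And>i. i < k \<Longrightarrow> \<mu> (1 + 2 * i) = src i \<and> \<mu> (2 + 2 * i) = tgt i"
    "adjOK (1 + 2 * k) \<mu>" "\<And>a. 1 + 2 * k + n ^ 2 \<le> a \<Longrightarrow> \<mu> a = 0"
proof -
  let ?A = "concat (map (\<lambda>(s, t). [s, t]) ps)"
  let ?B = "concat (map (\<lambda>u. map (\<lambda>v. of_bool ((u, v) \<in> parcs G) :: nat) [0..<n]) [0..<n])"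
  have xs: "xs = n # ?A @ ?B" by (simp add: xs_def encode_def Let_def n_def)
  have lA: "length ?A = 2 * k" and lB: "length ?B = n * n"
    using length_concat_pairs[of ps] length_concat_blocks[of "\<lambda>u v. of_bool ((u, v) \<in> parcs G) :: nat" n "[0..<n]"] len
    by simp_all
  have lxs: "length xs = 1 + 2 * k + n * n" using lA lB by (simp add: xs)
  show "\<mu> 0 = n" by (simp add: \<mu>_def xs)
  show "\<mu> (1 + 2 * i) = src i \<and> \<mu> (2 + 2 * i) = tgt i" if "i < k" for i
  proof -
    have "\<mu> (1 + 2 * i) = ?A ! (2 * i)" "\<mu> (2 + 2 * i) = ?A ! (2 * i + 1)"
      using that lA unfolding \<mu>_def lxs by (simp_all add: xs nth_append)
    then show ?thesis using nth_concat_pairs[of i ps] that len by (simp add: src_def tgt_def)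
  qed
  show "adjOK (1 + 2 * k) \<mu>"
    unfolding adjOK_def nonzero_def
  proof (intro allI impI)
    fix u v assume uv: "u < n" "v < n"
    have h: "horner n [u, v] = u * n + v" by (simp add: horner_def)
    have "u * n + v < n * n" using horner_bound(1)[OF uv] h by (simp add: power2_eq_square)
    then have "\<mu> (1 + 2 * k + horner n [u, v]) = ?B ! (u * n + v)"
      unfolding \<mu>_def lxs h by (simp add: xs nth_append lA)
    also have "\<dots> = of_bool ((u, v) \<in> parcs G)"
      using nth_concat_blocks[of u "[0..<n]" v n "\<lambda>u v. of_bool ((u, v) \<in> parcs G) :: nat"] uv by simp
    finally show "\<mu> (1 + 2 * k + horner n [u, v]) \<noteq> 0 \<longleftrightarrow> (u, v) \<in> parcs G" by simp
  qed
  show "\<mu> a = 0" if "1 + 2 * k + n ^ 2 \<le> a" for a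
    using that unfolding \<mu>_def lxs by (simp add: power2_eq_square)
qed

text \<open>For n = 1 every power of n is 1, so the bound starts at n = 2; the answer is correct for
  every instance.\<close>

lemma dsp_prog_answers:
  "\<exists>T. answers (dsp_prog k (blocks k)) (encode G ps) (pre_digraph.has_disjoint_shortest_paths (with_proj G) ps) T \<and>
     (2 \<le> n \<longrightarrow> T \<le> n ^ (10000 * (k * Suc (blocks k) + 1) ^ 2))"
proof -
  have iff: "accepted \<longleftrightarrow> solvable" using accepted_imp_solvable solvable_imp_accepted by (auto simp: blocks_def)
  obtain T \<sigma> where T: "exec (dsp_prog k (blocks k)) (initial_state (encode G ps)) T \<sigma>"
    "T \<le> dsp_time n k (blocks k)" "fst \<sigma> 0 \<noteq> 0 \<longleftrightarrow> accepted"
    using runs_dsp_prog[OF initial_memory n_pos] unfolding runs_def initial_state_def by blast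
  have "answers (dsp_prog k (blocks k)) (encode G ps) (pre_digraph.has_disjoint_shortest_paths (with_proj G) ps) T"
    unfolding answers_def disjoint_iff_solvable using T(1,3) iff by (cases \<sigma>) auto
  moreover have "T \<le> n ^ (10000 * (k * Suc (blocks k) + 1) ^ 2)" if n2: "2 \<le> n"
  proof -
    have "T \<le> n ^ dsp_weight k (blocks k)" using T(2) dsp_time_le[OF n2] by (rule order_trans)
    also have "\<dots> \<le> n ^ (10000 * (k * Suc (blocks k) + 1) ^ 2)"
      by (rule power_increasing[OF dsp_weight_le]) (use n2 in simp)
    finally show ?thesis .
  qed
  ultimately show ?thesis by blast
qed

end

theorem theorem1:
  shows "\<exists>g :: nat \<Rightarrow> nat.
    (\<lambda>k. real (g k)) \<in> O(\<lambda>k. real (k ^ (5 ^ k))) \<and>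
    (\<forall>k\<ge>1. \<exists>p :: prog. \<forall>G st. is_instance k G st \<longrightarrow>
      (\<exists>T. answers p (encode G st)
             (pre_digraph.has_disjoint_shortest_paths (with_proj G) st) T \<and>
           (card (pverts G) \<ge> 2 \<longrightarrow> T \<le> card (pverts G) ^ g k)))"
proof (rule exI[of _ "\<lambda>k. 10000 * (k * Suc (blocks k) + 1) ^ 2"], intro conjI allI impI)
  \<comment> \<open>The factor 10000 belongs to the exponent and is absorbed by the Landau symbol
    there.\<close>
  show "(\<lambda>k. real (10000 * (k * Suc (blocks k) + 1) ^ 2)) \<in> O(\<lambda>k. real (k ^ (5 ^ k)))"
    by (rule exponent_bigo)
  fix k :: nat assume k: "1 \<le> k"
  show "\<exists>p :: prog. \<forall>G st. is_instance k G st \<longrightarrow>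
      (\<exists>T. answers p (encode G st)
             (pre_digraph.has_disjoint_shortest_paths (with_proj G) st) T \<and>
           (card (pverts G) \<ge> 2 \<longrightarrow> T \<le> card (pverts G) ^ (10000 * (k * Suc (blocks k) + 1) ^ 2)))"
  proof (rule exI[of _ "dsp_prog k (blocks k)"], intro allI impI)
    fix G st assume "is_instance k G st"
    then interpret dsp k G st using k by unfold_locales
    show "\<exists>T. answers (dsp_prog k (blocks k)) (encode G st) (pre_digraph.has_disjoint_shortest_paths (with_proj G) st) T \<and>
           (card (pverts G) \<ge> 2 \<longrightarrow> T \<le> card (pverts G) ^ (10000 * (k * Suc (blocks k) + 1) ^ 2))"
      using dsp_prog_answers unfolding n_def .
  qed
qed

end
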